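(* Let $k$ be a field, $R=k[x_1,\dots,x_n]$, and let $I,J,K$ be monomial ideals of $R$ such that $I=J+K$ and $\mathcal{G}(I)$ is the disjoint union of $\mathcal{G}(J)$ and $\mathcal{G}(K)$. Consider the short exact sequence $$(\ddagger)\qquad 0\longrightarrow J\cap K \stackrel{\varphi}{\longrightarrow} J\oplus K \stackrel{\psi}{\longrightarrow} J+K=I\longrightarrow 0,$$ where $\varphi(f)=(f,-f)$ and $\psi(g,h)=g+h$. Then the following are equivalent: (a) $I=J+K$ is a Betti splitting. (b) For all $i\in\mathbb{N}$ and all (multi)degrees $j$, the map $$\operatorname{Tor}_i(k,J\cap K)_j \stackrel{\varphi_i}{\longrightarrow} \operatorname{Tor}_i(k,J)_j\oplus\operatorname{Tor}_i(k,K)_j$$ in the long exact sequence in $\operatorname{Tor}$ induced from $(\ddagger)$ is the zero map. (c) Applying the mapping cone construction to $(\ddagger)$ gives a minimal free resolution of $I$.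
   Context: $\mathcal{G}(L)$ denotes the unique set of minimal monomial generators of a monomial ideal $L$. The ring $R$ is graded either by the standard grading ($\deg x_i=1$) or by the standard multigrading ($\deg x_i$ is the $i$-th unit vector of $\mathbb{N}^n$); "(multi)degree" means a degree in whichever of these two gradings has been chosen, and the result is asserted for either choice. $\operatorname{Tor}$ is taken over $R$, and $\beta_{i,j}(L)=\dim_k\operatorname{Tor}_i(k,L)_j$ is the $i,j$-th (multi)graded Betti number, with $\beta_{-1,j}=0$. Betti splitting: if $\mathcal{G}(I)$ is the disjoint union of $\mathcal{G}(J)$ and $\mathcal{G}(K)$, then $I=J+K$ is a Betti splitting if $\beta_{i,j}(I)=\beta_{i,j}(J)+\beta_{i,j}(K)+\beta_{i-1,j}(J\cap K)$ for all $i\in\mathbb{N}$ and all (multi)degrees $j$. The mapping cone construction applied to $(\ddagger)$ means: take minimal (multi)graded free resolutions of $J\cap K$ and of $J\oplus K$ (the latter the direct sum of minimal resolutions of $J$ and $K$), lift $\varphi$ to a (multi)graded chain map between them, and form the mapping cone of this chain map; it is a free resolution of $I$. *)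

theory Defs
  imports Complex_Main "HOL-Library.Poly_Mapping" "HOL-Library.Product_Plus"
    "HOL-Library.Set_Algebras"
begin

section \<open>Monomial ideals\<close>

text \<open>
  The polynomial ring is the monoid algebra of the exponent vectors, with the library's
  multiplication on finitely supported functions. The finite type of variables plays the role
  of \<open>x\<^sub>1, \<dots>, x\<^sub>n\<close>.
\<close>

type_synonym ('n, 'k) mpoly = "('n \<Rightarrow>\<^sub>0 nat) \<Rightarrow>\<^sub>0 'k"

definition monomial :: "('n \<Rightarrow>\<^sub>0 nat) \<Rightarrow> ('n, 'k::zero_neq_one) mpoly" where
  "monomial m = Poly_Mapping.single m 1"

definition ideal_gen :: "'r::comm_ring_1 set \<Rightarrow> 'r set" where
  "ideal_gen S = module.span (*) S"

definition monomial_ideal :: "('n, 'k::field) mpoly set \<Rightarrow> bool" where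
  "monomial_ideal L \<longleftrightarrow> (\<exists>S \<subseteq> range monomial. L = ideal_gen S)"

definition min_gens :: "('n, 'k::field) mpoly set \<Rightarrow> ('n, 'k) mpoly set" where
  "min_gens L = (THE S. S \<subseteq> range monomial \<and> ideal_gen S = L \<and> (\<forall>T. T \<subset> S \<longrightarrow> ideal_gen T \<noteq> L))"

definition irrelevant_ideal :: "('n, 'k::field) mpoly set" where
  "irrelevant_ideal = ideal_gen (range (\<lambda>i. monomial (Poly_Mapping.single i 1)))"

text \<open>
  A grading is given by the degree of each monomial. Everything below is parametrised by such a
  degree function, to be instantiated with one of the following two.
\<close>

definition standard_deg :: "('n::finite \<Rightarrow>\<^sub>0 nat) \<Rightarrow> nat" where
  "standard_deg m = (\<Sum>i\<in>UNIV. Poly_Mapping.lookup m i)"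

definition multi_deg :: "('n \<Rightarrow>\<^sub>0 nat) \<Rightarrow> ('n \<Rightarrow>\<^sub>0 nat)" where
  "multi_deg m = m"


section \<open>Graded free modules and graded free resolutions\<close>

text \<open>
  The free module on a finite set \<open>B\<close> consists of the functions supported in \<open>B\<close>. Homomorphisms
  between free modules are matrices, where \<open>A p q\<close> is the coefficient of the target basis
  element \<open>p\<close> in the image of the source basis element \<open>q\<close>.
\<close>

definition free_module :: "'b set \<Rightarrow> ('b \<Rightarrow> 'r::zero) set" where
  "free_module B = {v. \<forall>b. b \<notin> B \<longrightarrow> v b = 0}"

definition mat_app :: "'b set \<Rightarrow> ('c \<Rightarrow> 'b \<Rightarrow> 'r::comm_ring_1) \<Rightarrow> ('b \<Rightarrow> 'r) \<Rightarrow> 'c \<Rightarrow> 'r" where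
  "mat_app B A v = (\<lambda>p. \<Sum>q\<in>B. A p q * v q)"

text \<open>
  Matrices of degree-preserving maps: if \<open>dB\<close> and \<open>dC\<close> are the degrees of the basis elements, then
  a nonzero entry \<open>A p q\<close> is homogeneous of degree \<open>dB q - dC p\<close>. Entries outside \<open>C \<times> B\<close> are
  normalised to zero.
\<close>

definition graded_matrix ::
  "(('n \<Rightarrow>\<^sub>0 nat) \<Rightarrow> 'd::comm_monoid_add) \<Rightarrow> 'b set \<Rightarrow> ('b \<Rightarrow> 'd) \<Rightarrow> 'c set \<Rightarrow> ('c \<Rightarrow> 'd)
    \<Rightarrow> ('c \<Rightarrow> 'b \<Rightarrow> ('n, 'k::field) mpoly) \<Rightarrow> bool" where
  "graded_matrix deg B dB C dC A \<longleftrightarrow>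
     (\<forall>p q. p \<notin> C \<or> q \<notin> B \<longrightarrow> A p q = 0) \<and>
     (\<forall>p\<in>C. \<forall>q\<in>B. \<forall>m\<in>Poly_Mapping.keys (A p q). deg m + dC p = dB q)"

text \<open>
  An augmented complex \<open>\<dots> \<rightarrow> F\<^sub>1 \<rightarrow> F\<^sub>0 \<rightarrow> M\<close> of free modules: \<open>gens F i\<close> is the basis of \<open>F\<^sub>i\<close>,
  \<open>gdeg F i\<close> gives the degrees of the basis elements, \<open>dmat F i\<close> is the matrix of
  \<open>F\<^bsub>i+1\<^esub> \<rightarrow> F\<^sub>i\<close> (note the index shift), and \<open>aug F\<close> gives the images in \<open>M\<close> of the basis of \<open>F\<^sub>0\<close>.
\<close>

record ('b, 'd, 'r, 'm) aug_complex =
  gens :: "nat \<Rightarrow> 'b set"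
  gdeg :: "nat \<Rightarrow> 'b \<Rightarrow> 'd"
  dmat :: "nat \<Rightarrow> 'b \<Rightarrow> 'b \<Rightarrow> 'r"
  aug :: "'b \<Rightarrow> 'm"

definition dmap :: "('b, 'd, 'r::comm_ring_1, 'm) aug_complex \<Rightarrow> nat \<Rightarrow> ('b \<Rightarrow> 'r) \<Rightarrow> 'b \<Rightarrow> 'r" where
  "dmap F i = mat_app (gens F (Suc i)) (dmat F i)"

definition aug_map ::
  "('r \<Rightarrow> 'm \<Rightarrow> 'm) \<Rightarrow> ('b, 'd, 'r::comm_ring_1, 'm::comm_monoid_add) aug_complex \<Rightarrow> ('b \<Rightarrow> 'r) \<Rightarrow> 'm" where
  "aug_map s F v = (\<Sum>b\<in>gens F 0. s (v b) (aug F b))"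

text \<open>
  Since the polynomial ring is Noetherian, it suffices to consider resolutions by free modules of
  finite rank. That the maps compose to zero is part of the exactness conditions.
\<close>

definition graded_resolution ::
  "(('n \<Rightarrow>\<^sub>0 nat) \<Rightarrow> 'd::comm_monoid_add) \<Rightarrow> ('n, 'k::field) mpoly set
    \<Rightarrow> ('b, 'd, ('n, 'k) mpoly, ('n, 'k) mpoly) aug_complex \<Rightarrow> bool" where
  "graded_resolution deg L F \<longleftrightarrow>
     (\<forall>i. finite (gens F i)) \<and>
     (\<forall>i. graded_matrix deg (gens F (Suc i)) (gdeg F (Suc i)) (gens F i) (gdeg F i) (dmat F i)) \<and>
     (\<forall>b\<in>gens F 0. \<forall>m\<in>Poly_Mapping.keys (aug F b). deg m = gdeg F 0 b) \<and>
     aug_map (*) F ` free_module (gens F 0) = L \<and>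
     dmap F 0 ` free_module (gens F 1) = {v \<in> free_module (gens F 0). aug_map (*) F v = 0} \<and>
     (\<forall>i. dmap F (Suc i) ` free_module (gens F (Suc (Suc i))) =
            {v \<in> free_module (gens F (Suc i)). \<forall>p. dmap F i v p = 0})"

definition minimal_complex :: "('b, 'd, ('n, 'k::field) mpoly, 'm) aug_complex \<Rightarrow> bool" where
  "minimal_complex F \<longleftrightarrow>
     (\<forall>i. \<forall>v \<in> free_module (gens F (Suc i)). \<forall>p. dmap F i v p \<in> irrelevant_ideal)"

definition minimal_resolution ::
  "(('n \<Rightarrow>\<^sub>0 nat) \<Rightarrow> 'd::comm_monoid_add) \<Rightarrow> ('n, 'k::field) mpoly set
    \<Rightarrow> ('b, 'd, ('n, 'k) mpoly, ('n, 'k) mpoly) aug_complex \<Rightarrow> bool" where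
  "minimal_resolution deg L F \<longleftrightarrow> graded_resolution deg L F \<and> minimal_complex F"


section \<open>The short exact sequence, lifts and the mapping cone\<close>

definition ses_phi :: "'r::comm_ring_1 \<Rightarrow> 'r \<times> 'r" where
  "ses_phi f = (f, - f)"

definition ses_psi :: "'r::comm_ring_1 \<times> 'r \<Rightarrow> 'r" where
  "ses_psi = (\<lambda>(g, h). g + h)"

definition pair_scale :: "'r::comm_ring_1 \<Rightarrow> 'r \<times> 'r \<Rightarrow> 'r \<times> 'r" where
  "pair_scale r = (\<lambda>(g, h). (r * g, r * h))"

text \<open>The direct sum of complexes over \<open>J\<close> and \<open>K\<close>, augmented to \<open>J \<oplus> K \<subseteq> R \<times> R\<close>.\<close>

definition dsum_complex ::
  "('b, 'd, 'r::comm_ring_1, 'r) aug_complex \<Rightarrow> ('c, 'd, 'r, 'r) aug_complex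
    \<Rightarrow> ('b + 'c, 'd, 'r, 'r \<times> 'r) aug_complex" where
  "dsum_complex F G =
     \<lparr> gens = (\<lambda>i. gens F i <+> gens G i),
       gdeg = (\<lambda>i. case_sum (gdeg F i) (gdeg G i)),
       dmat = (\<lambda>i p q. case (p, q) of
                 (Inl p, Inl q) \<Rightarrow> dmat F i p q
               | (Inr p, Inr q) \<Rightarrow> dmat G i p q
               | _ \<Rightarrow> 0),
       aug = case_sum (\<lambda>b. (aug F b, 0)) (\<lambda>c. (0, aug G c)) \<rparr>"

text \<open>Graded chain maps \<open>\<Phi> : F \<rightarrow> G\<close> lifting \<open>\<phi>\<close>, where \<open>G\<close> is augmented to a submodule of \<open>R \<times> R\<close>.\<close>

definition phi_lift ::
  "(('n \<Rightarrow>\<^sub>0 nat) \<Rightarrow> 'd::comm_monoid_add)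
    \<Rightarrow> ('b, 'd, ('n, 'k::field) mpoly, ('n, 'k) mpoly) aug_complex
    \<Rightarrow> ('c, 'd, ('n, 'k) mpoly, ('n, 'k) mpoly \<times> ('n, 'k) mpoly) aug_complex
    \<Rightarrow> (nat \<Rightarrow> 'c \<Rightarrow> 'b \<Rightarrow> ('n, 'k) mpoly) \<Rightarrow> bool" where
  "phi_lift deg F G \<Phi> \<longleftrightarrow>
     (\<forall>i. graded_matrix deg (gens F i) (gdeg F i) (gens G i) (gdeg G i) (\<Phi> i)) \<and>
     (\<forall>i. \<forall>v \<in> free_module (gens F (Suc i)).
        mat_app (gens F i) (\<Phi> i) (dmap F i v) = dmap G i (mat_app (gens F (Suc i)) (\<Phi> (Suc i)) v)) \<and>
     (\<forall>v \<in> free_module (gens F 0).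
        aug_map pair_scale G (mat_app (gens F 0) (\<Phi> 0) v) = ses_phi (aug_map (*) F v))"

text \<open>
  The mapping cone of \<open>\<Phi> : F \<rightarrow> G\<close>, with \<open>C\<^sub>0 = G\<^sub>0\<close>, \<open>C\<^bsub>i+1\<^esub> = G\<^bsub>i+1\<^esub> \<oplus> F\<^sub>i\<close> and differential
  \<open>(g, f) \<mapsto> (d g + \<Phi> f, - d f)\<close>, augmented by \<open>\<psi>\<close> after the augmentation of \<open>G\<close>.
\<close>

definition mapping_cone ::
  "('b, 'd, 'r::comm_ring_1, 'r) aug_complex \<Rightarrow> ('c, 'd, 'r, 'r \<times> 'r) aug_complex
    \<Rightarrow> (nat \<Rightarrow> 'c \<Rightarrow> 'b \<Rightarrow> 'r) \<Rightarrow> ('c + 'b, 'd, 'r, 'r) aug_complex" where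
  "mapping_cone F G \<Phi> =
     \<lparr> gens = (\<lambda>i. gens G i <+> (case i of 0 \<Rightarrow> {} | Suc l \<Rightarrow> gens F l)),
       gdeg = (\<lambda>i. case_sum (gdeg G i) (gdeg F (i - 1))),
       dmat = (\<lambda>i p q. case (p, q) of
                 (Inl p, Inl q) \<Rightarrow> dmat G i p q
               | (Inl p, Inr q) \<Rightarrow> \<Phi> i p q
               | (Inr p, Inl q) \<Rightarrow> 0
               | (Inr p, Inr q) \<Rightarrow> (case i of 0 \<Rightarrow> 0 | Suc l \<Rightarrow> - dmat F l p q)),
       aug = case_sum (\<lambda>c. ses_psi (aug G c)) (\<lambda>_. 0) \<rparr>"

text \<open>Minimality of the cone is required for all choices made in its construction.\<close>

definition cone_gives_minimal_resolution ::
  "(('n \<Rightarrow>\<^sub>0 nat) \<Rightarrow> 'd::comm_monoid_add) \<Rightarrow> ('n, 'k::field) mpoly set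
    \<Rightarrow> ('n, 'k) mpoly set \<Rightarrow> ('n, 'k) mpoly set \<Rightarrow> bool" where
  "cone_gives_minimal_resolution deg I J K \<longleftrightarrow>
     (\<forall>(F :: (nat, 'd, ('n, 'k) mpoly, ('n, 'k) mpoly) aug_complex)
       (G :: (nat, 'd, ('n, 'k) mpoly, ('n, 'k) mpoly) aug_complex)
       (H :: (nat, 'd, ('n, 'k) mpoly, ('n, 'k) mpoly) aug_complex) \<Phi>.
        minimal_resolution deg (J \<inter> K) F \<and> minimal_resolution deg J G \<and> minimal_resolution deg K H \<and>
        phi_lift deg F (dsum_complex G H) \<Phi> \<longrightarrow>
        minimal_resolution deg I (mapping_cone F (dsum_complex G H) \<Phi>))"


section \<open>Tor and Betti numbers\<close>

text \<open>Quotients of a space \<open>V\<close> of \<open>k\<close>-valued functions by a subspace \<open>W\<close>, and their dimension.\<close>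

definition fcoset :: "('b \<Rightarrow> 'k::field) set \<Rightarrow> ('b \<Rightarrow> 'k) \<Rightarrow> ('b \<Rightarrow> 'k) set" where
  "fcoset W v = {u. (\<lambda>b. u b - v b) \<in> W}"

definition quotient_space :: "('b \<Rightarrow> 'k::field) set \<Rightarrow> ('b \<Rightarrow> 'k) set \<Rightarrow> ('b \<Rightarrow> 'k) set set" where
  "quotient_space V W = fcoset W ` V"

text \<open>\<open>S\<close> is a finite set of representatives of a basis of \<open>V / W\<close>.\<close>

definition quotient_basis ::
  "('b \<Rightarrow> 'k::field) set \<Rightarrow> ('b \<Rightarrow> 'k) set \<Rightarrow> ('b \<Rightarrow> 'k) set \<Rightarrow> bool" where
  "quotient_basis V W S \<longleftrightarrow> finite S \<and> S \<subseteq> V \<and>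
     (\<forall>v\<in>V. \<exists>!c. c \<in> free_module S \<and> v \<in> fcoset W (\<lambda>b. \<Sum>s\<in>S. c s * s b))"

definition quotient_dim :: "('b \<Rightarrow> 'k::field) set \<Rightarrow> ('b \<Rightarrow> 'k) set \<Rightarrow> nat" where
  "quotient_dim V W = (THE d. \<exists>S. quotient_basis V W S \<and> card S = d)"

text \<open>
  Tensoring with \<open>k = R/(x\<^sub>1, \<dots>, x\<^sub>n)\<close> turns a free module over \<open>R\<close> with basis \<open>B\<close> into the
  \<open>k\<close>-vector space with the same basis, and replaces the entries of matrices by their constant
  terms. The part of degree \<open>j\<close> is spanned by the basis elements of degree \<open>j\<close>.
\<close>

definition const_mat :: "('c \<Rightarrow> 'b \<Rightarrow> ('n, 'k::field) mpoly) \<Rightarrow> 'c \<Rightarrow> 'b \<Rightarrow> 'k" where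
  "const_mat A = (\<lambda>p q. Poly_Mapping.lookup (A p q) 0)"

definition tensor_part :: "('b, 'd, ('n, 'k::field) mpoly, 'm) aug_complex \<Rightarrow> nat \<Rightarrow> 'd \<Rightarrow> ('b \<Rightarrow> 'k) set" where
  "tensor_part F i j = free_module {b \<in> gens F i. gdeg F i b = j}"

definition tensor_dmap ::
  "('b, 'd, ('n, 'k::field) mpoly, 'm) aug_complex \<Rightarrow> nat \<Rightarrow> ('b \<Rightarrow> 'k) \<Rightarrow> 'b \<Rightarrow> 'k" where
  "tensor_dmap F i = mat_app (gens F (Suc i)) (const_mat (dmat F i))"

definition tensor_cycles :: "('b, 'd, ('n, 'k::field) mpoly, 'm) aug_complex \<Rightarrow> nat \<Rightarrow> 'd \<Rightarrow> ('b \<Rightarrow> 'k) set" where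
  "tensor_cycles F i j =
     {v \<in> tensor_part F i j. case i of 0 \<Rightarrow> True | Suc l \<Rightarrow> (\<forall>p. tensor_dmap F l v p = 0)}"

definition tensor_boundaries :: "('b, 'd, ('n, 'k::field) mpoly, 'm) aug_complex \<Rightarrow> nat \<Rightarrow> 'd \<Rightarrow> ('b \<Rightarrow> 'k) set" where
  "tensor_boundaries F i j = tensor_dmap F i ` tensor_part F (Suc i) j"

text \<open>
  \<open>Tor\<^sub>i(k, L)\<^sub>j\<close> is the homology of \<open>k \<otimes> F\<close> for a graded free resolution \<open>F\<close> of \<open>L\<close>. The
  resolution is fixed once and for all for each \<open>L\<close>; it need not be minimal.
\<close>

definition chosen_resolution ::
  "(('n \<Rightarrow>\<^sub>0 nat) \<Rightarrow> 'd::comm_monoid_add) \<Rightarrow> ('n, 'k::field) mpoly set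
    \<Rightarrow> (nat, 'd, ('n, 'k) mpoly, ('n, 'k) mpoly) aug_complex" where
  "chosen_resolution deg L = (SOME F. graded_resolution deg L F)"

definition Tor ::
  "(('n \<Rightarrow>\<^sub>0 nat) \<Rightarrow> 'd::comm_monoid_add) \<Rightarrow> nat \<Rightarrow> ('n, 'k::field) mpoly set \<Rightarrow> 'd \<Rightarrow> (nat \<Rightarrow> 'k) set set" where
  "Tor deg i L j =
     quotient_space (tensor_cycles (chosen_resolution deg L) i j)
                    (tensor_boundaries (chosen_resolution deg L) i j)"

definition Tor_zero ::
  "(('n \<Rightarrow>\<^sub>0 nat) \<Rightarrow> 'd::comm_monoid_add) \<Rightarrow> nat \<Rightarrow> ('n, 'k::field) mpoly set \<Rightarrow> 'd \<Rightarrow> (nat \<Rightarrow> 'k) set" where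
  "Tor_zero deg i L j = fcoset (tensor_boundaries (chosen_resolution deg L) i j) (\<lambda>_. 0)"

definition betti ::
  "(('n \<Rightarrow>\<^sub>0 nat) \<Rightarrow> 'd::comm_monoid_add) \<Rightarrow> nat \<Rightarrow> ('n, 'k::field) mpoly set \<Rightarrow> 'd \<Rightarrow> nat" where
  "betti deg i L j =
     quotient_dim (tensor_cycles (chosen_resolution deg L) i j)
                  (tensor_boundaries (chosen_resolution deg L) i j)"

definition betti_splitting ::
  "(('n \<Rightarrow>\<^sub>0 nat) \<Rightarrow> 'd::comm_monoid_add) \<Rightarrow> ('n, 'k::field) mpoly set
    \<Rightarrow> ('n, 'k) mpoly set \<Rightarrow> ('n, 'k) mpoly set \<Rightarrow> bool" where
  "betti_splitting deg I J K \<longleftrightarrow>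
     (\<forall>i j. betti deg i I j =
        betti deg i J j + betti deg i K j + (case i of 0 \<Rightarrow> 0 | Suc l \<Rightarrow> betti deg l (J \<inter> K) j))"

text \<open>
  The map induced by \<open>\<phi>\<close> on \<open>Tor\<close>: lift \<open>\<phi>\<close> to a chain map \<open>\<Phi>\<close> between the chosen resolutions,
  tensor with \<open>k\<close>, and send the class of a cycle \<open>v\<close> to the pair of the classes of the two
  components of its image. All \<open>v\<close> in a class \<open>c\<close> give the same coset, so that the unions are
  single cosets.
\<close>

definition chosen_lift ::
  "(('n \<Rightarrow>\<^sub>0 nat) \<Rightarrow> 'd::comm_monoid_add) \<Rightarrow> ('n, 'k::field) mpoly set \<Rightarrow> ('n, 'k) mpoly set
    \<Rightarrow> nat \<Rightarrow> nat + nat \<Rightarrow> nat \<Rightarrow> ('n, 'k) mpoly" where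
  "chosen_lift deg J K =
     (SOME \<Phi>. phi_lift deg (chosen_resolution deg (J \<inter> K))
                (dsum_complex (chosen_resolution deg J) (chosen_resolution deg K)) \<Phi>)"

definition tensor_lift ::
  "(('n \<Rightarrow>\<^sub>0 nat) \<Rightarrow> 'd::comm_monoid_add) \<Rightarrow> ('n, 'k::field) mpoly set \<Rightarrow> ('n, 'k) mpoly set
    \<Rightarrow> nat \<Rightarrow> (nat \<Rightarrow> 'k) \<Rightarrow> nat + nat \<Rightarrow> 'k" where
  "tensor_lift deg J K i =
     mat_app (gens (chosen_resolution deg (J \<inter> K)) i) (const_mat (chosen_lift deg J K i))"

definition Tor_phi ::
  "(('n \<Rightarrow>\<^sub>0 nat) \<Rightarrow> 'd::comm_monoid_add) \<Rightarrow> ('n, 'k::field) mpoly set \<Rightarrow> ('n, 'k) mpoly set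
    \<Rightarrow> nat \<Rightarrow> 'd \<Rightarrow> (nat \<Rightarrow> 'k) set \<Rightarrow> (nat \<Rightarrow> 'k) set \<times> (nat \<Rightarrow> 'k) set" where
  "Tor_phi deg J K i j c =
     (\<Union>v\<in>c. fcoset (tensor_boundaries (chosen_resolution deg J) i j) (tensor_lift deg J K i v \<circ> Inl),
      \<Union>v\<in>c. fcoset (tensor_boundaries (chosen_resolution deg K) i j) (tensor_lift deg J K i v \<circ> Inr))"

end

theory Submission
  imports Defs "HOL-Library.Function_Algebras"
begin

text \<open>
  The mapping cone of a lift of \<open>\<phi>\<close> to minimal resolutions is always a resolution of \<open>I\<close>, and the
  number of its generators in homological degree \<open>i\<close> and degree \<open>j\<close> is the right-hand side of the
  Betti splitting formula. Since Betti numbers can be computed from any resolution, and a resolution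
  is minimal exactly when each of its generators contributes to a Betti number, (a) and (c) are
  equivalent. The only blocks of the differential of the cone that can contain units are those of
  the lift, so the cone is minimal iff the lift vanishes modulo the maximal ideal. Over minimal
  resolutions this says that \<open>\<phi>\<close> is zero on \<open>Tor\<close>, a condition that does not depend on the
  resolutions or on the lift.
\<close>

section \<open>Homogeneous components\<close>

text \<open>Condition (c) quantifies over all minimal resolutions and lifts, so it yields (a) only
  once such data are known to exist; Tor, too, is read off from resolutions picked by choice, which
  need not be minimal. Existence of minimal resolutions is therefore part of the proof. It is
  carried out in the multigrading, where a homogeneous element has at most one monomial at each
  basis element: all graded pieces of a submodule of the free module on \<open>B\<close> embed into
  the one finite-dimensional space of functions on \<open>B\<close> and increase with the degree,
  and by Dickson's lemma all but finitely many of them are spanned by lower ones. Coarser gradings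
  inherit the resolution. The numerical test for minimality is a dimension count: the cycles of
  degree \<open>j\<close> lie in the span of the generators of degree \<open>j\<close>, so homology
  of that full dimension leaves no room for a nonzero boundary. The map \<open>\<phi>\<close> into a
  direct sum is handled as two lifts of multiplication by the constants 1 and -1. One notion of lift
  thus serves for comparing resolutions, for the components of \<open>\<phi>\<close> and, with
  constant 0, for homotopies.\<close>

abbreviation "lookup \<equiv> Poly_Mapping.lookup"
abbreviation "keys \<equiv> Poly_Mapping.keys"

text \<open>A sum of exponent vectors is zero only if both summands are. Hence the constant term is
  a ring homomorphism onto the field, which is what tensoring with the residue field uses.\<close>

lemma lookup_mult_zero:
  fixes f g :: "('n \<Rightarrow>\<^sub>0 nat) \<Rightarrow>\<^sub>0 'k::semiring_0"
  shows "lookup (f * g) 0 = lookup f 0 * lookup g 0"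
proof -
  have "0 = l + q \<longleftrightarrow> l = 0 \<and> q = 0" for l q :: "'n \<Rightarrow>\<^sub>0 nat"
    by (auto simp: poly_mapping_eq_iff fun_eq_iff lookup_add)
  then have "lookup (f * g) 0 = (\<Sum>l. lookup f l * (\<Sum>q. (lookup g q when q = 0) when l = 0))"
    unfolding lookup_mult by (auto intro!: Sum_any.cong arg_cong[of _ _ "(*) _"] simp: when_def)
  also have "\<dots> = (\<Sum>l::'n \<Rightarrow>\<^sub>0 nat. lookup f 0 * lookup g 0 when l = 0)"
    by (intro Sum_any.cong) (auto simp: when_def)
  finally show ?thesis by simp
qed

text \<open>For the fibres of a degree function this is the projection to a homogeneous component.
  Arbitrary sets \<open>P\<close> are allowed because monomial ideals are closed under all of these
  projections.\<close>

definition restrict_keys :: "'a set \<Rightarrow> ('a \<Rightarrow>\<^sub>0 'k::zero) \<Rightarrow> 'a \<Rightarrow>\<^sub>0 'k" where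
  "restrict_keys P f = Poly_Mapping.mapp (\<lambda>m c. if m \<in> P then c else 0) f"

lemma lookup_restrict_keys: "lookup (restrict_keys P f) m = (if m \<in> P then lookup f m else 0)"
  by (auto simp: restrict_keys_def lookup_mapp when_def in_keys_iff)

lemma keys_restrict_keys: "keys (restrict_keys P f) = keys f \<inter> P"
  by (auto simp: in_keys_iff lookup_restrict_keys split: if_splits)

lemma restrict_keys_zero [simp]: "restrict_keys P 0 = 0"
  by (rule poly_mapping_eqI) (simp add: lookup_restrict_keys)

lemma restrict_keys_add: "restrict_keys P (f + g) = restrict_keys P f + restrict_keys P g"
  for f g :: "'a \<Rightarrow>\<^sub>0 'k::ab_group_add"
  by (rule poly_mapping_eqI) (simp add: lookup_restrict_keys lookup_add)

lemma restrict_keys_sum: "restrict_keys P (\<Sum>i\<in>A. f i) = (\<Sum>i\<in>A. restrict_keys P (f i))"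
  for f :: "'b \<Rightarrow> 'a \<Rightarrow>\<^sub>0 'k::ab_group_add"
  by (rule poly_mapping_eqI) (simp add: lookup_restrict_keys lookup_sum)

lemma restrict_keys_id: "keys f \<subseteq> P \<Longrightarrow> restrict_keys P f = f"
  by (rule poly_mapping_eqI) (auto simp: lookup_restrict_keys in_keys_iff)

lemma restrict_keys_eq_0: "keys f \<inter> P = {} \<Longrightarrow> restrict_keys P f = 0"
  by (rule poly_mapping_eqI) (auto simp: lookup_restrict_keys in_keys_iff)

lemma restrict_keys_split: "f = restrict_keys P f + restrict_keys (- P) f"
  for f :: "'a \<Rightarrow>\<^sub>0 'k::ab_group_add"
  by (rule poly_mapping_eqI) (simp add: lookup_restrict_keys lookup_add)

text \<open>Covers both gradings at once. Degrees need not form a group, so degree conditions are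
  written as sums instead of differences.\<close>

locale grading =
  fixes deg :: "('n \<Rightarrow>\<^sub>0 nat) \<Rightarrow> 'd::cancel_comm_monoid_add"
  assumes deg_add: "deg (m + m') = deg m + deg m'"
begin

lemma deg_zero [simp]: "deg 0 = 0"
  using deg_add[of 0 0] by (metis add_cancel_left_right add.right_neutral)

text \<open>Multiplication by a homogeneous \<open>f\<close> shifts all degrees by the same amount,
  so the part of \<open>g\<close> inside a fibre is sent into the shifted fibre and the remaining
  part misses it.\<close>

lemma restrict_keys_mult_homogeneous:
  fixes f g :: "('n, 'k::field) mpoly"
  assumes "\<forall>m\<in>keys f. deg m + c = b"
  shows "restrict_keys {m. deg m + c = j} (f * g) = f * restrict_keys {m. deg m + b = j} g"
    (is "restrict_keys ?P _ = f * restrict_keys ?Q g")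
proof -
  have eq: "deg (m + m') + c = deg m' + b" if "m \<in> keys f" for m m'
    using assms that by (metis deg_add add.assoc add.commute)
  have "keys (f * restrict_keys ?Q g) \<subseteq> ?P"
    using keys_mult[of f "restrict_keys ?Q g"] by (fastforce simp: keys_restrict_keys eq)
  moreover have "keys (f * restrict_keys (- ?Q) g) \<inter> ?P = {}"
    using keys_mult[of f "restrict_keys (- ?Q) g"] by (fastforce simp: keys_restrict_keys eq)
  moreover have "f * g = f * restrict_keys ?Q g + f * restrict_keys (- ?Q) g"
    by (metis distrib_left restrict_keys_split)
  ultimately show ?thesis
    by (simp add: restrict_keys_add restrict_keys_id restrict_keys_eq_0)
qed

end

section \<open>Matrices\<close>

definition mat_mult :: "'c set \<Rightarrow> ('e \<Rightarrow> 'c \<Rightarrow> 'r) \<Rightarrow> ('c \<Rightarrow> 'b \<Rightarrow> 'r) \<Rightarrow> 'e \<Rightarrow> 'b \<Rightarrow> 'r::comm_ring_1" where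
  "mat_mult C A' A = (\<lambda>p q. \<Sum>r\<in>C. A' p r * A r q)"

definition unit_vec :: "'b \<Rightarrow> 'b \<Rightarrow> 'r::zero_neq_one" where
  "unit_vec q = (\<lambda>b. if b = q then 1 else 0)"

definition id_mat :: "'b set \<Rightarrow> 'b \<Rightarrow> 'b \<Rightarrow> 'r::zero_neq_one" where
  "id_mat B = (\<lambda>p q. if p = q \<and> q \<in> B then 1 else 0)"

lemma free_module_zero [simp]: "0 \<in> free_module B" "(\<lambda>_. 0) \<in> free_module B"
  by (auto simp: free_module_def zero_fun_def)

lemma free_module_add [intro]: "v \<in> free_module B \<Longrightarrow> w \<in> free_module B \<Longrightarrow> v + w \<in> free_module B"
  for v :: "'b \<Rightarrow> 'r::comm_ring_1"
  by (auto simp: free_module_def)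

lemma free_module_diff [intro]: "v \<in> free_module B \<Longrightarrow> w \<in> free_module B \<Longrightarrow> v - w \<in> free_module B"
  for v :: "'b \<Rightarrow> 'r::comm_ring_1"
  by (auto simp: free_module_def)

lemma free_module_uminus [intro]: "v \<in> free_module B \<Longrightarrow> - v \<in> free_module B"
  for v :: "'b \<Rightarrow> 'r::comm_ring_1"
  by (auto simp: free_module_def)

lemma unit_vec_free [simp]: "unit_vec q \<in> free_module B \<longleftrightarrow> q \<in> B"
  by (auto simp: free_module_def unit_vec_def)

lemma mat_app_add: "mat_app B A (v + w) = mat_app B A v + mat_app B A w"
  by (simp add: mat_app_def fun_eq_iff distrib_left sum.distrib)

lemma mat_app_diff: "mat_app B A (v - w) = mat_app B A v - mat_app B A w"
  by (simp add: mat_app_def fun_eq_iff right_diff_distrib sum_subtractf)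

lemma mat_app_uminus: "mat_app B A (- v) = - mat_app B A v"
  by (simp add: mat_app_def fun_eq_iff sum_negf)

lemma mat_app_zero [simp]: "mat_app B A 0 = 0" "mat_app B A (\<lambda>_. 0) = 0"
  by (simp_all add: mat_app_def fun_eq_iff)

lemma mat_app_scale: "mat_app B A (\<lambda>b. r * v b) = (\<lambda>p. r * mat_app B A v p)"
  by (simp add: mat_app_def fun_eq_iff sum_distrib_left mult_ac)

lemma mat_app_mat_mult: "mat_app B (mat_mult C A' A) v = mat_app C A' (mat_app B A v)"
proof
  fix p
  have "(\<Sum>q\<in>B. (\<Sum>r\<in>C. A' p r * A r q) * v q) = (\<Sum>q\<in>B. \<Sum>r\<in>C. A' p r * (A r q * v q))"
    by (simp add: sum_distrib_right mult.assoc)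
  also have "\<dots> = (\<Sum>r\<in>C. A' p r * (\<Sum>q\<in>B. A r q * v q))"
    by (subst sum.swap) (simp add: sum_distrib_left)
  finally show "mat_app B (mat_mult C A' A) v p = mat_app C A' (mat_app B A v) p"
    by (simp add: mat_app_def mat_mult_def)
qed

lemma mat_app_mat_diff: "mat_app B (A - A') v = mat_app B A v - mat_app B A' v"
  by (simp add: mat_app_def fun_eq_iff left_diff_distrib sum_subtractf)

lemma mat_app_unit_vec:
  assumes "finite B" "q \<in> B"
  shows "mat_app B A (unit_vec q) = (\<lambda>p. A p q)"
proof
  fix p
  have "(\<Sum>r\<in>B. A p r * unit_vec q r) = (\<Sum>r\<in>B. if r = q then A p q else 0)"
    by (intro sum.cong) (auto simp: unit_vec_def)
  then show "mat_app B A (unit_vec q) p = A p q"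
    using assms by (simp add: mat_app_def)
qed

lemma mat_app_id_mat:
  assumes "finite B" "v \<in> free_module B"
  shows "mat_app B (id_mat B) v = v"
proof
  fix p
  have "(\<Sum>q\<in>B. id_mat B p q * v q) = (\<Sum>q\<in>B. if q = p then v p else 0)"
    by (intro sum.cong) (auto simp: id_mat_def)
  then show "mat_app B (id_mat B) v p = v p"
    using assms by (auto simp: mat_app_def free_module_def)
qed

lemma graded_matrix_mat_app: "graded_matrix deg B dB C dC A \<Longrightarrow> mat_app B A v \<in> free_module C"
  by (auto simp: graded_matrix_def free_module_def mat_app_def intro!: sum.neutral)

text \<open>Homogeneous component in a free module whose basis element \<open>b\<close> sits in
  degree \<open>dB b\<close>; hence the shift inside the restriction.\<close>

definition hom_comp ::
  "(('n \<Rightarrow>\<^sub>0 nat) \<Rightarrow> 'd::comm_monoid_add) \<Rightarrow> ('b \<Rightarrow> 'd) \<Rightarrow> 'd \<Rightarrow> ('b \<Rightarrow> ('n, 'k::field) mpoly) \<Rightarrow> 'b \<Rightarrow> ('n, 'k) mpoly" where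
  "hom_comp deg dB j v = (\<lambda>b. restrict_keys {m. deg m + dB b = j} (v b))"

lemma hom_comp_free [intro]: "v \<in> free_module B \<Longrightarrow> hom_comp deg dB j v \<in> free_module B"
  by (auto simp: free_module_def hom_comp_def)

context grading
begin

lemma hom_comp_mat_app:
  fixes A :: "'c \<Rightarrow> 'b \<Rightarrow> ('n, 'k::field) mpoly"
  assumes "graded_matrix deg B dB C dC A"
  shows "hom_comp deg dC j (mat_app B A v) = mat_app B A (hom_comp deg dB j v)"
proof
  fix p
  have "restrict_keys {m. deg m + dC p = j} (A p q * v q)
          = A p q * restrict_keys {m. deg m + dB q = j} (v q)" if "q \<in> B" for q
  proof (cases "p \<in> C")
    case True
    then show ?thesis
      using assms that by (intro restrict_keys_mult_homogeneous) (auto simp: graded_matrix_def)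
  next
    case False
    then show ?thesis
      using assms by (simp add: graded_matrix_def)
  qed
  then show "hom_comp deg dC j (mat_app B A v) p = mat_app B A (hom_comp deg dB j v) p"
    by (simp add: hom_comp_def mat_app_def restrict_keys_sum)
qed

lemma graded_matrix_mat_mult:
  fixes A :: "'c \<Rightarrow> 'b \<Rightarrow> ('n, 'k::field) mpoly"
  assumes A: "graded_matrix deg B dB C dC A" and A': "graded_matrix deg C dC E dE A'"
  shows "graded_matrix deg B dB E dE (mat_mult C A' A)"
  unfolding graded_matrix_def
proof safe
  fix p q assume "p \<notin> E"
  then show "mat_mult C A' A p q = 0"
    using A' by (simp add: mat_mult_def graded_matrix_def)
next
  fix p q assume "q \<notin> B"
  then show "mat_mult C A' A p q = 0"
    using A by (simp add: mat_mult_def graded_matrix_def)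
next
  fix p q m
  assume pq: "p \<in> E" "q \<in> B" "m \<in> keys (mat_mult C A' A p q)"
  then have "lookup (\<Sum>r\<in>C. A' p r * A r q) m \<noteq> 0"
    by (simp add: mat_mult_def in_keys_iff)
  then obtain r where r: "r \<in> C" "m \<in> keys (A' p r * A r q)"
    by (auto simp: lookup_sum in_keys_iff elim: sum.not_neutral_contains_not_neutral)
  then obtain m1 m2 where "m = m1 + m2" "m1 \<in> keys (A' p r)" "m2 \<in> keys (A r q)"
    using keys_mult by blast
  moreover from this have "deg m1 + dE p = dC r" "deg m2 + dC r = dB q"
    using A A' pq r by (auto simp: graded_matrix_def)
  ultimately show "deg m + dE p = dB q"
    by (metis deg_add add.assoc add.commute)
qed

lemma graded_matrix_diff:
  fixes A :: "'c \<Rightarrow> 'b \<Rightarrow> ('n, 'k::field) mpoly"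
  assumes "graded_matrix deg B dB C dC A" "graded_matrix deg B dB C dC A'"
  shows "graded_matrix deg B dB C dC (A - A')"
proof -
  have "m \<in> keys (A p q) \<or> m \<in> keys (A' p q)" if "m \<in> keys (A p q - A' p q)" for p q m
    using that by (auto simp: in_keys_iff lookup_minus)
  then show ?thesis
    using assms unfolding graded_matrix_def by fastforce
qed

lemma graded_matrix_id: "graded_matrix deg B dB B dB (id_mat B :: 'b \<Rightarrow> 'b \<Rightarrow> ('n, 'k::field) mpoly)"
  by (auto simp: graded_matrix_def id_mat_def split: if_splits)

text \<open>Graded projectivity of free modules: each basis element is sent to a preimage of its
  image. An arbitrary preimage need not be homogeneous, but its component of the right degree is
  again a preimage.\<close>

lemma graded_lift_exists:
  fixes A :: "'c \<Rightarrow> 'b \<Rightarrow> ('n, 'k::field) mpoly" and D :: "'c \<Rightarrow> 'e \<Rightarrow> ('n, 'k) mpoly"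
  assumes finB: "finite B"
    and A: "graded_matrix deg B dB C dC A" and D: "graded_matrix deg E dE C dC D"
    and sub: "\<And>v. v \<in> free_module B \<Longrightarrow> mat_app B A v \<in> mat_app E D ` free_module E"
  shows "\<exists>X. graded_matrix deg B dB E dE X \<and> (\<forall>v. mat_app E D (mat_app B X v) = mat_app B A v)"
proof -
  have "\<exists>w. w \<in> free_module E \<and> (\<forall>r. \<forall>m\<in>keys (w r). deg m + dE r = dB q)
            \<and> mat_app E D w = (\<lambda>p. A p q)" if q: "q \<in> B" for q
  proof -
    obtain w where w: "w \<in> free_module E" "mat_app E D w = (\<lambda>p. A p q)"
      using sub[of "unit_vec q"] mat_app_unit_vec[OF finB q, of A] q
      by (metis imageE unit_vec_free)
    \<comment> \<open>Column \<open>q\<close> of \<open>A\<close> is already homogeneous of degree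
      \<open>dB q\<close>, so passing to that component leaves the target fixed.\<close>
    have "restrict_keys {m. deg m + dC p = dB q} (A p q) = A p q" for p
      using A q by (cases "p \<in> C") (auto intro!: restrict_keys_id simp: graded_matrix_def)
    then have "mat_app E D (hom_comp deg dE (dB q) w) = (\<lambda>p. A p q)"
      unfolding hom_comp_mat_app[OF D, symmetric] by (simp add: w hom_comp_def)
    then show ?thesis
      using w(1) by (intro exI[of _ "hom_comp deg dE (dB q) w"])
        (auto simp: hom_comp_def keys_restrict_keys free_module_def)
  qed
  then obtain w where w: "\<And>q. q \<in> B \<Longrightarrow> w q \<in> free_module E"
      "\<And>q r m. q \<in> B \<Longrightarrow> m \<in> keys (w q r) \<Longrightarrow> deg m + dE r = dB q"
      "\<And>q. q \<in> B \<Longrightarrow> mat_app E D (w q) = (\<lambda>p. A p q)"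
    by metis
  define X where "X = (\<lambda>r q. if q \<in> B then w q r else 0)"
  have "graded_matrix deg B dB E dE X"
    using w by (auto simp: graded_matrix_def X_def free_module_def)
  moreover have "mat_app E D (mat_app B X v) = mat_app B A v" for v
  proof -
    have "mat_mult E D X p q = A p q" if "q \<in> B" for p q
      using w(3)[OF that] that by (auto simp: mat_mult_def X_def mat_app_def fun_eq_iff)
    then have "mat_app B (mat_mult E D X) v = mat_app B A v"
      by (simp add: mat_app_def)
    then show ?thesis
      by (simp add: mat_app_mat_mult)
  qed
  ultimately show ?thesis
    by blast
qed

end

section \<open>Lifting maps of modules to resolutions\<close>

text \<open>The augmentation is treated as the differential out of degree 0, so exactness at every
  spot, including the first, becomes the same equation.\<close>

definition res_cycles :: "('b, 'd, 'r::comm_ring_1, 'r) aug_complex \<Rightarrow> nat \<Rightarrow> ('b \<Rightarrow> 'r) set" where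
  "res_cycles F i = {v \<in> free_module (gens F i).
     case i of 0 \<Rightarrow> aug_map (*) F v = 0 | Suc l \<Rightarrow> \<forall>p. dmap F l v p = 0}"

lemma res_cycles_free: "v \<in> res_cycles F i \<Longrightarrow> v \<in> free_module (gens F i)"
  by (simp add: res_cycles_def)

lemma res_cycles_Suc: "v \<in> res_cycles F (Suc i) \<longleftrightarrow> v \<in> free_module (gens F (Suc i)) \<and> dmap F i v = 0"
  by (auto simp: res_cycles_def fun_eq_iff)

text \<open>As a matrix, the augmentation is subject to the same lifting lemma as the differentials.\<close>

definition aug_mat :: "('b, 'd, 'r, 'r) aug_complex \<Rightarrow> unit \<Rightarrow> 'b \<Rightarrow> 'r::comm_ring_1" where
  "aug_mat F = (\<lambda>_ b. if b \<in> gens F 0 then aug F b else 0)"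

lemma mat_app_aug_mat: "mat_app (gens F 0) (aug_mat F) v = (\<lambda>_. aug_map (*) F v)"
  by (auto simp: mat_app_def aug_mat_def aug_map_def fun_eq_iff mult.commute intro!: sum.cong)

lemma aug_map_diff: "aug_map (*) F (v - w) = aug_map (*) F v - aug_map (*) F w"
  by (simp add: aug_map_def left_diff_distrib sum_subtractf)

lemma aug_map_uminus: "aug_map (*) F (- v) = - aug_map (*) F v"
  by (simp add: aug_map_def sum_negf)

lemma graded_resolution_exact:
  assumes "graded_resolution deg L F"
  shows "dmap F i ` free_module (gens F (Suc i)) = res_cycles F i"
  using assms by (cases i) (auto simp: graded_resolution_def res_cycles_def)

lemma graded_resolution_finite: "graded_resolution deg L F \<Longrightarrow> finite (gens F i)"
  by (simp add: graded_resolution_def)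

lemma graded_resolution_dmat:
  "graded_resolution deg L F \<Longrightarrow>
    graded_matrix deg (gens F (Suc i)) (gdeg F (Suc i)) (gens F i) (gdeg F i) (dmat F i)"
  by (simp add: graded_resolution_def)

lemma graded_resolution_aug: "graded_resolution deg L F \<Longrightarrow> aug_map (*) F ` free_module (gens F 0) = L"
  by (simp add: graded_resolution_def)

lemma graded_resolution_aug_mat:
  "graded_resolution deg L F \<Longrightarrow> graded_matrix deg (gens F 0) (gdeg F 0) UNIV (\<lambda>_. 0) (aug_mat F)"
  by (auto simp: graded_resolution_def graded_matrix_def aug_mat_def)

lemma dmap_res_cycles:
  "graded_resolution deg L F \<Longrightarrow> v \<in> free_module (gens F (Suc i)) \<Longrightarrow> dmap F i v \<in> res_cycles F i"
  using graded_resolution_exact by blast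

text \<open>Lifts of multiplication by \<open>c\<close> from one module to another. The values in
  use are 1 for inclusions and comparisons, -1 for the second component of \<open>\<phi>\<close>,
  and 0 for differences of two lifts.\<close>

definition chain_lift ::
  "(('n \<Rightarrow>\<^sub>0 nat) \<Rightarrow> 'd::comm_monoid_add)
    \<Rightarrow> ('b, 'd, ('n, 'k::field) mpoly, ('n, 'k) mpoly) aug_complex
    \<Rightarrow> ('c, 'd, ('n, 'k) mpoly, ('n, 'k) mpoly) aug_complex
    \<Rightarrow> ('n, 'k) mpoly \<Rightarrow> (nat \<Rightarrow> 'c \<Rightarrow> 'b \<Rightarrow> ('n, 'k) mpoly) \<Rightarrow> bool" where
  "chain_lift deg F G c \<Phi> \<longleftrightarrow>
     (\<forall>i. graded_matrix deg (gens F i) (gdeg F i) (gens G i) (gdeg G i) (\<Phi> i)) \<and>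
     (\<forall>i. \<forall>v \<in> free_module (gens F (Suc i)).
        mat_app (gens F i) (\<Phi> i) (dmap F i v) = dmap G i (mat_app (gens F (Suc i)) (\<Phi> (Suc i)) v)) \<and>
     (\<forall>v \<in> free_module (gens F 0).
        aug_map (*) G (mat_app (gens F 0) (\<Phi> 0) v) = c * aug_map (*) F v)"

lemma chain_lift_graded:
  "chain_lift deg F G c \<Phi> \<Longrightarrow> graded_matrix deg (gens F i) (gdeg F i) (gens G i) (gdeg G i) (\<Phi> i)"
  by (simp add: chain_lift_def)

lemma chain_lift_commute:
  "chain_lift deg F G c \<Phi> \<Longrightarrow> v \<in> free_module (gens F (Suc i)) \<Longrightarrow>
    mat_app (gens F i) (\<Phi> i) (dmap F i v) = dmap G i (mat_app (gens F (Suc i)) (\<Phi> (Suc i)) v)"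
  by (simp add: chain_lift_def)

lemma chain_lift_aug:
  "chain_lift deg F G c \<Phi> \<Longrightarrow> v \<in> free_module (gens F 0) \<Longrightarrow>
    aug_map (*) G (mat_app (gens F 0) (\<Phi> 0) v) = c * aug_map (*) F v"
  by (simp add: chain_lift_def)

lemma chain_lift_free: "chain_lift deg F G c \<Phi> \<Longrightarrow> mat_app (gens F i) (\<Phi> i) v \<in> free_module (gens G i)"
  by (blast intro: graded_matrix_mat_app chain_lift_graded)

section \<open>Comparison theorem: lifts exist and are unique up to homotopy\<close>

context grading
begin

text \<open>Exactness of the target makes each of its differentials surjective onto the cycles
  below, so every matrix can be lifted from the previous one. The condition on \<open>keys c\<close>
  says that \<open>c\<close> is a scalar, so that multiplying by it preserves degrees.\<close>

lemma chain_lift_exists: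
  fixes F :: "('b, 'd, ('n, 'k::field) mpoly, ('n, 'k) mpoly) aug_complex"
    and G :: "('c, 'd, ('n, 'k) mpoly, ('n, 'k) mpoly) aug_complex"
  assumes F: "graded_resolution deg L F" and G: "graded_resolution deg L' G"
    and c: "keys c \<subseteq> {0}" and sub: "\<And>f. f \<in> L \<Longrightarrow> c * f \<in> L'"
  shows "\<exists>\<Phi>. chain_lift deg F G c \<Phi>"
proof -
  \<comment> \<open>That cycles go to cycles is part of the invariant, since the next matrix is
    obtained by lifting the image of \<open>dmap F i\<close>. The augmentation clause is recorded
    only at 0, where the augmentation lives.\<close>
  let ?P = "\<lambda>i X. graded_matrix deg (gens F i) (gdeg F i) (gens G i) (gdeg G i) X \<and>
    (\<forall>v\<in>res_cycles F i. mat_app (gens F i) X v \<in> res_cycles G i) \<and>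
    (i = 0 \<longrightarrow> (\<forall>v. aug_map (*) G (mat_app (gens F 0) X v) = c * aug_map (*) F v))"
  let ?Q = "\<lambda>i X Y. \<forall>v \<in> free_module (gens F (Suc i)).
    mat_app (gens F i) X (dmap F i v) = dmap G i (mat_app (gens F (Suc i)) Y v)"
  have "\<exists>\<Phi>. \<forall>i. ?P i (\<Phi> i) \<and> ?Q i (\<Phi> i) (\<Phi> (Suc i))"
  proof (rule dependent_nat_choice)
    define A where "A = (\<lambda>p q. c * aug_mat F p q)"
    have "keys (A p q) \<subseteq> keys (aug_mat F p q)" for p q
      using keys_mult[of c "aug_mat F p q"] c unfolding A_def by fastforce
    then have gA: "graded_matrix deg (gens F 0) (gdeg F 0) UNIV (\<lambda>_. 0) A"
      using graded_resolution_aug_mat[OF F] unfolding graded_matrix_def A_def by (auto, blast)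
    have A: "mat_app (gens F 0) A v = (\<lambda>_. c * aug_map (*) F v)" for v
      using mat_app_aug_mat[of F v]
      by (auto simp: mat_app_def A_def fun_eq_iff sum_distrib_left[symmetric] mult.assoc)
    have sub': "mat_app (gens F 0) A v \<in> mat_app (gens G 0) (aug_mat G) ` free_module (gens G 0)"
      if "v \<in> free_module (gens F 0)" for v
    proof -
      have "c * aug_map (*) F v \<in> aug_map (*) G ` free_module (gens G 0)"
        unfolding graded_resolution_aug[OF G]
        using sub graded_resolution_aug[OF F] that by blast
      then show ?thesis
        by (auto simp: A mat_app_aug_mat)
    qed
    obtain X where X: "graded_matrix deg (gens F 0) (gdeg F 0) (gens G 0) (gdeg G 0) X"
      "\<And>v. mat_app (gens G 0) (aug_mat G) (mat_app (gens F 0) X v) = mat_app (gens F 0) A v"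
      using graded_lift_exists[OF graded_resolution_finite[OF F] gA graded_resolution_aug_mat[OF G] sub'] by blast
    have "aug_map (*) G (mat_app (gens F 0) X v) = c * aug_map (*) F v" for v
      using X(2)[of v] by (simp add: A mat_app_aug_mat fun_eq_iff)
    then have "?P 0 X"
      using X(1) graded_matrix_mat_app[OF X(1)] by (simp add: res_cycles_def)
    then show "\<exists>X. ?P 0 X"
      by (rule exI[where x = X])
  next
    fix X i
    assume P: "?P i X"
    let ?A = "mat_mult (gens F i) X (dmat F i)"
    have A: "mat_app (gens F (Suc i)) ?A v = mat_app (gens F i) X (dmap F i v)" for v
      by (simp add: mat_app_mat_mult dmap_def)
    have gA: "graded_matrix deg (gens F (Suc i)) (gdeg F (Suc i)) (gens G i) (gdeg G i) ?A"
      using P F by (blast intro: graded_matrix_mat_mult graded_resolution_dmat)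
    have sub': "mat_app (gens F (Suc i)) ?A v \<in> mat_app (gens G (Suc i)) (dmat G i) ` free_module (gens G (Suc i))"
      if "v \<in> free_module (gens F (Suc i))" for v
      using graded_resolution_exact[OF G, of i] P dmap_res_cycles[OF F that]
      unfolding A by (simp add: dmap_def)
    obtain Y where Y: "graded_matrix deg (gens F (Suc i)) (gdeg F (Suc i)) (gens G (Suc i)) (gdeg G (Suc i)) Y"
      "\<And>v. mat_app (gens G (Suc i)) (dmat G i) (mat_app (gens F (Suc i)) Y v) = mat_app (gens F (Suc i)) ?A v"
      using graded_lift_exists[OF graded_resolution_finite[OF F] gA graded_resolution_dmat[OF G] sub'] by blast
    have Q: "mat_app (gens F i) X (dmap F i v) = dmap G i (mat_app (gens F (Suc i)) Y v)" for v
      using Y(2)[of v] A[of v] by (simp add: dmap_def)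
    have "mat_app (gens F (Suc i)) Y v \<in> res_cycles G (Suc i)" if "v \<in> res_cycles F (Suc i)" for v
      using that Q[of v] graded_matrix_mat_app[OF Y(1)] by (simp add: res_cycles_Suc)
    then show "\<exists>Y. ?P (Suc i) Y \<and> ?Q i X Y"
      using Y(1) Q by (intro exI[of _ Y]) simp
  qed
  then obtain \<Phi> where \<Phi>: "\<And>i. ?P i (\<Phi> i) \<and> ?Q i (\<Phi> i) (\<Phi> (Suc i))"
    by blast
  have "chain_lift deg F G c \<Phi>"
    unfolding chain_lift_def using \<Phi> by blast
  then show ?thesis by (rule exI[where x = \<Phi>])
qed

lemma chain_lift_comp:
  fixes F :: "('b, 'd, ('n, 'k::field) mpoly, ('n, 'k) mpoly) aug_complex"
    and G :: "('c, 'd, ('n, 'k) mpoly, ('n, 'k) mpoly) aug_complex"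
    and H :: "('e, 'd, ('n, 'k) mpoly, ('n, 'k) mpoly) aug_complex"
  assumes "chain_lift deg F G c \<Phi>" "chain_lift deg G H c' \<Psi>"
  shows "chain_lift deg F H (c' * c) (\<lambda>i. mat_mult (gens G i) (\<Psi> i) (\<Phi> i))"
  unfolding chain_lift_def
  using assms
  by (auto simp: mat_app_mat_mult chain_lift_commute chain_lift_aug chain_lift_free mult.assoc
    intro: graded_matrix_mat_mult chain_lift_graded)

lemma chain_lift_id:
  fixes F :: "('b, 'd, ('n, 'k::field) mpoly, ('n, 'k) mpoly) aug_complex"
  assumes "graded_resolution deg L F"
  shows "chain_lift deg F F 1 (\<lambda>i. id_mat (gens F i))"
  unfolding chain_lift_def
  using assms res_cycles_free[OF dmap_res_cycles[OF assms]]
  by (auto simp: graded_matrix_id mat_app_id_mat graded_resolution_finite)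

lemma chain_lift_diff:
  fixes F :: "('b, 'd, ('n, 'k::field) mpoly, ('n, 'k) mpoly) aug_complex"
    and G :: "('c, 'd, ('n, 'k) mpoly, ('n, 'k) mpoly) aug_complex"
  assumes "chain_lift deg F G c \<Phi>" "chain_lift deg F G c' \<Psi>"
  shows "chain_lift deg F G (c - c') (\<lambda>i. \<Phi> i - \<Psi> i)"
  unfolding chain_lift_def
proof (intro conjI allI ballI)
  show "graded_matrix deg (gens F i) (gdeg F i) (gens G i) (gdeg G i) (\<Phi> i - \<Psi> i)" for i
    using assms by (blast intro: graded_matrix_diff chain_lift_graded)
next
  fix i and v :: "'b \<Rightarrow> ('n, 'k) mpoly"
  assume "v \<in> free_module (gens F (Suc i))"
  then show "mat_app (gens F i) (\<Phi> i - \<Psi> i) (dmap F i v)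
      = dmap G i (mat_app (gens F (Suc i)) (\<Phi> (Suc i) - \<Psi> (Suc i)) v)"
    using assms by (simp only: mat_app_mat_diff chain_lift_commute) (simp only: dmap_def mat_app_diff)
next
  fix v :: "'b \<Rightarrow> ('n, 'k) mpoly"
  assume "v \<in> free_module (gens F 0)"
  then show "aug_map (*) G (mat_app (gens F 0) (\<Phi> 0 - \<Psi> 0) v) = (c - c') * aug_map (*) F v"
    using assms by (simp only: mat_app_mat_diff aug_map_diff chain_lift_aug left_diff_distrib)
qed

text \<open>After subtracting the part already explained by the homotopy, a lift of the zero map
  takes values in the cycles of \<open>G\<close>, so exactness supplies the next matrix of the
  homotopy.\<close>

lemma null_homotopy_exists:
  fixes F :: "('b, 'd, ('n, 'k::field) mpoly, ('n, 'k) mpoly) aug_complex"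
    and G :: "('c, 'd, ('n, 'k) mpoly, ('n, 'k) mpoly) aug_complex"
  assumes F: "graded_resolution deg L F" and G: "graded_resolution deg L' G"
    and \<Psi>: "chain_lift deg F G 0 \<Psi>"
  obtains s where
    "\<And>i. graded_matrix deg (gens F i) (gdeg F i) (gens G (Suc i)) (gdeg G (Suc i)) (s i)"
    "\<And>v. v \<in> free_module (gens F 0) \<Longrightarrow>
       mat_app (gens F 0) (\<Psi> 0) v = dmap G 0 (mat_app (gens F 0) (s 0) v)"
    "\<And>i v. v \<in> free_module (gens F (Suc i)) \<Longrightarrow>
       mat_app (gens F (Suc i)) (\<Psi> (Suc i)) v
         = dmap G (Suc i) (mat_app (gens F (Suc i)) (s (Suc i)) v) + mat_app (gens F i) (s i) (dmap F i v)"
proof -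
  \<comment> \<open>On cycles the term of the homotopy relation that passes through
    \<open>dmap F\<close> vanishes. What is left of the relation does not mention the previous
    matrix, and it is all that the next step uses.\<close>
  let ?P = "\<lambda>i X. graded_matrix deg (gens F i) (gdeg F i) (gens G (Suc i)) (gdeg G (Suc i)) X \<and>
    (\<forall>v\<in>res_cycles F i. mat_app (gens F i) (\<Psi> i) v = dmap G i (mat_app (gens F i) X v)) \<and>
    (i = 0 \<longrightarrow> (\<forall>v\<in>free_module (gens F 0). mat_app (gens F 0) (\<Psi> 0) v = dmap G 0 (mat_app (gens F 0) X v)))"
  let ?Q = "\<lambda>i X Y. \<forall>v \<in> free_module (gens F (Suc i)).
       mat_app (gens F (Suc i)) (\<Psi> (Suc i)) v
         = dmap G (Suc i) (mat_app (gens F (Suc i)) Y v) + mat_app (gens F i) X (dmap F i v)"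
  have "\<exists>s. \<forall>i. ?P i (s i) \<and> ?Q i (s i) (s (Suc i))"
  proof (rule dependent_nat_choice)
    have sub: "mat_app (gens F 0) (\<Psi> 0) v \<in> mat_app (gens G (Suc 0)) (dmat G 0) ` free_module (gens G (Suc 0))"
      if "v \<in> free_module (gens F 0)" for v
      using graded_resolution_exact[OF G, of 0] chain_lift_free[OF \<Psi>, of 0 v] chain_lift_aug[OF \<Psi> that]
      by (simp add: dmap_def res_cycles_def)
    obtain X where X: "graded_matrix deg (gens F 0) (gdeg F 0) (gens G (Suc 0)) (gdeg G (Suc 0)) X"
      "\<And>v. mat_app (gens G (Suc 0)) (dmat G 0) (mat_app (gens F 0) X v) = mat_app (gens F 0) (\<Psi> 0) v"
      using graded_lift_exists[OF graded_resolution_finite[OF F] chain_lift_graded[OF \<Psi>]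
            graded_resolution_dmat[OF G] sub] by blast
    then show "\<exists>X. ?P 0 X"
      by (intro exI[of _ X]) (simp add: dmap_def)
  next
    fix X i
    assume P: "?P i X"
    let ?A = "\<Psi> (Suc i) - mat_mult (gens F i) X (dmat F i)"
    have A: "mat_app (gens F (Suc i)) ?A v
        = mat_app (gens F (Suc i)) (\<Psi> (Suc i)) v - mat_app (gens F i) X (dmap F i v)" for v
      by (simp only: mat_app_mat_mult mat_app_mat_diff dmap_def)
    have gA: "graded_matrix deg (gens F (Suc i)) (gdeg F (Suc i)) (gens G (Suc i)) (gdeg G (Suc i)) ?A"
      using P by (blast intro: graded_matrix_diff graded_matrix_mat_mult
          graded_resolution_dmat[OF F] chain_lift_graded[OF \<Psi>])
    have sub: "mat_app (gens F (Suc i)) ?A v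
        \<in> mat_app (gens G (Suc (Suc i))) (dmat G (Suc i)) ` free_module (gens G (Suc (Suc i)))"
      if v: "v \<in> free_module (gens F (Suc i))" for v
    proof -
      \<comment> \<open>The image \<open>dmap F i v\<close> is a cycle, so the invariant rewrites
        its value under \<open>\<Psi> i\<close> and the two terms cancel.\<close>
      have "dmap G i (mat_app (gens F (Suc i)) ?A v)
          = mat_app (gens F i) (\<Psi> i) (dmap F i v) - dmap G i (mat_app (gens F i) X (dmap F i v))"
        unfolding A chain_lift_commute[OF \<Psi> v] by (simp only: dmap_def mat_app_diff)
      also have "\<dots> = 0"
        using P dmap_res_cycles[OF F v] by simp
      finally have "mat_app (gens F (Suc i)) ?A v \<in> res_cycles G (Suc i)"
        using graded_matrix_mat_app[OF gA] by (simp add: res_cycles_Suc)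
      then show ?thesis
        using graded_resolution_exact[OF G, of "Suc i"] by (simp add: dmap_def)
    qed
    obtain Y where Y: "graded_matrix deg (gens F (Suc i)) (gdeg F (Suc i))
        (gens G (Suc (Suc i))) (gdeg G (Suc (Suc i))) Y"
      "\<And>v. mat_app (gens G (Suc (Suc i))) (dmat G (Suc i)) (mat_app (gens F (Suc i)) Y v)
        = mat_app (gens F (Suc i)) ?A v"
      using graded_lift_exists[OF graded_resolution_finite[OF F] gA graded_resolution_dmat[OF G] sub] by blast
    have Q: "mat_app (gens F (Suc i)) (\<Psi> (Suc i)) v
         = dmap G (Suc i) (mat_app (gens F (Suc i)) Y v) + mat_app (gens F i) X (dmap F i v)" for v
      unfolding dmap_def[of G] Y(2) A by simp
    have "mat_app (gens F (Suc i)) (\<Psi> (Suc i)) v = dmap G (Suc i) (mat_app (gens F (Suc i)) Y v)"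
      if "v \<in> res_cycles F (Suc i)" for v
      using that Q[of v] by (simp add: res_cycles_Suc)
    then show "\<exists>Y. ?P (Suc i) Y \<and> ?Q i X Y"
      using Y(1) Q by (intro exI[of _ Y]) simp
  qed
  then obtain s where "\<And>i. ?P i (s i) \<and> ?Q i (s i) (s (Suc i))"
    by blast
  then show ?thesis
    using that[of s] by blast
qed

end

section \<open>Tensoring with the residue field\<close>

definition const_part :: "('b \<Rightarrow> ('n, 'k::field) mpoly) \<Rightarrow> 'b \<Rightarrow> 'k" where
  "const_part v = (\<lambda>b. lookup (v b) 0)"

text \<open>A section of \<open>const_part\<close>. Identities between maps over the polynomial ring
  are transported to their reductions by evaluating them at such constant vectors.\<close>

definition const_vec :: "('b \<Rightarrow> 'k::field) \<Rightarrow> 'b \<Rightarrow> ('n, 'k) mpoly" where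
  "const_vec v = (\<lambda>b. Poly_Mapping.single 0 (v b))"

lemma const_part_const_vec [simp]: "const_part (const_vec v) = v"
  by (simp add: const_part_def const_vec_def)

lemma const_vec_free: "v \<in> free_module B \<Longrightarrow> const_vec v \<in> free_module B"
  by (simp add: const_vec_def free_module_def)

lemma const_part_zero [simp]: "const_part 0 = 0"
  by (simp add: const_part_def fun_eq_iff)

lemma const_part_add: "const_part (v + w) = const_part v + const_part w"
  by (simp add: const_part_def fun_eq_iff lookup_add)

lemma const_part_mat_app: "const_part (mat_app B A v) = mat_app B (const_mat A) (const_part v)"
  by (simp add: const_part_def mat_app_def const_mat_def lookup_sum lookup_mult_zero fun_eq_iff)

lemma const_mat_diff: "const_mat (A - A') = const_mat A - const_mat A'"
  by (simp add: const_mat_def fun_eq_iff lookup_minus)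

lemma const_mat_id: "const_mat (id_mat B) = id_mat B"
  by (simp add: const_mat_def fun_eq_iff id_mat_def)

lemma const_mat_mat_mult: "const_mat (mat_mult C A' A) = mat_mult C (const_mat A') (const_mat A)"
  by (simp add: const_mat_def mat_mult_def lookup_sum lookup_mult_zero fun_eq_iff)

lemma const_part_dmap: "const_part (dmap F i v) = tensor_dmap F i (const_part v)"
  by (simp add: dmap_def tensor_dmap_def const_part_mat_app)

lemma tensor_dmap_add: "tensor_dmap F i (v + w) = tensor_dmap F i v + tensor_dmap F i w"
  by (simp only: tensor_dmap_def mat_app_add)

lemma tensor_dmap_zero [simp]: "tensor_dmap F i 0 = 0"
  by (simp add: tensor_dmap_def)

lemma tensor_dmap_scale: "tensor_dmap F i (\<lambda>b. r * v b) = (\<lambda>p. r * tensor_dmap F i v p)"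
  by (simp only: tensor_dmap_def mat_app_scale)

abbreviation tensor_map :: "('b, 'd, ('n, 'k::field) mpoly, 'm) aug_complex
    \<Rightarrow> (nat \<Rightarrow> 'c \<Rightarrow> 'b \<Rightarrow> ('n, 'k) mpoly) \<Rightarrow> nat \<Rightarrow> ('b \<Rightarrow> 'k) \<Rightarrow> 'c \<Rightarrow> 'k" where
  "tensor_map F \<Phi> i \<equiv> mat_app (gens F i) (const_mat (\<Phi> i))"

lemma tensor_part_free: "v \<in> tensor_part F i j \<Longrightarrow> v \<in> free_module (gens F i)"
  by (auto simp: tensor_part_def free_module_def)

lemma tensor_cycles_part: "v \<in> tensor_cycles F i j \<Longrightarrow> v \<in> tensor_part F i j"
  by (simp add: tensor_cycles_def)

lemma tensor_cycles_Suc: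
  "v \<in> tensor_cycles F (Suc i) j \<longleftrightarrow> v \<in> tensor_part F (Suc i) j \<and> tensor_dmap F i v = 0"
  by (auto simp: tensor_cycles_def fun_eq_iff)

lemma tensor_cycles_0: "tensor_cycles F 0 j = tensor_part F 0 j"
  by (simp add: tensor_cycles_def)

lemma free_module_scale: "v \<in> free_module B \<Longrightarrow> (\<lambda>b. r * v b) \<in> free_module B" for r :: "'r::comm_ring_1"
  by (simp add: free_module_def)

lemma tensor_part_add: "v \<in> tensor_part F i j \<Longrightarrow> w \<in> tensor_part F i j \<Longrightarrow> v + w \<in> tensor_part F i j"
  unfolding tensor_part_def by (rule free_module_add)

lemma tensor_part_scale: "v \<in> tensor_part F i j \<Longrightarrow> (\<lambda>b. r * v b) \<in> tensor_part F i j"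
  unfolding tensor_part_def by (rule free_module_scale)

lemma tensor_part_zero [simp]: "0 \<in> tensor_part F i j"
  unfolding tensor_part_def by simp

lemma tensor_cycles_add:
  "v \<in> tensor_cycles F i j \<Longrightarrow> w \<in> tensor_cycles F i j \<Longrightarrow> v + w \<in> tensor_cycles F i j"
  by (cases i) (simp_all add: tensor_cycles_Suc tensor_cycles_0 tensor_part_add tensor_dmap_add)

lemma tensor_cycles_scale: "v \<in> tensor_cycles F i j \<Longrightarrow> (\<lambda>b. r * v b) \<in> tensor_cycles F i j"
  by (cases i) (simp_all add: tensor_cycles_Suc tensor_cycles_0 tensor_part_scale tensor_dmap_scale zero_fun_def)

lemma tensor_cycles_zero [simp]: "0 \<in> tensor_cycles F i j"
  by (cases i) (simp_all add: tensor_cycles_Suc tensor_cycles_0)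

lemma tensor_boundaries_add:
  "v \<in> tensor_boundaries F i j \<Longrightarrow> w \<in> tensor_boundaries F i j \<Longrightarrow> v + w \<in> tensor_boundaries F i j"
  unfolding tensor_boundaries_def
  by (elim imageE) (simp add: tensor_dmap_add[symmetric] tensor_part_add)

lemma tensor_boundaries_scale:
  "v \<in> tensor_boundaries F i j \<Longrightarrow> (\<lambda>b. r * v b) \<in> tensor_boundaries F i j"
  unfolding tensor_boundaries_def
  by (elim imageE) (simp add: tensor_dmap_scale[symmetric] tensor_part_scale)

lemma tensor_boundaries_zero [simp]: "0 \<in> tensor_boundaries F i j"
  unfolding tensor_boundaries_def by (rule image_eqI[where x = 0]) simp_all

lemma tensor_boundaries_uminus: "v \<in> tensor_boundaries F i j \<Longrightarrow> - v \<in> tensor_boundaries F i j"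
  using tensor_boundaries_scale[of v F i j "-1"] by (simp add: fun_Compl_def)

lemma tensor_boundaries_diff:
  "v \<in> tensor_boundaries F i j \<Longrightarrow> w \<in> tensor_boundaries F i j \<Longrightarrow> v - w \<in> tensor_boundaries F i j"
  using tensor_boundaries_add[OF _ tensor_boundaries_uminus, of v F i j w] by simp

section \<open>Induced maps on the homology of the tensored complexes\<close>

context grading
begin

text \<open>A constant term has monomial degree \<open>deg 0 = 0\<close>, so it can only connect
  basis elements of equal degree.\<close>

lemma const_mat_tensor_part:
  fixes A :: "'c \<Rightarrow> 'b \<Rightarrow> ('n, 'k::field) mpoly"
  assumes A: "graded_matrix deg B dB C dC A" and v: "v \<in> free_module {b \<in> B. dB b = j}"
  shows "mat_app B (const_mat A) v \<in> free_module {p \<in> C. dC p = j}"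
proof -
  have "const_mat A p q * v q = 0" if "q \<in> B" "p \<notin> C \<or> dC p \<noteq> j" for p q
  proof (rule ccontr)
    assume "const_mat A p q * v q \<noteq> 0"
    then have "0 \<in> keys (A p q)" "dB q = j"
      using v by (auto simp: const_mat_def in_keys_iff free_module_def)
    moreover from this have "p \<in> C"
      using A by (force simp: graded_matrix_def)
    ultimately have "deg 0 + dC p = dB q"
      using A \<open>q \<in> B\<close> unfolding graded_matrix_def by blast
    then show False
      using \<open>p \<in> C\<close> \<open>dB q = j\<close> that by simp
  qed
  then show ?thesis
    by (auto simp: free_module_def mat_app_def intro!: sum.neutral)
qed

lemma tensor_map_part:
  "graded_matrix deg (gens F i) (gdeg F i) (gens G i') (gdeg G i') A \<Longrightarrow>
    v \<in> tensor_part F i j \<Longrightarrow> mat_app (gens F i) (const_mat A) v \<in> tensor_part G i' j"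
  unfolding tensor_part_def by (rule const_mat_tensor_part)

lemma tensor_map_commute:
  assumes "chain_lift deg F G c \<Phi>" "v \<in> free_module (gens F (Suc i))"
  shows "tensor_map F \<Phi> i (tensor_dmap F i v) = tensor_dmap G i (tensor_map F \<Phi> (Suc i) v)"
  using arg_cong[OF chain_lift_commute[OF assms(1) const_vec_free[OF assms(2)]], of const_part]
  by (simp only: const_part_mat_app const_part_dmap const_part_const_vec)

lemma tensor_dmap_dmap:
  fixes F :: "('b, 'd, ('n, 'k::field) mpoly, ('n, 'k) mpoly) aug_complex"
  assumes F: "graded_resolution deg L F" and v: "v \<in> free_module (gens F (Suc (Suc i)))"
  shows "tensor_dmap F i (tensor_dmap F (Suc i) v) = 0"
proof -
  have "dmap F i (dmap F (Suc i) (const_vec v)) = 0"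
    using dmap_res_cycles[OF F const_vec_free[OF v]] by (simp add: res_cycles_Suc)
  then show ?thesis
    using const_part_dmap[of F i "dmap F (Suc i) (const_vec v)"] const_part_dmap[of F "Suc i" "const_vec v"]
    by simp
qed

lemma tensor_dmap_part:
  fixes F :: "('b, 'd, ('n, 'k::field) mpoly, ('n, 'k) mpoly) aug_complex"
  assumes F: "graded_resolution deg L F" and "v \<in> tensor_part F (Suc i) j"
  shows "tensor_dmap F i v \<in> tensor_part F i j"
  unfolding tensor_dmap_def by (rule tensor_map_part[OF graded_resolution_dmat[OF F] assms(2)])

lemma tensor_boundaries_cycles:
  fixes F :: "('b, 'd, ('n, 'k::field) mpoly, ('n, 'k) mpoly) aug_complex"
  assumes F: "graded_resolution deg L F"
  shows "tensor_boundaries F i j \<subseteq> tensor_cycles F i j"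
proof
  fix v assume "v \<in> tensor_boundaries F i j"
  then obtain w where w: "w \<in> tensor_part F (Suc i) j" "v = tensor_dmap F i w"
    by (auto simp: tensor_boundaries_def)
  then show "v \<in> tensor_cycles F i j"
    using tensor_dmap_part[OF F w(1)]
    by (cases i) (auto simp: tensor_cycles_0 tensor_cycles_Suc tensor_dmap_dmap[OF F] tensor_part_free)
qed

lemma tensor_map_cycles:
  assumes "chain_lift deg F G c \<Phi>" "v \<in> tensor_cycles F i j"
  shows "tensor_map F \<Phi> i v \<in> tensor_cycles G i j"
proof -
  have "tensor_map F \<Phi> i v \<in> tensor_part G i j"
    by (rule tensor_map_part[OF chain_lift_graded[OF assms(1)] tensor_cycles_part[OF assms(2)]])
  then show ?thesis
    using assms tensor_map_commute[OF assms(1) tensor_part_free, of v "i - 1" j]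
    by (cases i) (simp_all add: tensor_cycles_0 tensor_cycles_Suc)
qed

lemma tensor_map_boundaries:
  assumes "chain_lift deg F G c \<Phi>" "v \<in> tensor_boundaries F i j"
  shows "tensor_map F \<Phi> i v \<in> tensor_boundaries G i j"
proof -
  obtain w where w: "w \<in> tensor_part F (Suc i) j" "v = tensor_dmap F i w"
    using assms by (auto simp: tensor_boundaries_def)
  then have "tensor_map F \<Phi> i v = tensor_dmap G i (tensor_map F \<Phi> (Suc i) w)"
    using tensor_map_commute[OF assms(1) tensor_part_free[OF w(1)]] by simp
  moreover have "tensor_map F \<Phi> (Suc i) w \<in> tensor_part G (Suc i) j"
    by (rule tensor_map_part[OF chain_lift_graded[OF assms(1)] w(1)])
  ultimately show ?thesis
    unfolding tensor_boundaries_def by blast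
qed

text \<open>The difference of the two lifts is null-homotopic. On a cycle the term of the homotopy
  relation that passes through the differential of \<open>F\<close> vanishes, and the other term is
  a boundary.\<close>

lemma tensor_map_unique:
  fixes F :: "('b, 'd, ('n, 'k::field) mpoly, ('n, 'k) mpoly) aug_complex"
    and G :: "('c, 'd, ('n, 'k) mpoly, ('n, 'k) mpoly) aug_complex"
  assumes F: "graded_resolution deg L F" and G: "graded_resolution deg L' G"
    and \<Phi>: "chain_lift deg F G c \<Phi>" and \<Psi>: "chain_lift deg F G c \<Psi>"
    and v: "v \<in> tensor_cycles F i j"
  shows "tensor_map F \<Phi> i v - tensor_map F \<Psi> i v \<in> tensor_boundaries G i j"
proof -
  have lift: "chain_lift deg F G 0 (\<lambda>i. \<Phi> i - \<Psi> i)"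
    using chain_lift_diff[OF \<Phi> \<Psi>] by simp
  obtain s where s: "\<And>i. graded_matrix deg (gens F i) (gdeg F i) (gens G (Suc i)) (gdeg G (Suc i)) (s i)"
    "\<And>v. v \<in> free_module (gens F 0) \<Longrightarrow>
       mat_app (gens F 0) (\<Phi> 0 - \<Psi> 0) v = dmap G 0 (mat_app (gens F 0) (s 0) v)"
    "\<And>i v. v \<in> free_module (gens F (Suc i)) \<Longrightarrow>
       mat_app (gens F (Suc i)) (\<Phi> (Suc i) - \<Psi> (Suc i)) v
         = dmap G (Suc i) (mat_app (gens F (Suc i)) (s (Suc i)) v) + mat_app (gens F i) (s i) (dmap F i v)"
    using null_homotopy_exists[OF F G lift] by metis
  have vf: "const_vec v \<in> free_module (gens F i)"
    using v by (blast intro: const_vec_free tensor_part_free tensor_cycles_part)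
  have "tensor_map F (\<lambda>i. \<Phi> i - \<Psi> i) i v = tensor_dmap G i (tensor_map F s i v)"
  proof (cases i)
    case 0
    then show ?thesis
      using arg_cong[OF s(2)[of "const_vec v"], of const_part] vf
      by (simp only: const_part_mat_app const_part_dmap const_part_const_vec)
  next
    case (Suc l)
    then show ?thesis
      using arg_cong[OF s(3)[of "const_vec v" l], of const_part] vf v
      by (simp only: const_part_mat_app const_part_dmap const_part_const_vec const_part_add tensor_cycles_Suc
          mat_app_zero add_0_right)
  qed
  moreover have "tensor_map F s i v \<in> tensor_part G (Suc i) j"
    by (rule tensor_map_part[OF s(1) tensor_cycles_part[OF v]])
  ultimately show ?thesis
    unfolding tensor_boundaries_def by (simp add: const_mat_diff mat_app_mat_diff)
qed

text \<open>Vanishing of the induced map in all degrees, phrased on representatives so that no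
  cosets have to be handled.\<close>

definition tor_zero_map ::
  "('b, 'd, ('n, 'k::field) mpoly, ('n, 'k) mpoly) aug_complex
    \<Rightarrow> ('c, 'd, ('n, 'k) mpoly, ('n, 'k) mpoly) aug_complex
    \<Rightarrow> (nat \<Rightarrow> 'c \<Rightarrow> 'b \<Rightarrow> ('n, 'k) mpoly) \<Rightarrow> bool" where
  "tor_zero_map F G \<Phi> \<longleftrightarrow>
     (\<forall>i j. \<forall>v\<in>tensor_cycles F i j. tensor_map F \<Phi> i v \<in> tensor_boundaries G i j)"

text \<open>Comparison maps on both sides turn \<open>\<Phi>\<close> into another lift of
  multiplication by \<open>c\<close> between the new resolutions, and \<open>\<Psi>\<close> agrees
  with that lift on homology.\<close>

lemma tor_zero_map_transfer:
  fixes F :: "('b, 'd, ('n, 'k::field) mpoly, ('n, 'k) mpoly) aug_complex"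
    and G :: "('c, 'd, ('n, 'k) mpoly, ('n, 'k) mpoly) aug_complex"
    and F' :: "('b', 'd, ('n, 'k) mpoly, ('n, 'k) mpoly) aug_complex"
    and G' :: "('c', 'd, ('n, 'k) mpoly, ('n, 'k) mpoly) aug_complex"
  assumes F: "graded_resolution deg L F" and F': "graded_resolution deg L F'"
    and G: "graded_resolution deg L' G" and G': "graded_resolution deg L' G'"
    and \<Phi>: "chain_lift deg F G c \<Phi>" and \<Psi>: "chain_lift deg F' G' c \<Psi>"
    and zero: "tor_zero_map F G \<Phi>"
  shows "tor_zero_map F' G' \<Psi>"
  unfolding tor_zero_map_def
proof (intro allI ballI)
  fix i j v assume v: "v \<in> tensor_cycles F' i j"
  obtain \<alpha> where \<alpha>: "chain_lift deg F' F 1 \<alpha>"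
    using chain_lift_exists[OF F' F, of 1] by auto
  obtain \<beta> where \<beta>: "chain_lift deg G G' 1 \<beta>"
    using chain_lift_exists[OF G G', of 1] by auto
  define \<gamma> where "\<gamma> = (\<lambda>i. mat_mult (gens G i) (\<beta> i) (mat_mult (gens F i) (\<Phi> i) (\<alpha> i)))"
  have \<gamma>: "chain_lift deg F' G' c \<gamma>"
    using chain_lift_comp[OF chain_lift_comp[OF \<alpha> \<Phi>] \<beta>] by (simp add: \<gamma>_def)
  have "tensor_map F' \<gamma> i v = tensor_map G \<beta> i (tensor_map F \<Phi> i (tensor_map F' \<alpha> i v))"
    by (simp add: \<gamma>_def const_mat_mat_mult mat_app_mat_mult)
  also have "\<dots> \<in> tensor_boundaries G' i j"
    using zero tensor_map_cycles[OF \<alpha> v] by (auto simp: tor_zero_map_def intro: tensor_map_boundaries[OF \<beta>])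
  finally have "tensor_map F' \<gamma> i v \<in> tensor_boundaries G' i j" .
  from tensor_boundaries_add[OF tensor_map_unique[OF F' G' \<Psi> \<gamma> v] this]
  show "tensor_map F' \<Psi> i v \<in> tensor_boundaries G' i j"
    by simp
qed

text \<open>The round trip through \<open>G\<close> is homotopic to the identity, so the comparison
  map is injective on homology. Injectivity alone suffices, since dimensions are later compared in
  both directions.\<close>

lemma tensor_comparison:
  fixes F :: "('b, 'd, ('n, 'k::field) mpoly, ('n, 'k) mpoly) aug_complex"
    and G :: "('c, 'd, ('n, 'k) mpoly, ('n, 'k) mpoly) aug_complex"
  assumes F: "graded_resolution deg L F" and G: "graded_resolution deg L G"
  obtains \<alpha> where "chain_lift deg F G 1 \<alpha>"
    "\<And>i j v. v \<in> tensor_cycles F i j \<Longrightarrow> tensor_map F \<alpha> i v \<in> tensor_boundaries G i j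
       \<Longrightarrow> v \<in> tensor_boundaries F i j"
proof -
  obtain \<alpha> where \<alpha>: "chain_lift deg F G 1 \<alpha>"
    using chain_lift_exists[OF F G, of 1] by auto
  obtain \<beta> where \<beta>: "chain_lift deg G F 1 \<beta>"
    using chain_lift_exists[OF G F, of 1] by auto
  define \<gamma> where "\<gamma> = (\<lambda>i. mat_mult (gens G i) (\<beta> i) (\<alpha> i))"
  have \<gamma>: "chain_lift deg F F 1 \<gamma>"
    using chain_lift_comp[OF \<alpha> \<beta>] by (simp add: \<gamma>_def)
  have "v \<in> tensor_boundaries F i j"
    if v: "v \<in> tensor_cycles F i j" "tensor_map F \<alpha> i v \<in> tensor_boundaries G i j" for i j v
  proof -
    have "tensor_map F \<gamma> i v \<in> tensor_boundaries F i j"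
      using tensor_map_boundaries[OF \<beta> v(2)] by (simp add: \<gamma>_def const_mat_mat_mult mat_app_mat_mult)
    from tensor_boundaries_add[OF tensor_map_unique[OF F F chain_lift_id[OF F] \<gamma> v(1)] this]
    show ?thesis
      using mat_app_id_mat[OF graded_resolution_finite[OF F] tensor_part_free[OF tensor_cycles_part[OF v(1)]]]
      by (simp add: const_mat_id)
  qed
  then show ?thesis
    using that[OF \<alpha>] by blast
qed

end

section \<open>Dimensions of quotients of spaces of functions\<close>

interpretation fun_space: vector_space "\<lambda>(c::'k::field) (v::'b \<Rightarrow> 'k) b. c * v b"
  by standard (simp_all add: fun_eq_iff algebra_simps)

lemma sum_fun_app: "(\<Sum>i\<in>A. f i) x = (\<Sum>i\<in>A. f i x)" for f :: "'i \<Rightarrow> 'a \<Rightarrow> 'b::comm_monoid_add"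
  by (induction A rule: infinite_finite_induct) auto

lemma fcoset_iff: "u \<in> fcoset W v \<longleftrightarrow> u - v \<in> W"
  by (simp add: fcoset_def fun_diff_def)

lemma subspace_free_module: "fun_space.subspace (free_module B)"
  by (rule fun_space.subspaceI) (auto simp: free_module_def)

lemma free_module_subset_span:
  assumes "finite B"
  shows "(free_module B :: ('b \<Rightarrow> 'k::field) set) \<subseteq> fun_space.span (unit_vec ` B)"
proof
  fix v :: "'b \<Rightarrow> 'k" assume v: "v \<in> free_module B"
  have "v = (\<Sum>b\<in>B. (\<lambda>b'. v b * unit_vec b b'))"
  proof
    fix x
    have "(\<Sum>b\<in>B. v b * unit_vec b x) = (\<Sum>b\<in>B. if b = x then v x else 0)"
      by (intro sum.cong) (auto simp: unit_vec_def)
    then show "v x = (\<Sum>b\<in>B. (\<lambda>b'. v b * unit_vec b b')) x"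
      using v assms by (auto simp: sum_fun_app free_module_def)
  qed
  also have "\<dots> \<in> fun_space.span (unit_vec ` B)"
    by (intro fun_space.span_sum fun_space.span_scale fun_space.span_base imageI)
  finally show "v \<in> fun_space.span (unit_vec ` B)" .
qed

definition lin_comb :: "('b \<Rightarrow> 'k::field) set \<Rightarrow> (('b \<Rightarrow> 'k) \<Rightarrow> 'k) \<Rightarrow> 'b \<Rightarrow> 'k" where
  "lin_comb S c = (\<lambda>b. \<Sum>s\<in>S. c s * s b)"

lemma lin_comb_eq: "lin_comb S c = (\<Sum>s\<in>S. (\<lambda>b. c s * s b))"
  by (simp add: lin_comb_def fun_eq_iff sum_fun_app)

lemma lin_comb_diff: "lin_comb S (c - c') = lin_comb S c - lin_comb S c'"
  by (simp add: lin_comb_def fun_eq_iff left_diff_distrib sum_subtractf)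

lemma lin_comb_in_subspace: "fun_space.subspace V \<Longrightarrow> S \<subseteq> V \<Longrightarrow> lin_comb S c \<in> V"
  unfolding lin_comb_eq by (intro fun_space.subspace_sum fun_space.subspace_scale) auto

text \<open>Unique representation splits into spanning and independence modulo \<open>W\<close>.
  Uniqueness is only asserted at vectors of \<open>V\<close>, so independence can be extracted only
  if \<open>V\<close> has an element.\<close>

lemma quotient_basis_iff:
  assumes W: "fun_space.subspace W"
  shows "quotient_basis V W S \<longleftrightarrow> finite S \<and> S \<subseteq> V \<and>
    (\<forall>v\<in>V. \<exists>c\<in>free_module S. v - lin_comb S c \<in> W) \<and>
    (\<forall>c\<in>free_module S. lin_comb S c \<in> W \<and> V \<noteq> {} \<longrightarrow> c = 0)"
    (is "?L \<longleftrightarrow> ?R")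
proof
  assume L: ?L
  then have uniq: "\<exists>!c. c \<in> free_module S \<and> v - lin_comb S c \<in> W" if "v \<in> V" for v
    using that by (simp add: quotient_basis_def fcoset_iff lin_comb_def)
  have "c = 0" if c: "c \<in> free_module S" "lin_comb S c \<in> W" "V \<noteq> {}" for c
  proof -
    obtain v where v: "v \<in> V" using c(3) by blast
    obtain a where a: "a \<in> free_module S" "v - lin_comb S a \<in> W"
      using uniq[OF v] by blast
    \<comment> \<open>Subtracting a relation modulo \<open>W\<close> from the coefficients of
      \<open>v\<close> gives a second representation of \<open>v\<close>.\<close>
    have "v - lin_comb S (a - c) \<in> W"
      using fun_space.subspace_add[OF W a(2) c(2)] by (simp only: lin_comb_diff diff_diff_eq2 add_diff_eq diff_add_eq)
    then have "a - c = a"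
      using uniq[OF v] a c(1) by blast
    then show ?thesis
      by (metis add_diff_cancel_left' diff_add_cancel diff_self)
  qed
  then show ?R
    using L uniq by (fastforce simp: quotient_basis_def)
next
  assume R: ?R
  have "c = a" if "v \<in> V" "c \<in> free_module S" "v - lin_comb S c \<in> W" "a \<in> free_module S" "v - lin_comb S a \<in> W"
    for v c a
  proof -
    have "lin_comb S (c - a) = (v - lin_comb S a) - (v - lin_comb S c)"
      by (simp add: lin_comb_diff)
    then have "lin_comb S (c - a) \<in> W"
      using fun_space.subspace_diff[OF W that(5,3)] by simp
    then have "c - a = 0"
      using R that free_module_diff by blast
    then show ?thesis by simp
  qed
  note uniq = this
  have "\<exists>!c. c \<in> free_module S \<and> v - lin_comb S c \<in> W" if v: "v \<in> V" for v
  proof -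
    obtain c where "c \<in> free_module S" "v - lin_comb S c \<in> W"
      using R v by blast
    then show ?thesis
      using uniq[OF v] by (intro ex1I[of _ c]) auto
  qed
  then show ?L
    using R by (simp add: quotient_basis_def fcoset_iff lin_comb_def)
qed

lemma quotient_basis_repr:
  assumes "fun_space.subspace W" "quotient_basis V W S" "v \<in> V"
  obtains c where "c \<in> free_module S" "v - lin_comb S c \<in> W"
  using assms(2,3) unfolding quotient_basis_iff[OF assms(1)] by metis

lemma quotient_basis_zero:
  assumes "fun_space.subspace W" "quotient_basis V W S" "c \<in> free_module S" "lin_comb S c \<in> W" "V \<noteq> {}"
  shows "c = 0"
  using assms(2-) unfolding quotient_basis_iff[OF assms(1)] by simp

text \<open>The linear map \<open>f\<close> is injective modulo \<open>W\<close> and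
  \<open>W'\<close>. Writing the images of \<open>S\<close> in terms of \<open>S'\<close> modulo
  \<open>W'\<close> gives independent coefficient vectors in the space of functions on
  \<open>S'\<close>, and the exchange bound compares the cardinalities.\<close>

lemma quotient_basis_card_le:
  fixes f :: "('b \<Rightarrow> 'k::field) \<Rightarrow> 'c \<Rightarrow> 'k"
  assumes V: "fun_space.subspace V" and W: "fun_space.subspace W" and W': "fun_space.subspace W'"
    and S: "quotient_basis V W S" and S': "quotient_basis V' W' S'"
    and add: "\<And>u v. f (u + v) = f u + f v" and scale: "\<And>c v. f (\<lambda>b. c * v b) = (\<lambda>p. c * f v p)"
    and fV: "\<And>v. v \<in> V \<Longrightarrow> f v \<in> V'" and inj: "\<And>v. v \<in> V \<Longrightarrow> f v \<in> W' \<Longrightarrow> v \<in> W"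
  shows "card S \<le> card S'"
proof -
  have finS: "finite S" and SV: "S \<subseteq> V" and finS': "finite S'"
    using S S' by (auto simp: quotient_basis_def)
  have "\<exists>c\<in>free_module S'. f s - lin_comb S' c \<in> W'" if "s \<in> S" for s
    using quotient_basis_repr[OF W' S' fV[OF subsetD[OF SV that]]] by metis
  then obtain c where c: "\<And>s. s \<in> S \<Longrightarrow> c s \<in> free_module S'" "\<And>s. s \<in> S \<Longrightarrow> f s - lin_comb S' (c s) \<in> W'"
    by metis
  have f0: "f 0 = 0"
    using scale[of 0 0] by (simp add: zero_fun_def)
  have indep: "x s = 0" if x: "(\<Sum>s\<in>S. (\<lambda>t. x s * c s t)) = 0" and s: "s \<in> S" for x s
  proof -
    define y where "y = (\<lambda>s. if s \<in> S then x s else 0)"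
    have fsum: "f (\<Sum>s\<in>T. (\<lambda>b. y s * s b)) = (\<Sum>s\<in>T. (\<lambda>p. y s * f s p))" if "finite T" for T
      using that by (induction T rule: finite_induct) (simp_all only: sum.empty f0 sum.insert add scale not_False_eq_True)
    have "(\<Sum>s\<in>S. x s * c s t) = 0" for t
      using fun_cong[OF x, of t] by (simp add: sum_fun_app)
    then have "(\<Sum>s\<in>S. y s * c s t) = 0" for t
      by (simp add: y_def)
    then have "(\<Sum>t\<in>S'. (\<Sum>s\<in>S. y s * c s t) * t p) = 0" for p
      by simp
    then have zero: "(\<Sum>s\<in>S. y s * lin_comb S' (c s) p) = 0" for p
      unfolding lin_comb_def sum_distrib_left sum_distrib_right
      by (subst sum.swap) (simp add: mult.assoc)
    have "f (lin_comb S y) = (\<Sum>s\<in>S. (\<lambda>p. y s * (f s - lin_comb S' (c s)) p))"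
      unfolding lin_comb_eq[of S] fsum[OF finS]
      using zero by (simp add: fun_eq_iff sum_fun_app right_diff_distrib sum_subtractf)
    also have "\<dots> \<in> W'"
      using c(2) by (intro fun_space.subspace_sum[OF W'] fun_space.subspace_scale[OF W'])
    finally have "lin_comb S y \<in> W"
      using inj lin_comb_in_subspace[OF V SV] by blast
    moreover have "y \<in> free_module S"
      by (simp add: y_def free_module_def)
    ultimately have "y = 0"
      using quotient_basis_zero[OF W S] s SV by auto
    then show ?thesis
      using s by (metis y_def zero_fun_apply)
  qed
  \<comment> \<open>Independence is a property of the image set, so \<open>c\<close> must not
    identify elements of \<open>S\<close>: if \<open>c s = c t\<close>, the coefficients 1 and -1 at
    \<open>s\<close> and \<open>t\<close> would be a forbidden relation.\<close>
  have inj_c: "inj_on c S"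
  proof (rule inj_onI, rule ccontr)
    fix s t assume st: "s \<in> S" "t \<in> S" "c s = c t" "s \<noteq> t"
    define x where "x = (\<lambda>r. if r = s then 1 else if r = t then - 1 else (0::'k))"
    have "(\<Sum>r\<in>S. x r * c r u) = (\<Sum>r\<in>S. (if r = s then c s u else 0) - (if r = t then c t u else 0))" for u
      using st by (intro sum.cong) (auto simp: x_def)
    then have "(\<Sum>r\<in>S. x r * c r u) = 0" for u
      using st finS by (simp add: sum_subtractf)
    then have "x s = 0"
      by (intro indep) (simp_all add: fun_eq_iff sum_fun_app st)
    then show False by (simp add: x_def)
  qed
  have "g v = 0" if g: "(\<Sum>v\<in>c ` S. (\<lambda>b. g v * v b)) = 0" and v: "v \<in> c ` S" for g v
  proof -
    have "(\<Sum>s\<in>S. (\<lambda>b. g (c s) * c s b)) = 0"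
      using g by (simp add: sum.reindex[OF inj_c])
    then show "g v = 0"
      using v indep[of "\<lambda>s. g (c s)"] by auto
  qed
  then have "fun_space.independent (c ` S)"
    using finS by (intro fun_space.independent_if_scalars_zero[of "c ` S"]) simp_all
  moreover have "c ` S \<subseteq> fun_space.span (unit_vec ` S')"
    using c(1) free_module_subset_span[OF finS'] by blast
  ultimately have "card (c ` S) \<le> card (unit_vec ` S' :: (('c \<Rightarrow> 'k) \<Rightarrow> 'k) set)"
    using fun_space.independent_span_bound finS' by blast
  also have "\<dots> \<le> card S'"
    using finS' by (rule card_image_le)
  finally show ?thesis
    by (simp add: card_image[OF inj_c])
qed

text \<open>With the identity map as \<open>f\<close>, any two bases of the same quotient bound each
  other, so the definite description is well defined.\<close>

lemma quotient_dim_eq: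
  assumes "fun_space.subspace V" "fun_space.subspace W" "quotient_basis V W S"
  shows "quotient_dim V W = card S"
  unfolding quotient_dim_def
proof (rule the_equality)
  show "\<exists>T. quotient_basis V W T \<and> card T = card S"
    using assms by blast
  have "card T \<le> card T'" if "quotient_basis V W T" "quotient_basis V W T'" for T T'
    by (rule quotient_basis_card_le[where f = "\<lambda>v. v", OF assms(1,2,2) that]) auto
  then show "d = card S" if "\<exists>T. quotient_basis V W T \<and> card T = d" for d
    using assms that by (metis order_antisym)
qed

text \<open>A basis of \<open>W\<close> is extended to one of \<open>V\<close>, and the added
  vectors represent a basis of the quotient. The finite spanning set ensures that there are finitely
  many of them.\<close>

lemma quotient_basis_exists:
  fixes V W :: "('b \<Rightarrow> 'k::field) set"
  assumes V: "fun_space.subspace V" and W: "fun_space.subspace W" and WV: "W \<subseteq> V"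
    and B: "finite B" "V \<subseteq> fun_space.span B"
  shows "\<exists>S. quotient_basis V W S"
proof -
  obtain Q where Q: "Q \<subseteq> W" "fun_space.independent Q" "W \<subseteq> fun_space.span Q"
    using fun_space.maximal_independent_subset by blast
  obtain Q' where Q': "Q \<subseteq> Q'" "Q' \<subseteq> V" "fun_space.independent Q'" "V \<subseteq> fun_space.span Q'"
    using fun_space.maximal_independent_subset_extend[OF _ Q(2), of V] Q(1) WV by blast
  have fin: "finite Q'"
    using fun_space.independent_span_bound[OF B(1) Q'(3)] Q'(2) B(2) by blast
  define S where "S = Q' - Q"
  have split: "lin_comb Q' c = lin_comb Q c + lin_comb S c" for c
    using sum.subset_diff[OF Q'(1) fin, of "\<lambda>q. c q * q b" for b]
    by (simp add: lin_comb_def S_def fun_eq_iff add.commute)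
  have spanQ: "fun_space.span T = range (lin_comb T)" if "finite T" for T :: "('b \<Rightarrow> 'k) set"
    using fun_space.span_finite[OF that] by (simp add: lin_comb_eq[abs_def])
  have finQ: "finite Q"
    by (rule finite_subset[OF Q'(1) fin])
  have "\<exists>c\<in>free_module S. v - lin_comb S c \<in> W" if v: "v \<in> V" for v
  proof -
    obtain c where c: "v = lin_comb Q' c"
      using subsetD[OF Q'(4) v] unfolding spanQ[OF fin] by (elim rangeE)
    define c' where "c' = (\<lambda>s. if s \<in> S then c s else 0)"
    have "lin_comb S c' = lin_comb S c"
      by (simp add: lin_comb_def c'_def)
    then have "v - lin_comb S c' = lin_comb Q c"
      using c split by simp
    then show ?thesis
      using lin_comb_in_subspace[OF W Q(1)] by (intro bexI[of _ c']) (auto simp: c'_def free_module_def)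
  qed
  moreover have "c = 0" if c: "c \<in> free_module S" "lin_comb S c \<in> W" for c
  proof -
    obtain a where a: "lin_comb S c = lin_comb Q a"
      using subsetD[OF Q(3) c(2)] unfolding spanQ[OF finQ] by (elim rangeE)
    \<comment> \<open>Both sides of the equation are merged into one linear relation on the basis
      \<open>Q'\<close>, with coefficients \<open>c\<close> outside \<open>Q\<close> and
      \<open>- a\<close> on \<open>Q\<close>.\<close>
    define e where "e = (\<lambda>q. if q \<in> Q then - a q else c q)"
    have "lin_comb Q e = - lin_comb Q a"
      by (simp add: lin_comb_def e_def fun_eq_iff sum_negf)
    moreover have "lin_comb S e = lin_comb S c"
      by (auto simp: lin_comb_def e_def S_def intro!: ext sum.cong)
    ultimately have "lin_comb Q' e = 0"
      using a split by simp
    then have "e q = 0" if "q \<in> Q'" for q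
      using fun_space.independentD[OF Q'(3) fin subset_refl _ that] by (simp add: lin_comb_eq)
    then have "c q = 0" if "q \<in> S" for q
      using that by (metis DiffE S_def e_def)
    then show ?thesis
      using c(1) by (auto simp: fun_eq_iff free_module_def)
  qed
  ultimately have "quotient_basis V W S"
    unfolding quotient_basis_iff[OF W] using fin Q'(2) by (auto simp: S_def)
  then show ?thesis ..
qed

lemma quotient_dim_le:
  fixes f :: "('b \<Rightarrow> 'k::field) \<Rightarrow> 'c \<Rightarrow> 'k"
  assumes V: "fun_space.subspace V" "finite B" "V \<subseteq> fun_space.span B"
    and W: "fun_space.subspace W" "W \<subseteq> V"
    and V': "fun_space.subspace V'" "finite B'" "V' \<subseteq> fun_space.span B'"
    and W': "fun_space.subspace W'" "W' \<subseteq> V'"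
    and add: "\<And>u v. f (u + v) = f u + f v" and scale: "\<And>c v. f (\<lambda>b. c * v b) = (\<lambda>p. c * f v p)"
    and fV: "\<And>v. v \<in> V \<Longrightarrow> f v \<in> V'" and inj: "\<And>v. v \<in> V \<Longrightarrow> f v \<in> W' \<Longrightarrow> v \<in> W"
  shows "quotient_dim V W \<le> quotient_dim V' W'"
proof -
  obtain S where S: "quotient_basis V W S"
    using quotient_basis_exists[OF V(1) W V(2,3)] ..
  obtain S' where S': "quotient_basis V' W' S'"
    using quotient_basis_exists[OF V'(1) W' V'(2,3)] ..
  have "card S \<le> card S'"
    using quotient_basis_card_le[where f = f, OF V(1) W(1) W'(1) S S'] add scale fV inj by blast
  then show ?thesis
    using quotient_dim_eq[OF V(1) W(1) S] quotient_dim_eq[OF V'(1) W'(1) S'] by simp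
qed

lemma quotient_dim_free_module:
  assumes "finite B"
  shows "quotient_dim (free_module B :: ('b \<Rightarrow> 'k::field) set) {0} = card B"
proof -
  let ?S = "unit_vec ` B :: ('b \<Rightarrow> 'k) set"
  have inj: "inj_on (unit_vec :: 'b \<Rightarrow> 'b \<Rightarrow> 'k) B"
    by (rule inj_onI) (metis unit_vec_def zero_neq_one)
  have zero: "fun_space.subspace {0}"
    by (rule fun_space.subspaceI) (auto simp: fun_eq_iff)
  have lc: "lin_comb ?S c p = (if p \<in> B then c (unit_vec p) else 0)" for c p
  proof -
    have "lin_comb ?S c p = (\<Sum>b\<in>B. c (unit_vec b) * unit_vec b p)"
      by (simp add: lin_comb_def sum.reindex[OF inj])
    also have "\<dots> = (\<Sum>b\<in>B. if b = p then c (unit_vec p) else 0)"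
      by (intro sum.cong) (auto simp: unit_vec_def)
    finally show ?thesis using assms by simp
  qed
  have ex: "\<exists>c\<in>free_module ?S. v - lin_comb ?S c \<in> {0}" if v: "v \<in> free_module B" for v :: "'b \<Rightarrow> 'k"
  proof -
    define c where "c = (\<lambda>s. if s \<in> ?S then v (inv_into B unit_vec s) else 0)"
    have "lin_comb ?S c = v"
      using v by (auto simp: lc c_def inv_into_f_f[OF inj] free_module_def)
    then show ?thesis
      by (intro bexI[of _ c]) (auto simp: c_def free_module_def)
  qed
  have "c = 0" if c: "c \<in> free_module ?S" "lin_comb ?S c \<in> {0}" for c
  proof
    fix s
    show "c s = 0 s"
    proof (cases "s \<in> ?S")
      case True
      then obtain p where p: "p \<in> B" "s = unit_vec p" by blast
      have "lin_comb ?S c p = 0"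
        using c(2) by simp
      then show ?thesis
        unfolding lc using p by simp
    next
      case False
      then show ?thesis using c(1) by (simp add: free_module_def)
    qed
  qed
  then have "quotient_basis (free_module B) {0} ?S"
    unfolding quotient_basis_iff[OF zero] using ex assms by auto
  then show ?thesis
    using quotient_dim_eq[OF subspace_free_module zero] card_image[OF inj] by metis
qed

text \<open>Representatives of a basis of the quotient are independent, and there are
  \<open>card B\<close> of them inside a space of dimension \<open>card B\<close>. A nonzero element
  of \<open>W\<close> lies outside their span and would be one vector too many.\<close>

lemma quotient_dim_full:
  fixes V W :: "('b \<Rightarrow> 'k::field) set"
  assumes B: "finite B" and V: "fun_space.subspace V" "V \<subseteq> free_module B"
    and W: "fun_space.subspace W" "W \<subseteq> V" and dim: "quotient_dim V W = card B"
  shows "W = {0}"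
proof -
  have finU: "finite (unit_vec ` B :: ('b \<Rightarrow> 'k) set)" and VU: "V \<subseteq> fun_space.span (unit_vec ` B)"
    using B V(2) free_module_subset_span[OF B] by auto
  obtain S where S: "quotient_basis V W S"
    using quotient_basis_exists[OF V(1) W finU VU] ..
  have card: "card S = card B"
    using quotient_dim_eq[OF V(1) W(1) S] dim by simp
  have finS: "finite S" and SV: "S \<subseteq> V"
    using S by (auto simp: quotient_basis_def)
  have coeff: "c s = 0" if c: "lin_comb S c \<in> W" and s: "s \<in> S" for c s
  proof -
    define c' where "c' = (\<lambda>s. if s \<in> S then c s else 0)"
    have "lin_comb S c' = lin_comb S c"
      by (simp add: lin_comb_def c'_def)
    then have "c' = 0"
      using c s SV by (intro quotient_basis_zero[OF W(1) S]) (auto simp: c'_def free_module_def)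
    then show ?thesis
      using s by (metis c'_def zero_fun_apply)
  qed
  have indep: "fun_space.independent S"
    using coeff fun_space.subspace_0[OF W(1)]
    by (intro fun_space.independent_if_scalars_zero[OF finS]) (simp add: lin_comb_eq)
  have "w = 0" if w: "w \<in> W" for w
  proof (rule ccontr)
    assume nz: "w \<noteq> 0"
    have "w \<notin> fun_space.span S"
    proof
      assume "w \<in> fun_space.span S"
      then obtain c where c: "w = lin_comb S c"
        using fun_space.span_finite[OF finS] by (auto simp: lin_comb_eq)
      then have "c s = 0" if "s \<in> S" for s
        using coeff w that by blast
      then show False
        using c nz by (auto simp: lin_comb_def fun_eq_iff)
    qed
    then have "fun_space.independent (insert w S)" "w \<notin> S"
      using indep fun_space.independent_insertI fun_space.span_base by blast+
    moreover have "insert w S \<subseteq> fun_space.span (unit_vec ` B)"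
      using SV VU W(2) w by blast
    ultimately have "card (insert w S) \<le> card (unit_vec ` B :: ('b \<Rightarrow> 'k) set)"
      using fun_space.independent_span_bound[OF finU] by blast
    also have "\<dots> \<le> card B"
      using B by (rule card_image_le)
    finally show False
      using card finS \<open>w \<notin> S\<close> by simp
  qed
  then show ?thesis
    using fun_space.subspace_0[OF W(1)] by blast
qed

section \<open>Minimality\<close>

interpretation ring_module: module "(*) :: 'r::comm_ring_1 \<Rightarrow> 'r \<Rightarrow> 'r"
  by standard (simp_all add: algebra_simps)

lemma poly_mapping_sum_singles: "f = (\<Sum>m\<in>keys f. Poly_Mapping.single m (lookup f m))"
proof (rule poly_mapping_eqI)
  fix m
  have "(\<Sum>m'\<in>keys f. lookup (Poly_Mapping.single m' (lookup f m')) m)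
      = (\<Sum>m'\<in>keys f. if m' = m then lookup f m else 0)"
    by (intro sum.cong) (auto simp: lookup_single when_def)
  then show "lookup f m = lookup (\<Sum>m\<in>keys f. Poly_Mapping.single m (lookup f m)) m"
    by (auto simp: lookup_sum in_keys_iff)
qed

lemma monomial_mult: "Poly_Mapping.single m c * monomial m' = Poly_Mapping.single (m + m') (c::'k::field)"
  by (simp add: monomial_def mult_single)

text \<open>A polynomial without constant term is a sum of terms each divisible by some variable;
  conversely, the vanishing of the constant term is stable under sums and multiples.\<close>

lemma irrelevant_ideal_eq: "irrelevant_ideal = {f :: ('n, 'k::field) mpoly. lookup f 0 = 0}"
proof
  have "ring_module.subspace {f :: ('n, 'k) mpoly. lookup f 0 = 0}"
    by (rule ring_module.subspaceI) (simp_all add: lookup_add lookup_mult_zero)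
  moreover have "range (\<lambda>i. monomial (Poly_Mapping.single i 1)) \<subseteq> {f :: ('n, 'k) mpoly. lookup f 0 = 0}"
  proof clarsimp
    fix i :: 'n
    have "Poly_Mapping.single i (1::nat) \<noteq> 0"
      by (metis lookup_single_eq lookup_zero zero_neq_one)
    then show "lookup (monomial (Poly_Mapping.single i (Suc 0)) :: ('n, 'k) mpoly) 0 = 0"
      by (simp add: monomial_def lookup_single when_def)
  qed
  ultimately show "irrelevant_ideal \<subseteq> {f :: ('n, 'k) mpoly. lookup f 0 = 0}"
    unfolding irrelevant_ideal_def ideal_gen_def by (intro ring_module.span_minimal)
  show "{f :: ('n, 'k) mpoly. lookup f 0 = 0} \<subseteq> irrelevant_ideal"
  proof
    fix f :: "('n, 'k) mpoly" assume f: "f \<in> {f. lookup f 0 = 0}"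
    have "Poly_Mapping.single m (lookup f m) \<in> irrelevant_ideal" if m: "m \<in> keys f" for m
    proof -
      have "m \<noteq> 0"
        using m f by (auto simp: in_keys_iff)
      then obtain i where i: "lookup m i \<noteq> 0"
        by (metis lookup_zero poly_mapping_eqI)
      then have "m = (m - Poly_Mapping.single i 1) + Poly_Mapping.single i 1"
        by (intro poly_mapping_eqI) (auto simp: lookup_add lookup_minus lookup_single when_def)
      then have "Poly_Mapping.single m (lookup f m) = Poly_Mapping.single (m - Poly_Mapping.single i 1) (lookup f m)
          * monomial (Poly_Mapping.single i 1)"
        by (simp add: monomial_mult)
      then show ?thesis
        unfolding irrelevant_ideal_def ideal_gen_def
        by (metis rangeI ring_module.span_base ring_module.span_scale)
    qed
    then have "(\<Sum>m\<in>keys f. Poly_Mapping.single m (lookup f m)) \<in> irrelevant_ideal"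
      unfolding irrelevant_ideal_def ideal_gen_def by (rule ring_module.span_sum)
    then show "f \<in> irrelevant_ideal"
      using poly_mapping_sum_singles[of f] by simp
  qed
qed

text \<open>Minimality is tested on unit vectors, which recover the entries of the matrices.
  Conversely, the constant terms of an image depend only on the constant terms of the matrix and the
  vector.\<close>

lemma minimal_complex_iff:
  assumes "\<And>i. finite (gens F i)"
    and "\<And>i. graded_matrix deg (gens F (Suc i)) (gdeg F (Suc i)) (gens F i) (gdeg F i) (dmat F i)"
  shows "minimal_complex F \<longleftrightarrow> (\<forall>i. const_mat (dmat F i) = 0)"
proof
  assume min: "minimal_complex F"
  have "lookup (dmat F i p q) 0 = 0" for i p q
  proof (cases "q \<in> gens F (Suc i)")
    case True
    have "dmap F i (unit_vec q) p \<in> irrelevant_ideal"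
      using min True unfolding minimal_complex_def by simp
    then show ?thesis
      using True assms(1) by (simp add: dmap_def mat_app_unit_vec irrelevant_ideal_eq)
  next
    case False
    then show ?thesis
      using assms(2)[of i] by (simp add: graded_matrix_def)
  qed
  then show "\<forall>i. const_mat (dmat F i) = 0"
    by (simp add: const_mat_def fun_eq_iff)
next
  assume zero: "\<forall>i. const_mat (dmat F i) = 0"
  have "lookup (dmap F i v p) 0 = 0" for i v p
    using fun_cong[OF const_part_dmap[of F i v], of p] zero
    by (simp add: const_part_def tensor_dmap_def mat_app_def)
  then show "minimal_complex F"
    by (simp add: minimal_complex_def irrelevant_ideal_eq)
qed

lemma minimal_resolution_iff:
  "minimal_resolution deg L F \<longleftrightarrow> graded_resolution deg L F \<and> (\<forall>i. const_mat (dmat F i) = 0)"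
proof (cases "graded_resolution deg L F")
  case True
  then show ?thesis
    using minimal_complex_iff[OF graded_resolution_finite[OF True] graded_resolution_dmat[OF True]]
    by (simp add: minimal_resolution_def)
qed (simp add: minimal_resolution_def)

lemma minimal_resolution_graded: "minimal_resolution deg L F \<Longrightarrow> graded_resolution deg L F"
  by (simp add: minimal_resolution_def)

lemma minimal_tensor_dmap: "minimal_resolution deg L F \<Longrightarrow> tensor_dmap F i v = 0"
  by (simp add: minimal_resolution_iff tensor_dmap_def mat_app_def fun_eq_iff)

lemma minimal_tensor_cycles: "minimal_resolution deg L F \<Longrightarrow> tensor_cycles F i j = tensor_part F i j"
  by (cases i) (auto simp: tensor_cycles_0 tensor_cycles_Suc minimal_tensor_dmap)

lemma minimal_tensor_boundaries: "minimal_resolution deg L F \<Longrightarrow> tensor_boundaries F i j = {0}"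
  using tensor_part_zero[of F "Suc i" j] unfolding tensor_boundaries_def
  by (auto simp: minimal_tensor_dmap simp del: tensor_part_zero)

section \<open>Betti numbers from arbitrary resolutions and the numerical test for
  minimality\<close>

abbreviation tensor_dim :: "('b, 'd, ('n, 'k::field) mpoly, 'm) aug_complex \<Rightarrow> nat \<Rightarrow> 'd \<Rightarrow> nat" where
  "tensor_dim F i j \<equiv> quotient_dim (tensor_cycles F i j) (tensor_boundaries F i j)"

abbreviation gens_deg :: "('b, 'd, 'r, 'm) aug_complex \<Rightarrow> nat \<Rightarrow> 'd \<Rightarrow> 'b set" where
  "gens_deg F i j \<equiv> {b \<in> gens F i. gdeg F i b = j}"

lemma subspace_tensor_cycles: "fun_space.subspace (tensor_cycles F i j)"
  by (rule fun_space.subspaceI) (auto simp: tensor_cycles_add tensor_cycles_scale)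

lemma subspace_tensor_boundaries: "fun_space.subspace (tensor_boundaries F i j)"
  by (rule fun_space.subspaceI) (auto simp: tensor_boundaries_add tensor_boundaries_scale)

lemma tensor_cycles_subset_span:
  assumes "finite (gens F i)"
  shows "tensor_cycles F i j \<subseteq> fun_space.span (unit_vec ` gens_deg F i j)"
  using free_module_subset_span[of "gens_deg F i j"] assms tensor_cycles_part
  unfolding tensor_part_def by fastforce

context grading
begin

text \<open>The comparison map is injective on homology, and each homology group is
  finite-dimensional because the bases are finite.\<close>

lemma tensor_dim_unique_le:
  fixes F :: "('b, 'd, ('n, 'k::field) mpoly, ('n, 'k) mpoly) aug_complex"
    and G :: "('c, 'd, ('n, 'k) mpoly, ('n, 'k) mpoly) aug_complex"
  assumes F: "graded_resolution deg L F" and G: "graded_resolution deg L G"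
  shows "tensor_dim F i j \<le> tensor_dim G i j"
proof -
  obtain \<alpha> where \<alpha>: "chain_lift deg F G 1 \<alpha>"
    "\<And>i j v. v \<in> tensor_cycles F i j \<Longrightarrow> tensor_map F \<alpha> i v \<in> tensor_boundaries G i j
       \<Longrightarrow> v \<in> tensor_boundaries F i j"
    using tensor_comparison[OF F G] by metis
  note finF = graded_resolution_finite[OF F, of i] and finG = graded_resolution_finite[OF G, of i]
  show ?thesis
  proof (rule quotient_dim_le[where f = "tensor_map F \<alpha> i"])
    show "tensor_cycles F i j \<subseteq> fun_space.span (unit_vec ` gens_deg F i j)"
      by (rule tensor_cycles_subset_span[OF finF])
    show "tensor_cycles G i j \<subseteq> fun_space.span (unit_vec ` gens_deg G i j)"
      by (rule tensor_cycles_subset_span[OF finG])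
    show "tensor_map F \<alpha> i v \<in> tensor_cycles G i j" if "v \<in> tensor_cycles F i j" for v
      by (rule tensor_map_cycles[OF \<alpha>(1) that])
    show "v \<in> tensor_boundaries F i j"
      if "v \<in> tensor_cycles F i j" "tensor_map F \<alpha> i v \<in> tensor_boundaries G i j" for v
      by (rule \<alpha>(2)[OF that])
    show "finite (unit_vec ` gens_deg F i j :: ('b \<Rightarrow> 'k) set)" "finite (unit_vec ` gens_deg G i j :: ('c \<Rightarrow> 'k) set)"
      using finF finG by simp_all
  qed (simp_all only: subspace_tensor_cycles subspace_tensor_boundaries
      tensor_boundaries_cycles[OF F] tensor_boundaries_cycles[OF G] mat_app_add mat_app_scale)
qed

lemma tensor_dim_unique:
  fixes F :: "('b, 'd, ('n, 'k::field) mpoly, ('n, 'k) mpoly) aug_complex"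
    and G :: "('c, 'd, ('n, 'k) mpoly, ('n, 'k) mpoly) aug_complex"
  assumes "graded_resolution deg L F" "graded_resolution deg L G"
  shows "tensor_dim F i j = tensor_dim G i j"
  using assms by (intro order_antisym tensor_dim_unique_le)

lemma minimal_tensor_dim:
  fixes F :: "('b, 'd, ('n, 'k::field) mpoly, ('n, 'k) mpoly) aug_complex"
  assumes "minimal_resolution deg L F"
  shows "tensor_dim F i j = card (gens_deg F i j)"
proof -
  have "finite (gens_deg F i j)"
    using graded_resolution_finite[OF minimal_resolution_graded[OF assms], of i] by simp
  then show ?thesis
    using quotient_dim_free_module
    by (simp add: minimal_tensor_cycles[OF assms] minimal_tensor_boundaries[OF assms] tensor_part_def)
qed

text \<open>The cycles sit inside the space on the generators of degree \<open>j\<close>. If the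
  homology has that full dimension, all boundaries are zero, and the boundaries of unit vectors are
  the columns of constant terms of the differential.\<close>

lemma minimal_if_tensor_dim:
  fixes F :: "('b, 'd, ('n, 'k::field) mpoly, ('n, 'k) mpoly) aug_complex"
  assumes F: "graded_resolution deg L F" and dim: "\<And>i j. tensor_dim F i j = card (gens_deg F i j)"
  shows "minimal_resolution deg L F"
proof -
  have zero: "tensor_boundaries F i j = {0}" for i j
  proof (rule quotient_dim_full)
    show "finite (gens_deg F i j)"
      using graded_resolution_finite[OF F, of i] by simp
    show "tensor_cycles F i j \<subseteq> free_module (gens_deg F i j)"
      using tensor_cycles_part by (fastforce simp: tensor_part_def)
  qed (rule subspace_tensor_cycles subspace_tensor_boundaries tensor_boundaries_cycles[OF F] dim)+
  have "const_mat (dmat F i) p q = 0" for i p q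
  proof (cases "q \<in> gens F (Suc i)")
    case True
    have "(unit_vec q :: 'b \<Rightarrow> 'k) \<in> tensor_part F (Suc i) (gdeg F (Suc i) q)"
      using True by (simp add: tensor_part_def)
    then have "tensor_dmap F i (unit_vec q) \<in> tensor_boundaries F i (gdeg F (Suc i) q)"
      unfolding tensor_boundaries_def by (rule imageI)
    then have "tensor_dmap F i (unit_vec q) p = 0"
      using zero by (simp add: fun_eq_iff)
    then show ?thesis
      using True by (simp add: tensor_dmap_def mat_app_unit_vec graded_resolution_finite[OF F])
  next
    case False
    then show ?thesis
      using graded_resolution_dmat[OF F, of i] by (simp add: graded_matrix_def const_mat_def)
  qed
  then show ?thesis
    using F by (simp add: minimal_resolution_iff fun_eq_iff)
qed

text \<open>Over minimal resolutions every vector is a cycle and only zero is a boundary, so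
  vanishing on homology is vanishing of the reduced matrices, column by column.\<close>

lemma tor_zero_map_minimal:
  fixes F :: "('b, 'd, ('n, 'k::field) mpoly, ('n, 'k) mpoly) aug_complex"
    and G :: "('c, 'd, ('n, 'k) mpoly, ('n, 'k) mpoly) aug_complex"
  assumes F: "minimal_resolution deg L F" and G: "minimal_resolution deg L' G"
    and \<Phi>: "chain_lift deg F G c \<Phi>"
  shows "tor_zero_map F G \<Phi> \<longleftrightarrow> (\<forall>i. const_mat (\<Phi> i) = 0)"
proof
  assume zero: "tor_zero_map F G \<Phi>"
  have "const_mat (\<Phi> i) p q = 0" for i p q
  proof (cases "q \<in> gens F i")
    case True
    then have "unit_vec q \<in> tensor_cycles F i (gdeg F i q)"
      by (simp add: minimal_tensor_cycles[OF F] tensor_part_def)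
    then have "tensor_map F \<Phi> i (unit_vec q) = 0"
      using zero by (simp add: tor_zero_map_def minimal_tensor_boundaries[OF G])
    moreover have "finite (gens F i)"
      by (rule graded_resolution_finite[OF minimal_resolution_graded[OF F]])
    ultimately show ?thesis
      using True by (simp add: mat_app_unit_vec fun_eq_iff)
  next
    case False
    then show ?thesis
      using chain_lift_graded[OF \<Phi>, of i] by (simp add: graded_matrix_def const_mat_def)
  qed
  then show "\<forall>i. const_mat (\<Phi> i) = 0"
    by (simp add: fun_eq_iff)
next
  assume zero: "\<forall>i. const_mat (\<Phi> i) = 0"
  then have "tensor_map F \<Phi> i v = 0" for i v
    by (simp add: mat_app_def fun_eq_iff)
  then show "tor_zero_map F G \<Phi>"
    by (simp add: tor_zero_map_def)
qed

end

section \<open>The mapping cone\<close>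

lemma free_module_Plus:
  "v \<in> free_module (A <+> B) \<longleftrightarrow> v \<circ> Inl \<in> free_module A \<and> v \<circ> Inr \<in> free_module B"
proof
  assume R: "v \<circ> Inl \<in> free_module A \<and> v \<circ> Inr \<in> free_module B"
  have "v b = 0" if "b \<notin> A <+> B" for b
    using R that by (cases b) (auto simp: free_module_def)
  then show "v \<in> free_module (A <+> B)"
    by (simp add: free_module_def)
qed (auto simp: free_module_def)

lemma case_sum_comp_Inl_Inr [simp]: "case_sum (v \<circ> Inl) (v \<circ> Inr) = v"
  by (auto simp: fun_eq_iff split: sum.split)

lemma case_sum_comp [simp]: "case_sum u w \<circ> Inl = u" "case_sum u w \<circ> Inr = w"
  by (simp_all add: fun_eq_iff)

lemma sum_fun_eqI: "u \<circ> Inl = v \<circ> Inl \<Longrightarrow> u \<circ> Inr = v \<circ> Inr \<Longrightarrow> u = v"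
  by (metis case_sum_comp_Inl_Inr)

lemma comp_zero [simp]: "0 \<circ> h = 0"
  by (simp add: fun_eq_iff)

lemma eq_case_sum_iff: "u = case_sum v w \<longleftrightarrow> u \<circ> Inl = v \<and> u \<circ> Inr = w"
  by (auto intro: sum_fun_eqI)

lemma mat_app_Inl: "mat_app B A v \<circ> Inl = mat_app B (\<lambda>p. A (Inl p)) v"
  by (simp add: mat_app_def fun_eq_iff)

lemma mat_app_Inr: "mat_app B A v \<circ> Inr = mat_app B (\<lambda>p. A (Inr p)) v"
  by (simp add: mat_app_def fun_eq_iff)

lemma gens_dsum [simp]: "gens (dsum_complex G H) i = gens G i <+> gens H i"
  by (simp add: dsum_complex_def)

lemma dmap_dsum:
  assumes "finite (gens G (Suc i))" "finite (gens H (Suc i))"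
  shows "dmap (dsum_complex G H) i v = case_sum (dmap G i (v \<circ> Inl)) (dmap H i (v \<circ> Inr))"
proof
  show "dmap (dsum_complex G H) i v p = case_sum (dmap G i (v \<circ> Inl)) (dmap H i (v \<circ> Inr)) p" for p
    using assms by (cases p) (simp_all add: dmap_def mat_app_def sum.Plus dsum_complex_def)
qed

lemma aug_map_dsum:
  assumes "finite (gens G 0)" "finite (gens H 0)"
  shows "aug_map pair_scale (dsum_complex G H) v = (aug_map (*) G (v \<circ> Inl), aug_map (*) H (v \<circ> Inr))"
  using assms
  by (simp add: aug_map_def sum.Plus dsum_complex_def pair_scale_def prod_eq_iff fst_sum snd_sum)

lemma pair_aug_map_add: "aug_map pair_scale D (v + w) = aug_map pair_scale D v + aug_map pair_scale D w"
proof -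
  have "pair_scale (v b + w b) x = pair_scale (v b) x + pair_scale (w b) x" for b x
    by (cases x) (simp add: pair_scale_def distrib_right)
  then show ?thesis
    by (simp add: aug_map_def sum.distrib)
qed

lemma pair_aug_map_diff: "aug_map pair_scale D (v - w) = aug_map pair_scale D v - aug_map pair_scale D w"
  using pair_aug_map_add[of D "v - w" w] by simp

lemma ball_Plus: "(\<forall>p\<in>A <+> B. P p) \<longleftrightarrow> (\<forall>p\<in>A. P (Inl p)) \<and> (\<forall>p\<in>B. P (Inr p))"
  by auto

text \<open>The direct sum is augmented to pairs of polynomials, so \<open>graded_resolution\<close>
  does not speak about it. The corresponding properties are recorded one by one, with exactness in
  the form that the cone needs.\<close>

lemma graded_resolution_dsum:
  fixes G :: "('b, 'd::comm_monoid_add, ('n, 'k::field) mpoly, ('n, 'k) mpoly) aug_complex"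
    and H :: "('c, 'd, ('n, 'k) mpoly, ('n, 'k) mpoly) aug_complex"
  assumes G: "graded_resolution deg L G" and H: "graded_resolution deg L' H"
  shows "finite (gens (dsum_complex G H) i)"
    and "graded_matrix deg (gens (dsum_complex G H) (Suc i)) (gdeg (dsum_complex G H) (Suc i))
      (gens (dsum_complex G H) i) (gdeg (dsum_complex G H) i) (dmat (dsum_complex G H) i)"
    and "aug_map pair_scale (dsum_complex G H) ` free_module (gens (dsum_complex G H) 0) = L \<times> L'"
    and "dmap (dsum_complex G H) i ` free_module (gens (dsum_complex G H) (Suc i)) =
      {v \<in> free_module (gens (dsum_complex G H) i). case i of
        0 \<Rightarrow> aug_map pair_scale (dsum_complex G H) v = 0 | Suc l \<Rightarrow> dmap (dsum_complex G H) l v = 0}"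
    and "b \<in> gens (dsum_complex G H) 0 \<Longrightarrow> m \<in> keys (ses_psi (aug (dsum_complex G H) b)) \<Longrightarrow>
      deg m = gdeg (dsum_complex G H) 0 b"
proof -
  note fin = graded_resolution_finite[OF G] graded_resolution_finite[OF H]
  show "finite (gens (dsum_complex G H) i)"
    by (simp add: fin)
  show "graded_matrix deg (gens (dsum_complex G H) (Suc i)) (gdeg (dsum_complex G H) (Suc i))
      (gens (dsum_complex G H) i) (gdeg (dsum_complex G H) i) (dmat (dsum_complex G H) i)"
    using graded_resolution_dmat[OF G, of i] graded_resolution_dmat[OF H, of i]
    unfolding graded_matrix_def dsum_complex_def
    by (auto split: sum.splits)
  have "aug_map pair_scale (dsum_complex G H) ` free_module (gens (dsum_complex G H) 0)
    = aug_map (*) G ` free_module (gens G 0) \<times> aug_map (*) H ` free_module (gens H 0)"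
  proof safe
    fix u :: "'b \<Rightarrow> ('n, 'k) mpoly" and w :: "'c \<Rightarrow> ('n, 'k) mpoly"
    assume "u \<in> free_module (gens G 0)" "w \<in> free_module (gens H 0)"
    then show "(aug_map (*) G u, aug_map (*) H w)
        \<in> aug_map pair_scale (dsum_complex G H) ` free_module (gens (dsum_complex G H) 0)"
      by (intro image_eqI[of _ _ "case_sum u w"]) (simp_all add: aug_map_dsum fin free_module_Plus)
  qed (auto simp: aug_map_dsum fin free_module_Plus)
  then show "aug_map pair_scale (dsum_complex G H) ` free_module (gens (dsum_complex G H) 0) = L \<times> L'"
    by (simp only: graded_resolution_aug[OF G] graded_resolution_aug[OF H])
  have cyc: "{v \<in> free_module (gens (dsum_complex G H) i). case i of
        0 \<Rightarrow> aug_map pair_scale (dsum_complex G H) v = 0 | Suc l \<Rightarrow> dmap (dsum_complex G H) l v = 0}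
      = {v. v \<circ> Inl \<in> res_cycles G i \<and> v \<circ> Inr \<in> res_cycles H i}"
  proof (cases i)
    case 0
    then show ?thesis
      by (auto simp: aug_map_dsum fin free_module_Plus res_cycles_def zero_prod_def)
  next
    case (Suc l)
    have "case_sum u w = 0 \<longleftrightarrow> u = 0 \<and> w = 0" for u :: "'b \<Rightarrow> ('n, 'k) mpoly" and w :: "'c \<Rightarrow> ('n, 'k) mpoly"
      by (metis case_sum_comp comp_zero sum_fun_eqI)
    then show ?thesis
      using Suc by (auto simp: dmap_dsum fin free_module_Plus res_cycles_Suc)
  qed
  show "dmap (dsum_complex G H) i ` free_module (gens (dsum_complex G H) (Suc i)) =
      {v \<in> free_module (gens (dsum_complex G H) i). case i of
        0 \<Rightarrow> aug_map pair_scale (dsum_complex G H) v = 0 | Suc l \<Rightarrow> dmap (dsum_complex G H) l v = 0}"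
    unfolding cyc
  proof safe
    fix v :: "'b + 'c \<Rightarrow> ('n, 'k) mpoly" assume "v \<in> free_module (gens (dsum_complex G H) (Suc i))"
    then show "dmap (dsum_complex G H) i v \<circ> Inl \<in> res_cycles G i"
      "dmap (dsum_complex G H) i v \<circ> Inr \<in> res_cycles H i"
      using dmap_res_cycles[OF G] dmap_res_cycles[OF H] by (simp_all add: dmap_dsum fin free_module_Plus)
  next
    fix v assume "v \<circ> Inl \<in> res_cycles G i" "v \<circ> Inr \<in> res_cycles H i"
    then obtain u w where "u \<in> free_module (gens G (Suc i))" "v \<circ> Inl = dmap G i u"
      "w \<in> free_module (gens H (Suc i))" "v \<circ> Inr = dmap H i w"
      unfolding graded_resolution_exact[OF G, symmetric] graded_resolution_exact[OF H, symmetric] by blast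
    then show "v \<in> dmap (dsum_complex G H) i ` free_module (gens (dsum_complex G H) (Suc i))"
      by (intro image_eqI[of _ _ "case_sum u w"] sum_fun_eqI) (simp_all add: dmap_dsum fin free_module_Plus)
  qed
  show "b \<in> gens (dsum_complex G H) 0 \<Longrightarrow> m \<in> keys (ses_psi (aug (dsum_complex G H) b)) \<Longrightarrow>
      deg m = gdeg (dsum_complex G H) 0 b"
    using G H by (auto simp: graded_resolution_def dsum_complex_def ses_psi_def)
qed

text \<open>A lift into the direct sum is a pair of lifts, one for each block of rows. Since
  \<open>\<phi>\<close> sends \<open>f\<close> to \<open>(f, - f)\<close>, they lift multiplication
  by 1 and by -1.\<close>

lemma phi_lift_dsum_iff:
  assumes F: "\<And>i. finite (gens F i)" and G: "\<And>i. finite (gens G i)" and H: "\<And>i. finite (gens H i)"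
  shows "phi_lift deg F (dsum_complex G H) \<Phi> \<longleftrightarrow>
    chain_lift deg F G 1 (\<lambda>i p. \<Phi> i (Inl p)) \<and> chain_lift deg F H (- 1) (\<lambda>i p. \<Phi> i (Inr p))"
proof -
  have "graded_matrix deg (gens F i) (gdeg F i) (gens (dsum_complex G H) i) (gdeg (dsum_complex G H) i) (\<Phi> i)
    \<longleftrightarrow> graded_matrix deg (gens F i) (gdeg F i) (gens G i) (gdeg G i) (\<lambda>p. \<Phi> i (Inl p))
      \<and> graded_matrix deg (gens F i) (gdeg F i) (gens H i) (gdeg H i) (\<lambda>p. \<Phi> i (Inr p))" for i
    unfolding graded_matrix_def by (simp add: dsum_complex_def split_sum_all ball_Plus) blast
  moreover have "mat_app (gens F i) (\<Phi> i) (dmap F i v)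
      = dmap (dsum_complex G H) i (mat_app (gens F (Suc i)) (\<Phi> (Suc i)) v)
    \<longleftrightarrow> mat_app (gens F i) (\<lambda>p. \<Phi> i (Inl p)) (dmap F i v)
        = dmap G i (mat_app (gens F (Suc i)) (\<lambda>p. \<Phi> (Suc i) (Inl p)) v)
      \<and> mat_app (gens F i) (\<lambda>p. \<Phi> i (Inr p)) (dmap F i v)
        = dmap H i (mat_app (gens F (Suc i)) (\<lambda>p. \<Phi> (Suc i) (Inr p)) v)" for i v
    unfolding dmap_dsum[OF G H] eq_case_sum_iff mat_app_Inl mat_app_Inr ..
  moreover have "aug_map pair_scale (dsum_complex G H) (mat_app (gens F 0) (\<Phi> 0) v) = ses_phi (aug_map (*) F v)
    \<longleftrightarrow> aug_map (*) G (mat_app (gens F 0) (\<lambda>p. \<Phi> 0 (Inl p)) v) = 1 * aug_map (*) F v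
      \<and> aug_map (*) H (mat_app (gens F 0) (\<lambda>p. \<Phi> 0 (Inr p)) v) = - 1 * aug_map (*) F v" for v
    unfolding aug_map_dsum[OF G H] mat_app_Inl mat_app_Inr by (simp add: ses_phi_def)
  ultimately show ?thesis
    unfolding phi_lift_def chain_lift_def by blast
qed

section \<open>Exactness and generators of the mapping cone\<close>

lemma gens_cone [simp]:
  "gens (mapping_cone F D \<Phi>) 0 = gens D 0 <+> {}"
  "gens (mapping_cone F D \<Phi>) (Suc i) = gens D (Suc i) <+> gens F i"
  by (simp_all add: mapping_cone_def)

lemma dmap_cone:
  assumes "finite (gens D (Suc i))" "finite (gens F i)"
  shows "dmap (mapping_cone F D \<Phi>) i v \<circ> Inl = dmap D i (v \<circ> Inl) + mat_app (gens F i) (\<Phi> i) (v \<circ> Inr)"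
    and "dmap (mapping_cone F D \<Phi>) i v \<circ> Inr = (case i of 0 \<Rightarrow> 0 | Suc l \<Rightarrow> - dmap F l (v \<circ> Inr))"
  using assms
  by (auto simp: fun_eq_iff dmap_def mat_app_def sum.Plus mapping_cone_def sum_negf split: nat.split)

lemma aug_map_cone:
  fixes D :: "('c, 'd, 'r::comm_ring_1, 'r \<times> 'r) aug_complex"
  assumes "finite (gens D 0)"
  shows "aug_map (*) (mapping_cone F D \<Phi>) v = ses_psi (aug_map pair_scale D (v \<circ> Inl))"
proof -
  have psi_sum: "ses_psi (\<Sum>b\<in>B. f b) = (\<Sum>b\<in>B. ses_psi (f b))" for B and f :: "'x \<Rightarrow> 'r \<times> 'r"
    by (simp add: ses_psi_def case_prod_beta fst_sum snd_sum sum.distrib)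
  have "r * ses_psi x = ses_psi (pair_scale r x)" for r :: 'r and x
    by (simp add: ses_psi_def pair_scale_def case_prod_beta distrib_left)
  then show ?thesis
    using assms by (simp add: aug_map_def sum.Plus psi_sum) (simp add: mapping_cone_def)
qed

text \<open>Exactness is checked on elements: the \<open>F\<close> component of a cycle is removed
  using exactness of \<open>F\<close>, and what remains in the direct sum is a cycle there, hence a
  boundary. At the bottom, exactness of the sequence relating \<open>J \<inter> K\<close>,
  \<open>J\<close>, \<open>K\<close> and their sum provides the correcting element of
  \<open>F\<close>.\<close>

lemma graded_resolution_cone:
  fixes F :: "('b, 'd::comm_monoid_add, ('n, 'k::field) mpoly, ('n, 'k) mpoly) aug_complex"
    and G :: "('c, 'd, ('n, 'k) mpoly, ('n, 'k) mpoly) aug_complex"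
    and H :: "('e, 'd, ('n, 'k) mpoly, ('n, 'k) mpoly) aug_complex"
  assumes F: "graded_resolution deg (J \<inter> K) F" and G: "graded_resolution deg J G"
    and H: "graded_resolution deg K H" and \<Phi>: "phi_lift deg F (dsum_complex G H) \<Phi>"
  shows "graded_resolution deg (J + K) (mapping_cone F (dsum_complex G H) \<Phi>)"
proof -
  define D where "D = dsum_complex G H"
  define C where "C = mapping_cone F D \<Phi>"
  note D = graded_resolution_dsum[OF G H, folded D_def]
  note finF = graded_resolution_finite[OF F]
  have \<Phi>_graded: "graded_matrix deg (gens F i) (gdeg F i) (gens D i) (gdeg D i) (\<Phi> i)" for i
    using \<Phi> by (simp add: phi_lift_def D_def)
  have \<Phi>_free: "mat_app (gens F i) (\<Phi> i) v \<in> free_module (gens D i)" for i v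
    by (rule graded_matrix_mat_app[OF \<Phi>_graded])
  have \<Phi>_commute: "mat_app (gens F i) (\<Phi> i) (dmap F i v) = dmap D i (mat_app (gens F (Suc i)) (\<Phi> (Suc i)) v)"
    if "v \<in> free_module (gens F (Suc i))" for i v
    using \<Phi> that by (simp add: phi_lift_def D_def)
  have \<Phi>_aug: "aug_map pair_scale D (mat_app (gens F 0) (\<Phi> 0) v) = ses_phi (aug_map (*) F v)"
    if "v \<in> free_module (gens F 0)" for v
    using \<Phi> that by (simp add: phi_lift_def D_def)
  have D_free: "dmap D i v \<in> free_module (gens D i)" for i v
    unfolding dmap_def by (rule graded_matrix_mat_app[OF D(2)])
  have F_free: "dmap F i v \<in> free_module (gens F i)" for i v
    unfolding dmap_def by (rule graded_matrix_mat_app[OF graded_resolution_dmat[OF F]])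
  have D_aug0: "aug_map pair_scale D (dmap D 0 v) = 0" if "v \<in> free_module (gens D 1)" for v
    using D(4)[of 0] that by auto
  have D_dd: "dmap D i (dmap D (Suc i) v) = 0" if "v \<in> free_module (gens D (Suc (Suc i)))" for i v
    using D(4)[of "Suc i"] that by auto
  note C_simps = dmap_cone[of D _ F \<Phi>, folded C_def, OF D(1) finF]
  note aug_C = aug_map_cone[of D F \<Phi>, folded C_def, OF D(1)]
  have gens_C: "gens C 0 = gens D 0 <+> {}" "gens C (Suc i) = gens D (Suc i) <+> gens F i" for i
    by (simp_all add: C_def)
  have empty: "free_module {} = {0 :: 'b \<Rightarrow> ('n, 'k) mpoly}"
    by (auto simp: free_module_def fun_eq_iff)
  \<comment> \<open>The access to \<open>K\<close> here is as the image of the augmentation of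
    \<open>H\<close>, which is closed under negation.\<close>
  have K_uminus: "- f \<in> K" if f: "f \<in> K" for f
  proof -
    obtain v where v: "v \<in> free_module (gens H 0)" "f = aug_map (*) H v"
      using f unfolding graded_resolution_aug[OF H, symmetric] by (elim imageE)
    have "- f = aug_map (*) H (- v)"
      by (simp only: v(2) aug_map_uminus)
    then show ?thesis
      unfolding graded_resolution_aug[OF H, symmetric] using free_module_uminus[OF v(1)] by (rule image_eqI)
  qed
  have C_free: "dmap C i v \<in> free_module (gens C i)" for i v
    using D_free \<Phi>_free F_free
    by (cases i) (auto simp: gens_C free_module_Plus C_simps empty)
  have aug_dmap: "aug_map (*) C (dmap C 0 v) = 0" if "v \<in> free_module (gens C 1)" for v
  proof -
    have v: "v \<circ> Inl \<in> free_module (gens D 1)" "v \<circ> Inr \<in> free_module (gens F 0)"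
      using that by (simp_all add: gens_C free_module_Plus)
    have "aug_map pair_scale D (dmap C 0 v \<circ> Inl) = ses_phi (aug_map (*) F (v \<circ> Inr))"
      unfolding C_simps pair_aug_map_add by (simp add: D_aug0[OF v(1)] \<Phi>_aug[OF v(2)])
    then show ?thesis
      by (simp add: aug_C ses_psi_def ses_phi_def)
  qed
  have exact0: "v \<in> dmap C 0 ` free_module (gens C 1)"
    if v: "v \<in> free_module (gens C 0)" and aug0: "aug_map (*) C v = 0" for v
  proof -
    have vl: "v \<circ> Inl \<in> free_module (gens D 0)" and vr: "v \<circ> Inr = 0"
      using v by (simp_all add: gens_C free_module_Plus empty)
    obtain a b where ab: "aug_map pair_scale D (v \<circ> Inl) = (a, b)" "a \<in> J" "b \<in> K"
      using imageI[OF vl, of "aug_map pair_scale D"] unfolding D(3) by (elim SigmaE) auto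
    \<comment> \<open>An element of the kernel of \<open>\<psi>\<close> has the form
      \<open>(a, - a)\<close>. Since \<open>b\<close> lies in \<open>K\<close>, so does
      \<open>a\<close>, and the pair comes from \<open>J \<inter> K\<close>.\<close>
    then have "b = - a"
      using aug0 by (simp add: aug_C ses_psi_def add_eq_0_iff)
    then have "a \<in> J \<inter> K"
      using ab K_uminus by force
    then obtain f where f: "f \<in> free_module (gens F 0)" "aug_map (*) F f = a"
      unfolding graded_resolution_aug[OF F, symmetric] by (elim imageE) simp
    have "aug_map pair_scale D ((v \<circ> Inl) - mat_app (gens F 0) (\<Phi> 0) f) = 0"
      unfolding pair_aug_map_diff \<Phi>_aug[OF f(1)] by (simp add: ab(1) \<open>b = - a\<close> f(2) ses_phi_def zero_prod_def)
    then have "(v \<circ> Inl) - mat_app (gens F 0) (\<Phi> 0) f \<in> dmap D 0 ` free_module (gens D (Suc 0))"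
      unfolding D(4) using vl \<Phi>_free by auto
    then obtain e where e: "e \<in> free_module (gens D (Suc 0))"
      "(v \<circ> Inl) - mat_app (gens F 0) (\<Phi> 0) f = dmap D 0 e"
      by blast
    have "v = dmap C 0 (case_sum e f)"
    proof (rule sum_fun_eqI)
      show "v \<circ> Inl = dmap C 0 (case_sum e f) \<circ> Inl"
        unfolding C_simps case_sum_comp e(2)[symmetric] by simp
      show "v \<circ> Inr = dmap C 0 (case_sum e f) \<circ> Inr"
        unfolding C_simps vr by simp
    qed
    then show ?thesis
      using e(1) f(1) by (simp add: gens_C free_module_Plus)
  qed
  have dmap_dmap: "dmap C i (dmap C (Suc i) v) = 0" if "v \<in> free_module (gens C (Suc (Suc i)))" for i v
  proof -
    have v: "v \<circ> Inl \<in> free_module (gens D (Suc (Suc i)))" "v \<circ> Inr \<in> free_module (gens F (Suc i))"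
      using that by (simp_all add: gens_C free_module_Plus)
    have d: "dmap C (Suc i) v \<circ> Inl = dmap D (Suc i) (v \<circ> Inl) + mat_app (gens F (Suc i)) (\<Phi> (Suc i)) (v \<circ> Inr)"
      "dmap C (Suc i) v \<circ> Inr = - dmap F i (v \<circ> Inr)"
      by (simp_all add: C_simps)
    show ?thesis
    proof (rule sum_fun_eqI)
      have "dmap C i (dmap C (Suc i) v) \<circ> Inl
          = dmap D i (dmap D (Suc i) (v \<circ> Inl)) + dmap D i (mat_app (gens F (Suc i)) (\<Phi> (Suc i)) (v \<circ> Inr))
            - mat_app (gens F i) (\<Phi> i) (dmap F i (v \<circ> Inr))"
        unfolding C_simps(1) d by (simp only: dmap_def mat_app_add mat_app_uminus diff_conv_add_uminus)
      then show "dmap C i (dmap C (Suc i) v) \<circ> Inl = 0 \<circ> Inl"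
        unfolding D_dd[OF v(1)] \<Phi>_commute[OF v(2)] by simp
      have "dmap F l (dmap F (Suc l) (v \<circ> Inr)) = 0" if "i = Suc l" for l
        using dmap_res_cycles[OF F v(2)] that by (simp add: res_cycles_Suc)
      then show "dmap C i (dmap C (Suc i) v) \<circ> Inr = 0 \<circ> Inr"
        unfolding C_simps(2) d by (auto simp: dmap_def mat_app_uminus split: nat.split)
    qed
  qed
  have exact: "v \<in> dmap C (Suc i) ` free_module (gens C (Suc (Suc i)))"
    if v: "v \<in> free_module (gens C (Suc i))" and d0: "dmap C i v = 0" for i v
  proof -
    have vl: "v \<circ> Inl \<in> free_module (gens D (Suc i))" and vr: "v \<circ> Inr \<in> free_module (gens F i)"
      using v by (simp_all add: gens_C free_module_Plus)
    have dl: "dmap D i (v \<circ> Inl) + mat_app (gens F i) (\<Phi> i) (v \<circ> Inr) = 0"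
      using C_simps(1)[of i v] d0 by simp
    have "v \<circ> Inr \<in> res_cycles F i"
    proof (cases i)
      case 0
      \<comment> \<open>At the bottom the cycle condition is read through the injectivity of
        \<open>\<phi>\<close>: the augmentation of the direct sum kills the boundary and turns the
        lift into \<open>\<phi>\<close> of the augmentation of \<open>F\<close>.\<close>
      have "ses_phi (aug_map (*) F (v \<circ> Inr))
          = aug_map pair_scale D (dmap D 0 (v \<circ> Inl) + mat_app (gens F 0) (\<Phi> 0) (v \<circ> Inr))"
        using D_aug0[of "v \<circ> Inl"] \<Phi>_aug[of "v \<circ> Inr"] vl vr 0 by (simp add: pair_aug_map_add)
      also have "\<dots> = 0"
        using dl 0 by (simp add: aug_map_def pair_scale_def case_prod_beta zero_prod_def[symmetric])
      finally show ?thesis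
        using vr 0 by (simp add: res_cycles_def ses_phi_def zero_prod_def)
    next
      case (Suc l)
      have "- dmap F l (v \<circ> Inr) = 0"
        using C_simps(2)[of i v] d0 Suc by simp
      then show ?thesis
        using vr Suc by (simp only: res_cycles_Suc neg_equal_0_iff_equal simp_thms)
    qed
    then obtain w where w: "w \<in> free_module (gens F (Suc i))" "v \<circ> Inr = dmap F i w"
      unfolding graded_resolution_exact[OF F, symmetric] by blast
    \<comment> \<open>The correction uses \<open>- w\<close> because the cone differential acts on
      the \<open>F\<close> summand by the negative of the differential of \<open>F\<close>.\<close>
    have "dmap D i ((v \<circ> Inl) - mat_app (gens F (Suc i)) (\<Phi> (Suc i)) (- w))
        = dmap D i (v \<circ> Inl) + dmap D i (mat_app (gens F (Suc i)) (\<Phi> (Suc i)) w)"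
      by (simp only: dmap_def mat_app_add mat_app_uminus diff_minus_eq_add)
    also have "\<dots> = 0"
      unfolding \<Phi>_commute[OF w(1), symmetric] w(2)[symmetric] by (rule dl)
    finally have "(v \<circ> Inl) - mat_app (gens F (Suc i)) (\<Phi> (Suc i)) (- w) \<in> dmap D (Suc i) ` free_module (gens D (Suc (Suc i)))"
      unfolding D(4) using vl \<Phi>_free by auto
    then obtain e where e: "e \<in> free_module (gens D (Suc (Suc i)))"
      "(v \<circ> Inl) - mat_app (gens F (Suc i)) (\<Phi> (Suc i)) (- w) = dmap D (Suc i) e"
      by blast
    have "v = dmap C (Suc i) (case_sum e (- w))"
    proof (rule sum_fun_eqI)
      show "v \<circ> Inl = dmap C (Suc i) (case_sum e (- w)) \<circ> Inl"
        unfolding C_simps case_sum_comp e(2)[symmetric] by simp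
      show "v \<circ> Inr = dmap C (Suc i) (case_sum e (- w)) \<circ> Inr"
        unfolding C_simps case_sum_comp w(2) by (simp add: dmap_def mat_app_uminus)
    qed
    moreover have "case_sum e (- w) \<in> free_module (gens C (Suc (Suc i)))"
      using e(1) w(1) free_module_uminus by (simp add: gens_C free_module_Plus)
    ultimately show ?thesis by blast
  qed
  have "graded_resolution deg (J + K) C"
    unfolding graded_resolution_def
  proof (intro conjI allI)
    show "finite (gens C i)" for i
      by (cases i) (simp_all add: gens_C D(1) finF)
    show "graded_matrix deg (gens C (Suc i)) (gdeg C (Suc i)) (gens C i) (gdeg C i) (dmat C i)" for i
      using D(2)[of i] \<Phi>_graded[of i] graded_resolution_dmat[OF F, of "i - 1"]
      by (cases i) (auto simp: graded_matrix_def C_def mapping_cone_def split_sum_all)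
    show "\<forall>b\<in>gens C 0. \<forall>m\<in>keys (aug C b). deg m = gdeg C 0 b"
      using D(5) by (auto simp: gens_C) (auto simp: C_def mapping_cone_def)
    show "aug_map (*) C ` free_module (gens C 0) = J + K"
    proof -
      have "aug_map (*) C ` free_module (gens C 0) = (\<lambda>v. ses_psi (aug_map pair_scale D v)) ` free_module (gens D 0)"
      proof (intro equalityI image_subsetI)
        fix v :: "('c + 'e) + 'b \<Rightarrow> ('n, 'k) mpoly" assume "v \<in> free_module (gens C 0)"
        then show "aug_map (*) C v \<in> (\<lambda>v. ses_psi (aug_map pair_scale D v)) ` free_module (gens D 0)"
          by (simp add: aug_C gens_C free_module_Plus)
      next
        fix v :: "'c + 'e \<Rightarrow> ('n, 'k) mpoly" assume "v \<in> free_module (gens D 0)"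
        then show "ses_psi (aug_map pair_scale D v) \<in> aug_map (*) C ` free_module (gens C 0)"
          by (intro image_eqI[of _ _ "case_sum v 0"]) (simp_all add: aug_C gens_C free_module_Plus)
      qed
      also have "\<dots> = J + K"
        unfolding image_image[symmetric] D(3) by (auto simp: ses_psi_def set_plus_def image_iff)
      finally show ?thesis .
    qed
    show "dmap C 0 ` free_module (gens C 1) = {v \<in> free_module (gens C 0). aug_map (*) C v = 0}"
      using C_free aug_dmap exact0 by blast
    show "dmap C (Suc i) ` free_module (gens C (Suc (Suc i)))
        = {v \<in> free_module (gens C (Suc i)). \<forall>p. dmap C i v p = 0}" for i
    proof -
      have "(\<forall>p. dmap C i v p = 0) \<longleftrightarrow> dmap C i v = 0" for v
        by (simp add: fun_eq_iff)
      then show ?thesis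
        using C_free dmap_dmap exact by auto
    qed
  qed
  then show ?thesis
    by (simp add: C_def D_def)
qed

lemma card_gens_deg_cone:
  assumes "\<And>i. finite (gens F i)" "\<And>i. finite (gens G i)" "\<And>i. finite (gens H i)"
  shows "card (gens_deg (mapping_cone F (dsum_complex G H) \<Phi>) i j)
    = card (gens_deg G i j) + card (gens_deg H i j) + (case i of 0 \<Rightarrow> 0 | Suc l \<Rightarrow> card (gens_deg F l j))"
proof -
  have "gens_deg (mapping_cone F (dsum_complex G H) \<Phi>) i j
      = (gens_deg G i j <+> gens_deg H i j) <+> (case i of 0 \<Rightarrow> {} | Suc l \<Rightarrow> gens_deg F l j)"
    by (cases i) (auto simp: mapping_cone_def dsum_complex_def)
  then show ?thesis
    using assms by (cases i) (simp_all add: card_Plus)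
qed

lemma cone_minimal_iff:
  assumes "minimal_resolution deg (J \<inter> K) F" "minimal_resolution deg J G" "minimal_resolution deg K H"
    and "phi_lift deg F (dsum_complex G H) \<Phi>"
  shows "minimal_resolution deg (J + K) (mapping_cone F (dsum_complex G H) \<Phi>)
    \<longleftrightarrow> (\<forall>i. const_mat (\<lambda>p. \<Phi> i (Inl p)) = 0) \<and> (\<forall>i. const_mat (\<lambda>p. \<Phi> i (Inr p)) = 0)"
proof -
  let ?C = "mapping_cone F (dsum_complex G H) \<Phi>"
  have zero: "lookup (dmat F i p q) 0 = 0" "lookup (dmat G i p' q') 0 = 0" "lookup (dmat H i p'' q'') 0 = 0"
    for i p q p' q' p'' q''
    using assms(1-3) by (simp_all add: minimal_resolution_iff const_mat_def fun_eq_iff)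
  have "const_mat (dmat ?C i) = 0
      \<longleftrightarrow> const_mat (\<lambda>p. \<Phi> i (Inl p)) = 0 \<and> const_mat (\<lambda>p. \<Phi> i (Inr p)) = 0" for i
    by (cases i) (auto simp: const_mat_def fun_eq_iff mapping_cone_def dsum_complex_def split_sum_all zero)
  moreover have "graded_resolution deg (J + K) ?C"
    using assms by (intro graded_resolution_cone minimal_resolution_graded)
  ultimately show ?thesis
    by (auto simp: minimal_resolution_iff)
qed

section \<open>Existence of minimal resolutions\<close>

definition exp_le :: "('n \<Rightarrow>\<^sub>0 nat) \<Rightarrow> ('n \<Rightarrow>\<^sub>0 nat) \<Rightarrow> bool" where
  "exp_le a b \<longleftrightarrow> (\<forall>i. lookup a i \<le> lookup b i)"

lemma exp_le_refl [simp]: "exp_le a a"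
  by (simp add: exp_le_def)

lemma exp_le_trans: "exp_le a b \<Longrightarrow> exp_le b c \<Longrightarrow> exp_le a c"
  unfolding exp_le_def using le_trans by blast

lemma exp_le_add_diff: "exp_le a b \<Longrightarrow> a + (b - a) = b"
  by (rule poly_mapping_eqI) (simp add: exp_le_def lookup_add lookup_minus)

lemma exp_le_add: "exp_le a (a + b)" "exp_le b (a + b)"
  by (simp_all add: exp_le_def lookup_add)

lemma exp_eq_diff_iff: "exp_le a b \<Longrightarrow> m + a = b \<longleftrightarrow> m = b - a"
  by (metis add.commute add_diff_cancel_right' exp_le_add_diff)

text \<open>A monotone subsequence increases or decreases; a decreasing sequence of naturals is
  constant from its minimum on, so its tail will do.\<close>

lemma nat_increasing_subseq:
  fixes g :: "nat \<Rightarrow> nat"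
  shows "\<exists>r :: nat \<Rightarrow> nat. strict_mono r \<and> (\<forall>x y. x \<le> y \<longrightarrow> g (r x) \<le> g (r y))"
proof -
  obtain r :: "nat \<Rightarrow> nat" where r: "strict_mono r" "monoseq (\<lambda>n. g (r n))"
    using seq_monosub[of g] by (auto simp: comp_def)
  show ?thesis
  proof (cases "\<forall>x y. x \<le> y \<longrightarrow> g (r x) \<le> g (r y)")
    case False
    then have dec: "\<And>x y. x \<le> y \<Longrightarrow> g (r y) \<le> g (r x)"
      using r(2) unfolding monoseq_def by blast
    obtain N where N: "\<And>x. g (r N) \<le> g (r x)"
      using ex_has_least_nat[of "\<lambda>_. True" _ "\<lambda>x. g (r x)"] by auto
    have "g (r (x + N)) = g (r N)" for x
      using N dec[of N "x + N"] by (intro order_antisym) auto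
    moreover have "strict_mono (\<lambda>x. r (x + N))"
      using r(1) by (simp add: strict_mono_def)
    ultimately show ?thesis
      by (intro exI[of _ "\<lambda>x. r (x + N)"]) simp
  qed (use r in blast)
qed

text \<open>The coordinates are treated one after another; passing to a further subsequence keeps
  the coordinates already arranged.\<close>

lemma exp_increasing_subseq:
  fixes f :: "nat \<Rightarrow> 'n \<Rightarrow>\<^sub>0 nat"
  assumes "finite I"
  shows "\<exists>r :: nat \<Rightarrow> nat. strict_mono r \<and> (\<forall>i\<in>I. \<forall>x y. x \<le> y \<longrightarrow> lookup (f (r x)) i \<le> lookup (f (r y)) i)"
  using assms
proof (induction I rule: finite_induct)
  case empty
  show ?case by (auto intro: exI[of _ id] simp: strict_mono_def)
next
  case (insert i I)
  then obtain r :: "nat \<Rightarrow> nat" where r: "strict_mono r" "\<And>i x y. i \<in> I \<Longrightarrow> x \<le> y \<Longrightarrow> lookup (f (r x)) i \<le> lookup (f (r y)) i"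
    by blast
  obtain r' :: "nat \<Rightarrow> nat" where r': "strict_mono r'" "\<And>x y. x \<le> y \<Longrightarrow> lookup (f (r (r' x))) i \<le> lookup (f (r (r' y))) i"
    using nat_increasing_subseq[of "\<lambda>x. lookup (f (r x)) i"] by blast
  have "r' x \<le> r' y" if "x \<le> y" for x y
    using r'(1) that by (simp add: strict_mono_less_eq)
  then show ?case
    using r r' by (intro exI[of _ "\<lambda>x. r (r' x)"]) (auto simp: strict_mono_def)
qed

text \<open>Dickson's lemma in the form of a strict chain inside \<open>A\<close>. An injective
  enumeration is used as the starting sequence so that the members of the increasing subsequence are
  distinct.\<close>

lemma dickson_infinite_chain:
  fixes A :: "('n::finite \<Rightarrow>\<^sub>0 nat) set"
  assumes "infinite A"
  shows "\<exists>f :: nat \<Rightarrow> 'n \<Rightarrow>\<^sub>0 nat. (\<forall>x. f x \<in> A) \<and> (\<forall>x y. x < y \<longrightarrow> exp_le (f x) (f y) \<and> f x \<noteq> f y)"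
proof -
  obtain h :: "nat \<Rightarrow> 'n \<Rightarrow>\<^sub>0 nat" where h: "inj h" "range h \<subseteq> A"
    using infinite_countable_subset[OF assms] by blast
  obtain r :: "nat \<Rightarrow> nat" where r: "strict_mono r" "\<And>i x y. x \<le> y \<Longrightarrow> lookup (h (r x)) i \<le> lookup (h (r y)) i"
    using exp_increasing_subseq[of UNIV h] by auto
  show ?thesis
  proof (intro exI[of _ "\<lambda>x. h (r x)"] conjI allI impI)
    show "h (r x) \<in> A" for x
      using h(2) by blast
    fix x y :: nat assume less: "x < y"
    show "exp_le (h (r x)) (h (r y))" "h (r x) \<noteq> h (r y)"
      using r less injD[OF h(1), of "r x" "r y"] strict_monoD[OF r(1) less] by (auto simp: exp_le_def)
  qed
qed

lemma lookup_mult_single: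
  fixes f :: "('n, 'k::field) mpoly"
  shows "lookup (f * Poly_Mapping.single t c) m = (if exp_le t m then lookup f (m - t) * c else 0)"
proof -
  have "f * Poly_Mapping.single t c = (\<Sum>k\<in>keys f. Poly_Mapping.single (k + t) (lookup f k * c))"
    by (subst poly_mapping_sum_singles[of f]) (simp add: sum_distrib_right mult_single)
  then have eq: "lookup (f * Poly_Mapping.single t c) m = (\<Sum>k\<in>keys f. if k + t = m then lookup f k * c else 0)"
    by (simp add: lookup_sum lookup_single when_def)
  show ?thesis
  proof (cases "exp_le t m")
    case True
    then have "(\<Sum>k\<in>keys f. if k + t = m then lookup f k * c else 0)
        = (\<Sum>k\<in>keys f. if k = m - t then lookup f (m - t) * c else 0)"
      by (intro sum.cong) (auto simp: exp_eq_diff_iff)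
    then show ?thesis
      using True eq by (auto simp: in_keys_iff)
  next
    case False
    then have "k + t \<noteq> m" for k
      using exp_le_add by blast
    then show ?thesis
      using False eq by simp
  qed
qed

section \<open>Graded pieces of multigraded submodules\<close>

definition graded_submodule ::
  "('b \<Rightarrow> 'n \<Rightarrow>\<^sub>0 nat) \<Rightarrow> 'b set \<Rightarrow> ('b \<Rightarrow> ('n, 'k::field) mpoly) set \<Rightarrow> bool" where
  "graded_submodule dB B N \<longleftrightarrow> N \<subseteq> free_module B \<and> 0 \<in> N \<and>
     (\<forall>v\<in>N. \<forall>w\<in>N. v + w \<in> N) \<and> (\<forall>r. \<forall>v\<in>N. (\<lambda>b. r * v b) \<in> N) \<and>
     (\<forall>v\<in>N. \<forall>j. hom_comp multi_deg dB j v \<in> N)"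

text \<open>
  The vector \<open>c\<close> of coefficients stands for the homogeneous element of degree \<open>a\<close> whose entry
  at the basis element \<open>b\<close> is \<open>c b\<close> times the monomial of degree \<open>a - dB b\<close>.
\<close>

definition homog :: "('b \<Rightarrow> 'n \<Rightarrow>\<^sub>0 nat) \<Rightarrow> ('n \<Rightarrow>\<^sub>0 nat) \<Rightarrow> ('b \<Rightarrow> 'k) \<Rightarrow> 'b \<Rightarrow> ('n, 'k::field) mpoly" where
  "homog dB a c = (\<lambda>b. if exp_le (dB b) a then Poly_Mapping.single (a - dB b) (c b) else 0)"

text \<open>Inverse to \<open>homog\<close> on vectors supported where \<open>dB b\<close> divides
  \<open>a\<close>: in the multigrading a homogeneous element has at most one monomial at each basis
  element.\<close>

definition coeffs :: "('b \<Rightarrow> 'n \<Rightarrow>\<^sub>0 nat) \<Rightarrow> ('n \<Rightarrow>\<^sub>0 nat) \<Rightarrow> ('b \<Rightarrow> ('n, 'k::field) mpoly) \<Rightarrow> 'b \<Rightarrow> 'k" where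
  "coeffs dB a v = (\<lambda>b. if exp_le (dB b) a then lookup (v b) (a - dB b) else 0)"

lemma hom_comp_eq_homog: "hom_comp multi_deg dB a v = homog dB a (coeffs dB a v)"
proof
  fix b
  show "hom_comp multi_deg dB a v b = homog dB a (coeffs dB a v) b"
  proof (cases "exp_le (dB b) a")
    case True
    then show ?thesis
      by (intro poly_mapping_eqI)
        (auto simp: hom_comp_def homog_def coeffs_def lookup_restrict_keys lookup_single when_def
          multi_deg_def exp_eq_diff_iff)
  next
    case False
    then have "m + dB b \<noteq> a" for m
      using exp_le_add by blast
    then show ?thesis
      using False
      by (intro poly_mapping_eqI) (simp add: hom_comp_def homog_def lookup_restrict_keys multi_deg_def)
  qed
qed

lemma homog_add: "homog dB a (u + v) = homog dB a u + homog dB a v"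
  by (simp add: homog_def fun_eq_iff single_add)

lemma homog_zero [simp]: "homog dB a 0 = 0"
  by (simp add: homog_def fun_eq_iff)

lemma homog_scale: "homog dB a (\<lambda>b. k * c b) = (\<lambda>b. Poly_Mapping.single 0 k * homog dB a c b)"
  by (simp add: homog_def fun_eq_iff mult_single)

text \<open>Multiplication by a monomial does not change the coefficient vector. This makes elements
  of different degrees comparable inside one space of functions.\<close>

lemma homog_shift:
  assumes "exp_le a a'" "\<And>b. \<not> exp_le (dB b) a \<Longrightarrow> c b = 0"
  shows "homog dB a' c = (\<lambda>b. Poly_Mapping.single (a' - a) 1 * homog dB a c b)"
proof
  fix b
  show "homog dB a' c b = Poly_Mapping.single (a' - a) 1 * homog dB a c b"
  proof (cases "exp_le (dB b) a")
    case True
    then have "a' - a + (a - dB b) = a' - dB b" "exp_le (dB b) a'"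
      using assms(1) by (auto simp: exp_le_def poly_mapping_eq_iff fun_eq_iff lookup_add lookup_minus intro: le_trans)
    then show ?thesis
      using True by (simp add: homog_def mult_single)
  next
    case False
    then show ?thesis
      using assms(2) by (simp add: homog_def)
  qed
qed

lemma coeffs_add: "coeffs dB a (u + v) = coeffs dB a u + coeffs dB a v"
  by (simp add: coeffs_def fun_eq_iff lookup_add)

lemma coeffs_scale:
  fixes v :: "'b \<Rightarrow> ('n, 'k::field) mpoly"
  shows "coeffs dB a (\<lambda>b. Poly_Mapping.single 0 k * v b) = (\<lambda>b. k * coeffs dB a v b)"
proof -
  have "lookup (Poly_Mapping.single 0 k * f) m = k * lookup f m" for f :: "('n, 'k) mpoly" and m
    using lookup_mult_single[of f 0 k m] by (simp add: exp_le_def mult.commute)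
  then show ?thesis
    by (simp add: coeffs_def fun_eq_iff)
qed

lemma coeffs_homog: "(\<And>b. \<not> exp_le (dB b) a \<Longrightarrow> c b = 0) \<Longrightarrow> coeffs dB a (homog dB a c) = c"
  by (auto simp: coeffs_def homog_def fun_eq_iff)

text \<open>Only the coefficient of \<open>f\<close> at \<open>a - a'\<close> moves degree
  \<open>a'\<close> to degree \<open>a\<close>.\<close>

lemma coeffs_mult_homog:
  assumes c: "\<And>b. \<not> exp_le (dB b) a' \<Longrightarrow> c b = 0"
  shows "coeffs dB a (\<lambda>b. f * homog dB a' c b) = (\<lambda>b. (if exp_le a' a then lookup f (a - a') else 0) * c b)"
proof
  fix b
  show "coeffs dB a (\<lambda>b. f * homog dB a' c b) b = (if exp_le a' a then lookup f (a - a') else 0) * c b"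
  proof (cases "exp_le (dB b) a'")
    case True
    show ?thesis
    proof (cases "exp_le (dB b) a")
      case le: True
      have "exp_le (a' - dB b) (a - dB b) \<longleftrightarrow> exp_le a' a"
        using True le by (auto simp: exp_le_def lookup_minus le_diff_iff)
      moreover have "a - dB b - (a' - dB b) = a - a'"
        using True le by (intro poly_mapping_eqI) (auto simp: exp_le_def lookup_minus)
      ultimately show ?thesis
        using True le by (simp add: coeffs_def homog_def lookup_mult_single)
    next
      case False
      then have "\<not> exp_le a' a"
        using True exp_le_trans by blast
      then show ?thesis
        using False by (simp add: coeffs_def)
    qed
  next
    case False
    then show ?thesis
      using c by (simp add: coeffs_def homog_def)
  qed
qed

text \<open>As graded submodules contain the components of their elements, this is the space of
  coefficient vectors of their homogeneous elements of degree \<open>a\<close>.\<close>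

definition piece :: "('b \<Rightarrow> 'n \<Rightarrow>\<^sub>0 nat) \<Rightarrow> ('b \<Rightarrow> ('n, 'k::field) mpoly) set \<Rightarrow> ('n \<Rightarrow>\<^sub>0 nat) \<Rightarrow> ('b \<Rightarrow> 'k) set" where
  "piece dB N a = coeffs dB a ` N"

text \<open>For a graded submodule this is the degree \<open>a\<close> part of its product with the
  maximal ideal, in coefficient vectors. The quotient of \<open>piece\<close> by it counts the
  minimal generators of degree \<open>a\<close>.\<close>

definition lower_span :: "('b \<Rightarrow> 'n \<Rightarrow>\<^sub>0 nat) \<Rightarrow> ('b \<Rightarrow> ('n, 'k::field) mpoly) set \<Rightarrow> ('n \<Rightarrow>\<^sub>0 nat) \<Rightarrow> ('b \<Rightarrow> 'k) set" where
  "lower_span dB N a = fun_space.span (\<Union>a'\<in>{a'. exp_le a' a \<and> a' \<noteq> a}. piece dB N a')"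

lemma piece_support: "c \<in> piece dB N a \<Longrightarrow> \<not> exp_le (dB b) a \<Longrightarrow> c b = 0"
  by (auto simp: piece_def coeffs_def)

lemma piece_free: "graded_submodule dB B N \<Longrightarrow> piece dB N a \<subseteq> free_module B"
  by (fastforce simp: piece_def coeffs_def graded_submodule_def free_module_def)

lemma piece_homog:
  assumes "graded_submodule dB B N" "c \<in> piece dB N a"
  shows "homog dB a c \<in> N"
  using assms by (auto simp: piece_def graded_submodule_def hom_comp_eq_homog)

lemma subspace_piece:
  assumes N: "graded_submodule dB B N"
  shows "fun_space.subspace (piece dB N a)"
proof (rule fun_space.subspaceI)
  show "0 \<in> piece dB N a"
  proof -
    have "coeffs dB a 0 = 0" by (simp add: coeffs_def fun_eq_iff)
    then show ?thesis
      using N unfolding piece_def graded_submodule_def by (metis imageI)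
  qed
next
  fix u v assume "u \<in> piece dB N a" "v \<in> piece dB N a"
  then obtain u' v' where "u = coeffs dB a u'" "v = coeffs dB a v'" "u' \<in> N" "v' \<in> N"
    by (auto simp: piece_def)
  then show "u + v \<in> piece dB N a"
    using N unfolding piece_def graded_submodule_def by (metis coeffs_add imageI)
next
  fix k v assume "v \<in> piece dB N a"
  then obtain v' where "v = coeffs dB a v'" "v' \<in> N"
    by (auto simp: piece_def)
  then have "(\<lambda>b. k * v b) = coeffs dB a (\<lambda>b. Poly_Mapping.single 0 k * v' b)"
      "(\<lambda>b. Poly_Mapping.single 0 k * v' b) \<in> N"
    using N by (simp_all add: coeffs_scale graded_submodule_def)
  then show "(\<lambda>b. k * v b) \<in> piece dB N a"
    unfolding piece_def by (rule image_eqI)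
qed

lemma piece_mono:
  assumes N: "graded_submodule dB B N" and le: "exp_le a a'"
  shows "piece dB N a \<subseteq> piece dB N a'"
proof
  fix c assume c: "c \<in> piece dB N a"
  have "homog dB a' c = (\<lambda>b. Poly_Mapping.single (a' - a) 1 * homog dB a c b)"
    by (rule homog_shift[OF le piece_support[OF c]])
  then have "homog dB a' c \<in> N"
    using N piece_homog[OF N c] by (simp add: graded_submodule_def)
  moreover have "coeffs dB a' (homog dB a' c) = c"
    using piece_support[OF c] exp_le_trans[OF _ le] exp_le_trans le
    by (intro coeffs_homog) blast
  ultimately show "c \<in> piece dB N a'"
    unfolding piece_def by (metis imageI)
qed

lemma subspace_lower_span: "fun_space.subspace (lower_span dB N a)"
  unfolding lower_span_def by (rule fun_space.subspace_span)

lemma lower_span_subset: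
  assumes N: "graded_submodule dB B N"
  shows "lower_span dB N a \<subseteq> piece dB N a"
  unfolding lower_span_def
  by (rule fun_space.span_minimal[OF _ subspace_piece[OF N]]) (use piece_mono[OF N] in blast)

lemma piece_subset_lower_span:
  "exp_le a' a \<Longrightarrow> a' \<noteq> a \<Longrightarrow> piece dB N a' \<subseteq> lower_span dB N a"
  unfolding lower_span_def by (intro subset_trans[OF _ fun_space.span_superset]) blast

text \<open>
  Since the pieces increase with the degree inside a finite-dimensional space, Dickson's lemma
  leaves only finitely many degrees in which new generators are needed.
\<close>

lemma finite_new_degrees:
  fixes N :: "('b \<Rightarrow> ('n::finite, 'k::field) mpoly) set"
  assumes N: "graded_submodule dB B N" and B: "finite B"
  shows "finite {a. piece dB N a \<noteq> lower_span dB N a}"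
proof (rule ccontr)
  assume inf: "infinite {a. piece dB N a \<noteq> lower_span dB N a}"
  obtain f :: "nat \<Rightarrow> 'n \<Rightarrow>\<^sub>0 nat" where
    f: "\<And>x. f x \<in> {a. piece dB N a \<noteq> lower_span dB N a}" "\<And>x y. x < y \<Longrightarrow> exp_le (f x) (f y) \<and> f x \<noteq> f y"
    using dickson_infinite_chain[OF inf] by blast
  have "\<exists>w. w \<in> piece dB N (f x) \<and> w \<notin> lower_span dB N (f x)" for x
    using f(1)[of x] lower_span_subset[OF N] by blast
  then obtain w where w: "\<And>x. w x \<in> piece dB N (f x)" "\<And>x. w x \<notin> lower_span dB N (f x)"
    by metis
  \<comment> \<open>Along the chain the earlier vectors all lie in \<open>lower_span\<close> at the
    new degree while the new vector does not, so independence persists and the number of vectors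
    outgrows the dimension.\<close>
  have "fun_space.independent (w ` {..<k}) \<and> card (w ` {..<k}) = k" for k
  proof (induction k)
    case 0
    show ?case by (simp add: fun_space.independent_empty)
  next
    case (Suc k)
    have "w x \<in> lower_span dB N (f k)" if "x < k" for x
      using w(1)[of x] f(2)[OF that] piece_subset_lower_span[of "f x" "f k" dB N] by auto
    then have "fun_space.span (w ` {..<k}) \<subseteq> lower_span dB N (f k)"
      by (intro fun_space.span_minimal[OF _ subspace_lower_span]) auto
    then have new: "w k \<notin> fun_space.span (w ` {..<k})"
      using w(2) by auto
    then have "w k \<notin> w ` {..<k}"
      using fun_space.span_superset[of "w ` {..<k}"] by auto
    then show ?case
      using Suc fun_space.independent_insertI[OF new] by (simp add: lessThan_Suc)
  qed
  moreover have "w ` {..<k} \<subseteq> fun_space.span (unit_vec ` B)" for k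
    using w(1) piece_free[OF N] free_module_subset_span[OF B] by blast
  moreover have "finite (unit_vec ` B :: ('b \<Rightarrow> 'k) set)"
    using B by simp
  ultimately have "k \<le> card (unit_vec ` B :: ('b \<Rightarrow> 'k) set)" for k
    using fun_space.independent_span_bound by metis
  then show False
    using not_less_eq_eq by blast
qed

interpretation multi: grading "multi_deg :: ('n \<Rightarrow>\<^sub>0 nat) \<Rightarrow> _"
  by standard (simp add: multi_deg_def)

lemma graded_submodule_sum:
  assumes "graded_submodule dB B N" "\<And>i. i \<in> T \<Longrightarrow> v i \<in> N"
  shows "(\<Sum>i\<in>T. v i) \<in> N"
  using assms(2)
proof (induction T rule: infinite_finite_induct)
  case (insert i T)
  then have "v i \<in> N" "(\<Sum>i\<in>T. v i) \<in> N"
    by simp_all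
  then have "v i + (\<Sum>i\<in>T. v i) \<in> N"
    using assms(1) by (simp only: graded_submodule_def)
  then show ?case
    by (simp only: sum.insert[OF insert.hyps])
qed (use assms(1) in \<open>simp_all add: graded_submodule_def\<close>)

lemma sum_hom_comp:
  fixes v :: "'b \<Rightarrow> ('n, 'k::field) mpoly"
  assumes "finite B" "v \<in> free_module B"
  shows "v = (\<Sum>a\<in>(\<Union>b\<in>B. (\<lambda>m. m + dB b) ` keys (v b)). hom_comp multi_deg dB a v)"
    (is "v = (\<Sum>a\<in>?T. _)")
proof
  fix b
  have fin: "finite ?T"
    using assms(1) by simp
  show "v b = (\<Sum>a\<in>?T. hom_comp multi_deg dB a v) b"
  proof (rule poly_mapping_eqI)
    fix m
    have "lookup ((\<Sum>a\<in>?T. hom_comp multi_deg dB a v) b) m = (\<Sum>a\<in>?T. if a = m + dB b then lookup (v b) m else 0)"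
      unfolding sum_fun_app lookup_sum
      by (intro sum.cong) (auto simp: hom_comp_def lookup_restrict_keys multi_deg_def)
    also have "\<dots> = lookup (v b) m"
    proof (cases "m \<in> keys (v b)")
      case True
      then have "b \<in> B"
        using assms(2) by (force simp: free_module_def)
      then have "m + dB b \<in> ?T"
        using True by blast
      then show ?thesis
        using fin by simp
    next
      case False
      then have "lookup (v b) m = 0"
        by (simp add: in_keys_iff)
      then show ?thesis
        by (simp cong: if_cong)
    qed
    finally show "lookup (v b) m = lookup ((\<Sum>a\<in>?T. hom_comp multi_deg dB a v) b) m" ..
  qed
qed

lemma coeffs_sum: "coeffs dB a (\<Sum>i\<in>T. v i) = (\<Sum>i\<in>T. coeffs dB a (v i))"
  by (simp add: coeffs_def fun_eq_iff sum_fun_app lookup_sum)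

text \<open>Graded Nakayama: bases of the pieces modulo \<open>lower_span\<close> generate
  \<open>N\<close> by induction on the total degree, and their independence modulo
  \<open>lower_span\<close> forces all entries of a relation into the maximal ideal.\<close>

lemma minimal_generators_exist:
  fixes N :: "('b \<Rightarrow> ('n::finite, 'k::field) mpoly) set"
  assumes N: "graded_submodule dB B N" and B: "finite B"
  shows "\<exists>(n::nat) dE X. graded_matrix multi_deg {..<n} dE B dB X \<and>
    mat_app {..<n} X ` free_module {..<n} = N \<and>
    (\<forall>v\<in>free_module {..<n}. mat_app {..<n} X v = 0 \<longrightarrow> (\<forall>e. lookup (v e) 0 = 0))"
proof -
  have "\<exists>S. quotient_basis (piece dB N a) (lower_span dB N a) S" for a
  proof (rule quotient_basis_exists[OF subspace_piece[OF N] subspace_lower_span lower_span_subset[OF N]])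
    show "finite (unit_vec ` B :: ('b \<Rightarrow> 'k) set)"
      using B by simp
    show "piece dB N a \<subseteq> fun_space.span (unit_vec ` B)"
      by (rule subset_trans[OF piece_free[OF N] free_module_subset_span[OF B]])
  qed
  then obtain S where S: "\<And>a. quotient_basis (piece dB N a) (lower_span dB N a) (S a)"
    by metis
  have finS: "finite (S a)" and SN: "S a \<subseteq> piece dB N a" for a
    using S[of a] by (simp_all add: quotient_basis_def)
  have nonempty: "piece dB N a \<noteq> {}" for a
    using fun_space.subspace_0[OF subspace_piece[OF N]] by blast
  \<comment> \<open>Degrees without new generators contribute nothing, so restricting
    \<open>P\<close> to the finitely many others loses no generator.\<close>
  have S_empty: "S a = {}" if eq: "piece dB N a = lower_span dB N a" for a
  proof (rule ccontr)
    assume "S a \<noteq> {}"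
    then obtain s where s: "s \<in> S a" by blast
    have "lin_comb (S a) (unit_vec s) = s"
    proof
      fix b
      have "(\<Sum>t\<in>S a. unit_vec s t * t b) = (\<Sum>t\<in>S a. if t = s then s b else 0)"
        by (intro sum.cong) (auto simp: unit_vec_def)
      then show "lin_comb (S a) (unit_vec s) b = s b"
        using s finS by (simp add: lin_comb_def)
    qed
    then have "unit_vec s = (0 :: ('b \<Rightarrow> 'k) \<Rightarrow> 'k)"
      using s SN[of a] eq by (intro quotient_basis_zero[OF subspace_lower_span S]) auto
    then show False
      by (metis unit_vec_def zero_fun_apply zero_neq_one)
  qed
  define P where "P = (SIGMA a:{a. piece dB N a \<noteq> lower_span dB N a}. S a)"
  have in_P: "(a, s) \<in> P \<longleftrightarrow> s \<in> S a" for a s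
    using S_empty by (auto simp: P_def)
  have "finite P"
    unfolding P_def using finite_new_degrees[OF N B] finS by (rule finite_SigmaI)
  then obtain g where g: "bij_betw g {..<card P} P"
    using ex_bij_betw_nat_finite[of P] by (auto simp: atLeast0LessThan)
  define n where "n = card P"
  define E where "E = {..<n}"
  define dE where "dE = (\<lambda>e. fst (g e))"
  define sE where "sE = (\<lambda>e. snd (g e))"
  define X where "X = (\<lambda>b e. if e \<in> E then homog dB (dE e) (sE e) b else 0)"
  have finE: "finite E"
    by (simp add: E_def)
  have sE: "sE e \<in> S (dE e)" if "e \<in> E" for e
    using bij_betwE[OF g] that in_P[of "dE e" "sE e"] by (simp add: E_def n_def dE_def sE_def)
  have gen: "\<exists>e\<in>E. dE e = a \<and> sE e = s" if s: "s \<in> S a" for a s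
  proof -
    have "(a, s) \<in> g ` E"
      using g s in_P by (simp add: bij_betw_def E_def n_def)
    then obtain e where "e \<in> E" "g e = (a, s)"
      by (metis imageE)
    then show ?thesis
      by (intro bexI[of _ e]) (simp_all add: dE_def sE_def)
  qed
  have uniq: "e = e'" if "e \<in> E" "e' \<in> E" "dE e = dE e'" "sE e = sE e'" for e e'
    using inj_onD[OF bij_betw_imp_inj_on[OF g], of e e'] that
    by (simp add: E_def n_def dE_def sE_def prod_eq_iff)
  have sN: "sE e \<in> piece dB N (dE e)" if "e \<in> E" for e
    using sE[OF that] SN by blast
  have hN: "homog dB (dE e) (sE e) \<in> N" if "e \<in> E" for e
    by (rule piece_homog[OF N sN[OF that]])
  have X_app: "mat_app E X v = (\<Sum>e\<in>E. (\<lambda>b. v e * homog dB (dE e) (sE e) b))" for v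
    by (auto simp: mat_app_def X_def fun_eq_iff sum_fun_app mult.commute intro!: sum.cong)
  have graded: "graded_matrix multi_deg E dE B dB X"
    unfolding graded_matrix_def
  proof (intro conjI allI impI ballI)
    fix b e assume "b \<notin> B \<or> e \<notin> E"
    then show "X b e = 0"
      using hN N by (fastforce simp: X_def graded_submodule_def free_module_def)
  next
    fix b e m assume "b \<in> B" "e \<in> E" "m \<in> keys (X b e)"
    then have "exp_le (dB b) (dE e)" "m = dE e - dB b"
      by (auto simp: X_def homog_def split: if_splits)
    then show "multi_deg m + dB b = dE e"
      using exp_le_add_diff by (simp add: multi_deg_def add.commute)
  qed
  define Im where "Im = mat_app E X ` free_module E"
  have Im_add: "u + v \<in> Im" if uv: "u \<in> Im" "v \<in> Im" for u v
  proof -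
    obtain u' v' where "u' \<in> free_module E" "u = mat_app E X u'" "v' \<in> free_module E" "v = mat_app E X v'"
      using uv by (auto simp: Im_def)
    then show ?thesis
      unfolding Im_def using free_module_add by (intro image_eqI[of _ _ "u' + v'"]) (simp_all only: mat_app_add)
  qed
  have Im_scale: "(\<lambda>b. r * v b) \<in> Im" if v: "v \<in> Im" for r v
  proof -
    obtain v' where "v' \<in> free_module E" "v = mat_app E X v'"
      using v by (auto simp: Im_def)
    then show ?thesis
      unfolding Im_def
      by (intro image_eqI[of _ _ "\<lambda>e. r * v' e"]) (simp_all only: mat_app_scale free_module_scale)
  qed
  have Im_0: "0 \<in> Im"
    unfolding Im_def by (intro image_eqI[of _ _ 0]) simp_all
  have Im_gen: "homog dB a s \<in> Im" if s: "s \<in> S a" for a s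
  proof -
    obtain e where e: "e \<in> E" "dE e = a" "sE e = s"
      using gen[OF s] by blast
    then have "homog dB a s = mat_app E X (unit_vec e)"
      using finE by (simp add: mat_app_unit_vec X_def)
    then show ?thesis
      using e(1) by (simp add: Im_def)
  qed
  \<comment> \<open>The total degree only serves as a measure: a proper divisor has strictly smaller
    \<open>standard_deg\<close>, so the lower pieces are covered by induction and the rest is a
    combination of \<open>S a\<close>.\<close>
  have Im_piece: "homog dB a c \<in> Im" if "c \<in> piece dB N a" for a c
    using that
  proof (induction "standard_deg a" arbitrary: a c rule: less_induct)
    case less
    let ?V = "{c. homog dB a c \<in> Im}"
    have V: "fun_space.subspace ?V"
      by (rule fun_space.subspaceI) (simp_all add: Im_0 homog_add Im_add homog_scale Im_scale)
    have "piece dB N a' \<subseteq> ?V" if a': "exp_le a' a" "a' \<noteq> a" for a'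
    proof
      fix c assume c: "c \<in> piece dB N a'"
      obtain i where "lookup a' i \<noteq> lookup a i"
        using a'(2) by (metis poly_mapping_eqI)
      then have "lookup a' i < lookup a i"
        using a'(1) by (simp add: exp_le_def le_neq_implies_less)
      then have "standard_deg a' < standard_deg a"
        using a'(1) unfolding standard_deg_def by (intro sum_strict_mono_ex1) (auto simp: exp_le_def)
      then have "homog dB a' c \<in> Im"
        using less.hyps c by blast
      then show "c \<in> ?V"
        by (simp add: homog_shift[OF a'(1) piece_support[OF c]] Im_scale)
    qed
    then have low: "lower_span dB N a \<subseteq> ?V"
      unfolding lower_span_def by (intro fun_space.span_minimal[OF _ V]) blast
    have "S a \<subseteq> ?V"
      using Im_gen by blast
    obtain d where d: "c - lin_comb (S a) d \<in> lower_span dB N a"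
      using quotient_basis_repr[OF subspace_lower_span S less.prems] .
    have "(c - lin_comb (S a) d) + lin_comb (S a) d \<in> ?V"
      by (rule fun_space.subspace_add[OF V subsetD[OF low d] lin_comb_in_subspace[OF V \<open>S a \<subseteq> ?V\<close>]])
    then show ?case by simp
  qed
  have "mat_app E X v \<in> N" for v
    unfolding X_app
    using N hN by (intro graded_submodule_sum[OF N]) (simp add: graded_submodule_def)
  moreover have "v \<in> Im" if v: "v \<in> N" for v
  proof -
    have "homog dB a (coeffs dB a v) \<in> Im" for a
      using v by (intro Im_piece) (simp add: piece_def)
    then have "(\<Sum>a\<in>T. hom_comp multi_deg dB a v) \<in> Im" for T
      unfolding hom_comp_eq_homog
      by (induction T rule: infinite_finite_induct)
        (simp_all only: sum.infinite sum.empty sum.insert not_False_eq_True Im_0 Im_add)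
    moreover have "v \<in> free_module B"
      using N v by (auto simp: graded_submodule_def)
    ultimately show ?thesis
      by (subst sum_hom_comp[OF B, of v dB]) simp_all
  qed
  ultimately have "Im = N"
    unfolding Im_def by blast
  moreover have "lookup (v e0) 0 = 0" if v: "v \<in> free_module E" "mat_app E X v = 0" for v e0
  proof (cases "e0 \<in> E")
    case False
    then show ?thesis
      using v(1) by (simp add: free_module_def)
  next
    case True
    \<comment> \<open>In degree \<open>dE e0\<close> the generator \<open>e0\<close> contributes
      through the constant term of \<open>v e0\<close>, and likewise every generator of that degree;
      the other generators contribute elements of \<open>lower_span\<close> or nothing.\<close>
    define a where "a = dE e0"
    define k where "k = (\<lambda>e. if exp_le (dE e) a then lookup (v e) (a - dE e) else 0)"
    define E1 where "E1 = {e \<in> E. dE e = a}"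
    have "coeffs dB a (\<lambda>b. v e * homog dB (dE e) (sE e) b) = (\<lambda>b. k e * sE e b)" if "e \<in> E" for e
      unfolding k_def by (rule coeffs_mult_homog[OF piece_support[OF sN[OF that]]])
    then have "coeffs dB a (mat_app E X v) = (\<Sum>e\<in>E. (\<lambda>b. k e * sE e b))"
      unfolding X_app coeffs_sum by (rule sum.cong[OF refl])
    moreover have "coeffs dB a (mat_app E X v) = 0"
      unfolding v(2) by (simp add: coeffs_def fun_eq_iff)
    ultimately have total: "(\<Sum>e\<in>E. (\<lambda>b. k e * sE e b)) = 0"
      by simp
    have "(\<lambda>b. k e * sE e b) \<in> lower_span dB N a" if e: "e \<in> E - E1" for e
    proof (cases "exp_le (dE e) a")
      case True
      then have "sE e \<in> lower_span dB N a"
        using e sN[of e] piece_subset_lower_span[of "dE e" a dB N] by (auto simp: E1_def)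
      then show ?thesis
        by (rule fun_space.subspace_scale[OF subspace_lower_span])
    next
      case False
      then show ?thesis
        using fun_space.subspace_0[OF subspace_lower_span] by (simp add: k_def zero_fun_def)
    qed
    then have rest: "(\<Sum>e\<in>E - E1. (\<lambda>b. k e * sE e b)) \<in> lower_span dB N a"
      by (rule fun_space.subspace_sum[OF subspace_lower_span])
    have "E1 \<subseteq> E"
      by (auto simp: E1_def)
    then have "(\<Sum>e\<in>E - E1. (\<lambda>b. k e * sE e b)) + (\<Sum>e\<in>E1. (\<lambda>b. k e * sE e b)) = 0"
      using total sum.subset_diff[OF _ finE, of E1 "\<lambda>e b. k e * sE e b"] by simp
    then have "(\<Sum>e\<in>E1. (\<lambda>b. k e * sE e b)) = - (\<Sum>e\<in>E - E1. (\<lambda>b. k e * sE e b))"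
      by (simp only: add_eq_0_iff)
    then have low: "(\<Sum>e\<in>E1. (\<lambda>b. k e * sE e b)) \<in> lower_span dB N a"
      using fun_space.subspace_neg[OF subspace_lower_span rest] by simp
    have bij: "bij_betw sE E1 (S a)"
      unfolding bij_betw_def
    proof
      show "inj_on sE E1"
        using uniq by (auto simp: inj_on_def E1_def)
      show "sE ` E1 = S a"
        using sE gen by (auto simp: E1_def image_iff) metis
    qed
    \<comment> \<open>The coefficients \<open>k\<close> are indexed by generators, those of a
      quotient basis by vectors; within one degree \<open>sE\<close> is a bijection, so they can be
      transported.\<close>
    define c where "c = (\<lambda>s. if s \<in> S a then k (inv_into E1 sE s) else 0)"
    have c_sE: "c (sE e) = k e" if "e \<in> E1" for e
      using that bij by (auto simp: c_def bij_betw_def inv_into_f_f)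
    have "lin_comb (S a) c = (\<Sum>e\<in>E1. (\<lambda>b. k e * sE e b))"
      unfolding lin_comb_eq sum.reindex_bij_betw[OF bij, symmetric] by (simp add: c_sE cong: sum.cong)
    then have "c = 0"
      using low nonempty by (intro quotient_basis_zero[OF subspace_lower_span S]) (auto simp: c_def free_module_def)
    then have "k e0 = 0"
      using c_sE[of e0] True by (simp add: E1_def a_def)
    then show ?thesis
      by (simp add: k_def a_def)
  qed
  ultimately show ?thesis
    using graded unfolding Im_def E_def by blast
qed

section \<open>Minimal resolutions by covering successive kernels\<close>

lemma graded_submodule_kernel:
  fixes A :: "'c \<Rightarrow> 'b \<Rightarrow> ('n, 'k::field) mpoly"
  assumes A: "graded_matrix multi_deg B dB C dC A"
  shows "graded_submodule dB B {v \<in> free_module B. mat_app B A v = 0}"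
proof -
  have "mat_app B A (hom_comp multi_deg dB j v) = 0" if "mat_app B A v = 0" for j v
    unfolding multi.hom_comp_mat_app[OF A, symmetric] that by (simp add: hom_comp_def fun_eq_iff)
  then show ?thesis
    by (auto simp: graded_submodule_def mat_app_add mat_app_scale free_module_scale simp del: plus_fun_apply)
qed

text \<open>The polynomials all of whose restrictions stay in \<open>L\<close> form an ideal, and it
  contains the monomial generators because the restriction of a monomial is itself or zero.\<close>

lemma restrict_keys_ideal:
  assumes L: "monomial_ideal L" and f: "f \<in> L"
  shows "restrict_keys P f \<in> L"
proof -
  obtain S where S: "S \<subseteq> range monomial" "L = ring_module.span S"
    using L by (auto simp: monomial_ideal_def ideal_gen_def)
  \<comment> \<open>All sets \<open>P\<close> are quantified at once, since pulling a restriction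
    past multiplication by a monomial replaces \<open>P\<close> by a translate.\<close>
  let ?T = "{f. \<forall>P. restrict_keys P f \<in> L}"
  have "restrict_keys P (Poly_Mapping.single t c * f)
      = Poly_Mapping.single t c * restrict_keys {m. t + m \<in> P} f" for P t c and f :: "('a, 'b) mpoly"
  proof -
    let ?Q = "{m. t + m \<in> P}"
    have "keys (Poly_Mapping.single t c) \<subseteq> {t}" by simp
    then have "keys (Poly_Mapping.single t c * restrict_keys ?Q f) \<subseteq> P"
      "keys (Poly_Mapping.single t c * restrict_keys (- ?Q) f) \<inter> P = {}"
      using keys_mult[of "Poly_Mapping.single t c" "restrict_keys ?Q f"]
        keys_mult[of "Poly_Mapping.single t c" "restrict_keys (- ?Q) f"]
      by (fastforce simp: keys_restrict_keys)+
    moreover have "Poly_Mapping.single t c * f = Poly_Mapping.single t c * restrict_keys ?Q f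
        + Poly_Mapping.single t c * restrict_keys (- ?Q) f"
      by (metis distrib_left restrict_keys_split)
    ultimately show ?thesis
      by (simp add: restrict_keys_add restrict_keys_id restrict_keys_eq_0)
  qed
  note restrict_single = this
  have "ring_module.subspace ?T"
  proof (rule ring_module.subspaceI)
    show "0 \<in> ?T"
      using S(2) ring_module.span_zero by simp
    show "f + g \<in> ?T" if "f \<in> ?T" "g \<in> ?T" for f g
      using that unfolding S(2) by (auto simp: restrict_keys_add intro: ring_module.span_add)
    show "r * f \<in> ?T" if f: "f \<in> ?T" for r f
    proof
      show "\<forall>P. restrict_keys P (r * f) \<in> L"
      proof
        fix P
        have "restrict_keys P (r * f) = (\<Sum>t\<in>keys r. restrict_keys P (Poly_Mapping.single t (lookup r t) * f))"
          by (subst poly_mapping_sum_singles[of r]) (simp add: sum_distrib_right restrict_keys_sum)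
        also have "\<dots> \<in> L"
          unfolding restrict_single using f S(2)
          by (auto intro!: ring_module.span_sum ring_module.span_scale)
        finally show "restrict_keys P (r * f) \<in> L" .
      qed
    qed
  qed
  moreover have "S \<subseteq> ?T"
  proof (intro subsetI CollectI allI)
    fix s P assume s: "s \<in> S"
    then obtain m where m: "s = monomial m"
      using S(1) by blast
    have "restrict_keys P s = s \<or> restrict_keys P s = 0"
      by (cases "m \<in> P") (auto simp: m monomial_def intro!: restrict_keys_id restrict_keys_eq_0)
    then show "restrict_keys P s \<in> L"
      using s S(2) ring_module.span_base ring_module.span_zero by metis
  qed
  ultimately have "L \<subseteq> ?T"
    unfolding S(2) by (intro ring_module.span_minimal)
  then show ?thesis
    using f by blast
qed

lemma subspace_monomial_ideal: "monomial_ideal L \<Longrightarrow> ring_module.subspace L"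
  by (auto simp: monomial_ideal_def ideal_gen_def)

text \<open>Stated for ideals stable under restrictions, so that it applies to
  \<open>J \<inter> K\<close> directly. Each kernel is again a multigraded submodule of a free
  module of finite rank and is covered by its minimal generators.\<close>

lemma multigraded_minimal_resolution_exists:
  fixes L :: "('n::finite, 'k::field) mpoly set"
  assumes L: "ring_module.subspace L" and restrict: "\<And>P f. f \<in> L \<Longrightarrow> restrict_keys P f \<in> L"
  shows "\<exists>F :: (nat, 'n \<Rightarrow>\<^sub>0 nat, ('n, 'k) mpoly, ('n, 'k) mpoly) aug_complex. minimal_resolution multi_deg L F"
proof -
  let ?min = "\<lambda>K. \<forall>v\<in>K. \<forall>e. lookup (v e) 0 = 0"
  let ?ker = "\<lambda>n X. {v \<in> free_module {..<n}. mat_app {..<n} X v = 0}"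
  define N0 where "N0 = {v :: unit \<Rightarrow> ('n, 'k) mpoly. v () \<in> L}"
  have "graded_submodule (\<lambda>_. 0) UNIV N0"
    using ring_module.subspace_0[OF L] ring_module.subspace_add[OF L] ring_module.subspace_scale[OF L] restrict
    by (simp add: graded_submodule_def N0_def free_module_def hom_comp_def)
  from minimal_generators_exist[OF this] obtain n0 d0 X0 where
    X0: "graded_matrix multi_deg {..<n0::nat} d0 UNIV (\<lambda>_. 0) X0"
    "mat_app {..<n0} X0 ` free_module {..<n0} = N0"
    "\<forall>v\<in>free_module {..<n0}. mat_app {..<n0} X0 v = 0 \<longrightarrow> (\<forall>e. lookup (v e) 0 = 0)"
    by auto
  define s0 :: "nat \<times> (nat \<Rightarrow> 'n \<Rightarrow>\<^sub>0 nat) \<times> (nat \<Rightarrow> ('n, 'k) mpoly) set \<times> (nat \<Rightarrow> nat \<Rightarrow> ('n, 'k) mpoly)"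
    where "s0 = (n0, d0, ?ker n0 X0, 0)"
  \<comment> \<open>A state holds the rank, the degrees, the kernel to be covered next and the
    matrix leading to the previous state. The start has no previous state: \<open>s0\<close> carries
    a zero matrix, and the augmentation \<open>X0\<close> takes its place. The clause for
    \<open>i = 0\<close> ties the sequence to that start.\<close>
  define P where "P = (\<lambda>(i::nat) s. case s of (n, d, K, X) \<Rightarrow>
    graded_submodule d {..<n} K \<and> ?min K \<and> (i = 0 \<longrightarrow> s = s0))"
  define Q where "Q = (\<lambda>(n :: nat, d, K, X :: nat \<Rightarrow> nat \<Rightarrow> ('n, 'k) mpoly)
      (n' :: nat, d', K', X' :: nat \<Rightarrow> nat \<Rightarrow> ('n, 'k) mpoly).
    graded_matrix multi_deg {..<n'} d' {..<n} d X' \<and> mat_app {..<n'} X' ` free_module {..<n'} = K \<and>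
    K' = ?ker n' X')"
  have "\<exists>f. \<forall>i. P i (f i) \<and> Q (f i) (f (Suc i))"
  proof (rule dependent_nat_choice)
    show "\<exists>s. P 0 s"
      using graded_submodule_kernel[OF X0(1)] X0(3) by (intro exI[of _ s0]) (simp add: P_def s0_def)
  next
    fix s and i :: nat
    assume "P i s"
    then obtain n d K X where s: "s = (n, d, K, X)" "graded_submodule d {..<n} K"
      by (cases s) (auto simp: P_def)
    from minimal_generators_exist[OF s(2)] obtain n' d' X' where
      X': "graded_matrix multi_deg {..<n'::nat} d' {..<n} d X'"
      "mat_app {..<n'} X' ` free_module {..<n'} = K"
      "\<forall>v\<in>free_module {..<n'}. mat_app {..<n'} X' v = 0 \<longrightarrow> (\<forall>e. lookup (v e) 0 = 0)"
      by auto
    show "\<exists>t. P (Suc i) t \<and> Q s t"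
      using graded_submodule_kernel[OF X'(1)] X' s(1)
      by (intro exI[of _ "(n', d', ?ker n' X', X')"]) (simp add: P_def Q_def)
  qed
  then obtain f where f: "\<And>i. P i (f i)" "\<And>i. Q (f i) (f (Suc i))"
    by blast
  define n where "n = (\<lambda>i. fst (f i))"
  define d where "d = (\<lambda>i. fst (snd (f i)))"
  define K where "K = (\<lambda>i. fst (snd (snd (f i))))"
  define X where "X = (\<lambda>i. snd (snd (snd (f (Suc i)))))"
  have f0: "n 0 = n0" "d 0 = d0" "K 0 = ?ker n0 X0"
    using f(1)[of 0] by (auto simp: P_def n_def d_def K_def s0_def split: prod.splits)
  have min: "?min (K i)" for i
    using f(1)[of i] by (simp add: P_def K_def case_prod_beta)
  have X: "graded_matrix multi_deg {..<n (Suc i)} (d (Suc i)) {..<n i} (d i) (X i)"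
    "mat_app {..<n (Suc i)} (X i) ` free_module {..<n (Suc i)} = K i"
    "K (Suc i) = ?ker (n (Suc i)) (X i)" for i
    using f(2)[of i] by (simp_all add: Q_def n_def d_def K_def X_def case_prod_beta)
  define F where "F = \<lparr>gens = (\<lambda>i. {..<n i}), gdeg = d, dmat = X, aug = (\<lambda>b. X0 () b)\<rparr>"
  have F_simps: "gens F i = {..<n i}" "gdeg F i = d i" "dmat F i = X i" "aug F b = X0 () b" for i b
    by (simp_all add: F_def)
  have dmap_F: "dmap F i = mat_app {..<n (Suc i)} (X i)" for i
    by (simp add: dmap_def F_simps)
  have aug_F: "aug_map (*) F v = mat_app {..<n0} X0 v ()" for v
    by (simp add: aug_map_def F_simps f0 mat_app_def mult.commute)
  have ker0: "aug_map (*) F v = 0 \<longleftrightarrow> mat_app {..<n0} X0 v = 0" for v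
    by (auto simp: aug_F fun_eq_iff)
  have "graded_resolution multi_deg L F"
    unfolding graded_resolution_def
  proof (intro conjI allI)
    show "\<forall>b\<in>gens F 0. \<forall>m\<in>keys (aug F b). multi_deg m = gdeg F 0 b"
      using X0(1) by (simp add: graded_matrix_def F_simps f0)
    have "aug_map (*) F ` free_module {..<n0} = (\<lambda>v. v ()) ` N0"
      unfolding X0(2)[symmetric] image_image aug_F ..
    also have "\<dots> = L"
      by (auto simp: N0_def image_iff intro!: exI[of _ "\<lambda>_. x" for x])
    finally show "aug_map (*) F ` free_module (gens F 0) = L"
      by (simp add: F_simps f0)
    show "dmap F 0 ` free_module (gens F 1) = {v \<in> free_module (gens F 0). aug_map (*) F v = 0}"
      using X(2)[of 0] by (simp add: dmap_F F_simps f0 ker0)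
    show "dmap F (Suc i) ` free_module (gens F (Suc (Suc i)))
        = {v \<in> free_module (gens F (Suc i)). \<forall>p. dmap F i v p = 0}" for i
      using X(2)[of "Suc i"] X(3)[of i] by (simp add: dmap_F F_simps fun_eq_iff)
  qed (use X(1) in \<open>simp_all add: F_simps\<close>)
  \<comment> \<open>The images of the differentials are the kernels \<open>K i\<close>, and vectors
    in the kernel of a minimal cover have no constant terms.\<close>
  moreover have "minimal_complex F"
    unfolding minimal_complex_def irrelevant_ideal_eq
  proof (intro allI ballI CollectI)
    fix i p and v :: "nat \<Rightarrow> ('n, 'k) mpoly"
    assume "v \<in> free_module (gens F (Suc i))"
    then have "dmap F i v \<in> K i"
      unfolding X(2)[symmetric] dmap_F F_simps by (rule imageI)
    then show "lookup (dmap F i v p) 0 = 0"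
      using min by blast
  qed
  ultimately show ?thesis
    unfolding minimal_resolution_def by blast
qed

text \<open>A multigraded resolution is graded with respect to every coarser grading.\<close>

lemma minimal_resolution_exists:
  fixes L :: "('n::finite, 'k::field) mpoly set" and deg :: "('n \<Rightarrow>\<^sub>0 nat) \<Rightarrow> 'd::cancel_comm_monoid_add"
  assumes "grading deg" "ring_module.subspace L" "\<And>P f. f \<in> L \<Longrightarrow> restrict_keys P f \<in> L"
  shows "\<exists>F :: (nat, 'd, ('n, 'k) mpoly, ('n, 'k) mpoly) aug_complex. minimal_resolution deg L F"
proof -
  interpret grading deg by fact
  obtain F :: "(nat, 'n \<Rightarrow>\<^sub>0 nat, ('n, 'k) mpoly, ('n, 'k) mpoly) aug_complex"
    where F: "minimal_resolution multi_deg L F"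
    using multigraded_minimal_resolution_exists[OF assms(2,3)] by blast
  define G where "G = \<lparr>gens = gens F, gdeg = (\<lambda>i b. deg (gdeg F i b)), dmat = dmat F, aug = aug F\<rparr>"
  have G_simps: "gens G = gens F" "gdeg G i b = deg (gdeg F i b)" "dmat G = dmat F" "aug G = aug F" for i b
    by (simp_all add: G_def)
  have maps: "dmap G = dmap F" "aug_map (*) G = aug_map (*) F"
    by (simp_all add: fun_eq_iff dmap_def aug_map_def G_simps)
  have "graded_matrix deg (gens F (Suc i)) (gdeg G (Suc i)) (gens F i) (gdeg G i) (dmat F i)"
    if "graded_matrix multi_deg (gens F (Suc i)) (gdeg F (Suc i)) (gens F i) (gdeg F i) (dmat F i)" for i
    using that by (simp add: graded_matrix_def G_simps multi_deg_def deg_add[symmetric])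
  then have "minimal_resolution deg L G"
    using F by (simp add: minimal_resolution_def minimal_complex_def graded_resolution_def maps G_simps multi_deg_def)
  then show ?thesis by blast
qed

section \<open>The equivalences\<close>

text \<open>The union over a class is a single coset because chain maps send boundaries to
  boundaries; it is the zero class exactly if the image of a representative is a boundary. This
  turns \<open>Tor_phi\<close> into the condition of \<open>tor_zero_map\<close>.\<close>

lemma Tor_phi_component:
  fixes F :: "('b, 'd::cancel_comm_monoid_add, ('n, 'k::field) mpoly, ('n, 'k) mpoly) aug_complex"
    and G :: "('c, 'd, ('n, 'k) mpoly, ('n, 'k) mpoly) aug_complex"
  assumes "grading deg" and \<Phi>: "chain_lift deg F G c \<Phi>"
  shows "(\<Union>u\<in>fcoset (tensor_boundaries F i j) v. fcoset (tensor_boundaries G i j) (tensor_map F \<Phi> i u))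
      = fcoset (tensor_boundaries G i j) (\<lambda>_. 0)
    \<longleftrightarrow> tensor_map F \<Phi> i v \<in> tensor_boundaries G i j"
proof -
  interpret grading deg by fact
  let ?B = "tensor_boundaries G i j" and ?f = "tensor_map F \<Phi> i"
  have sub: "w - ?f v \<in> ?B" if "w - ?f u \<in> ?B" "u - v \<in> tensor_boundaries F i j" for u w
    using tensor_boundaries_add[OF that(1) tensor_map_boundaries[OF \<Phi> that(2)]]
    by (simp add: mat_app_diff del: plus_fun_apply)
  have "v \<in> fcoset (tensor_boundaries F i j) v"
    by (simp add: fcoset_iff)
  then have "fcoset ?B (?f v) \<subseteq> (\<Union>u\<in>fcoset (tensor_boundaries F i j) v. fcoset ?B (?f u))"
    by (rule UN_upper)
  then have "(\<Union>u\<in>fcoset (tensor_boundaries F i j) v. fcoset ?B (?f u)) = fcoset ?B (?f v)"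
    using sub by (auto simp: fcoset_iff)
  moreover have "fcoset ?B (?f v) = fcoset ?B (\<lambda>_. 0) \<longleftrightarrow> ?f v \<in> ?B"
  proof
    assume "fcoset ?B (?f v) = fcoset ?B (\<lambda>_. 0)"
    moreover have "?f v \<in> fcoset ?B (?f v)"
      by (simp add: fcoset_iff)
    ultimately show "?f v \<in> ?B"
      by (simp add: fcoset_def)
  next
    assume v: "?f v \<in> ?B"
    have "u - ?f v \<in> ?B \<longleftrightarrow> u \<in> ?B" for u
      using tensor_boundaries_add[OF _ v, of "u - ?f v"] tensor_boundaries_diff[OF _ v, of u] by auto
    then show "fcoset ?B (?f v) = fcoset ?B (\<lambda>_. 0)"
      by (auto simp: fcoset_iff zero_fun_def[symmetric])
  qed
  ultimately show ?thesis by simp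
qed

text \<open>Everything is compared with one auxiliary choice of minimal resolutions and a lift.
  Condition (a) does not mention that choice, and vanishing on Tor can be moved to it from the
  resolutions fixed in the definition of Tor.\<close>

lemma betti_splitting_equivalences:
  fixes I J K :: "('n::finite, 'k::field) mpoly set" and deg :: "('n \<Rightarrow>\<^sub>0 nat) \<Rightarrow> 'd::cancel_comm_monoid_add"
  assumes deg: "grading deg" and I: "monomial_ideal I" and J: "monomial_ideal J" and K: "monomial_ideal K"
    and sum: "I = J + K"
  shows "(betti_splitting deg I J K \<longleftrightarrow>
           (\<forall>i j. \<forall>c \<in> Tor deg i (J \<inter> K) j. Tor_phi deg J K i j c = (Tor_zero deg i J j, Tor_zero deg i K j)))
       \<and> (betti_splitting deg I J K \<longleftrightarrow> cone_gives_minimal_resolution deg I J K)"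
proof -
  interpret grading deg by fact
  have sub: "ring_module.subspace (J \<inter> K)"
    by (intro ring_module.subspace_inter subspace_monomial_ideal J K)
  obtain F0 :: "(nat, 'd, ('n, 'k) mpoly, ('n, 'k) mpoly) aug_complex" where F0: "minimal_resolution deg (J \<inter> K) F0"
    using minimal_resolution_exists[OF deg sub] restrict_keys_ideal[OF J] restrict_keys_ideal[OF K] by blast
  have ex: "\<exists>F :: (nat, 'd, ('n, 'k) mpoly, ('n, 'k) mpoly) aug_complex. minimal_resolution deg L F"
    if L: "monomial_ideal L" for L
    using minimal_resolution_exists[OF deg subspace_monomial_ideal[OF L]] restrict_keys_ideal[OF L] by blast
  obtain G0 :: "(nat, 'd, ('n, 'k) mpoly, ('n, 'k) mpoly) aug_complex" where G0: "minimal_resolution deg J G0"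
    using ex[OF J] by blast
  obtain H0 :: "(nat, 'd, ('n, 'k) mpoly, ('n, 'k) mpoly) aug_complex" where H0: "minimal_resolution deg K H0"
    using ex[OF K] by blast
  have chosen: "graded_resolution deg L (chosen_resolution deg L)"
    if "\<exists>F :: (nat, 'd, ('n, 'k) mpoly, ('n, 'k) mpoly) aug_complex. minimal_resolution deg L F" for L
    unfolding chosen_resolution_def using that by (intro someI_ex[of "graded_resolution deg L"]) (auto simp: minimal_resolution_def)
  note chosen_I = chosen[OF ex[OF I]] and chosen_J = chosen[OF ex[OF J]] and chosen_K = chosen[OF ex[OF K]]
  have chosen_JK: "graded_resolution deg (J \<inter> K) (chosen_resolution deg (J \<inter> K))"
    using chosen F0 by blast
  have betti_eq: "betti deg i L j = tensor_dim X i j"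
    if "graded_resolution deg L (chosen_resolution deg L)" "graded_resolution deg L X"
    for i j L and X :: "('x, 'd, ('n, 'k) mpoly, ('n, 'k) mpoly) aug_complex"
    unfolding betti_def by (rule tensor_dim_unique[OF that])
  have betti_min: "betti deg i L j = card (gens_deg X i j)"
    if "graded_resolution deg L (chosen_resolution deg L)" "minimal_resolution deg L X"
    for i j L and X :: "(nat, 'd, ('n, 'k) mpoly, ('n, 'k) mpoly) aug_complex"
    unfolding betti_def tensor_dim_unique[OF that(1) minimal_resolution_graded[OF that(2)]]
    by (rule minimal_tensor_dim[OF that(2)])

  \<comment> \<open>Stated for every choice of resolutions and lift: since the left-hand side
    mentions none of them, minimality of one cone implies minimality of all, as the quantifiers in
    (c) require.\<close>
  have a_iff: "betti_splitting deg I J K \<longleftrightarrow> minimal_resolution deg I (mapping_cone F (dsum_complex G H) \<Phi>)"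
    if F: "minimal_resolution deg (J \<inter> K) F" and G: "minimal_resolution deg J G"
      and H: "minimal_resolution deg K H" and \<Phi>: "phi_lift deg F (dsum_complex G H) \<Phi>"
    for F G H :: "(nat, 'd, ('n, 'k) mpoly, ('n, 'k) mpoly) aug_complex" and \<Phi>
  proof -
    let ?C = "mapping_cone F (dsum_complex G H) \<Phi>"
    have C: "graded_resolution deg I ?C"
      unfolding sum using F G H \<Phi> by (intro graded_resolution_cone minimal_resolution_graded)
    have "betti_splitting deg I J K \<longleftrightarrow> (\<forall>i j. tensor_dim ?C i j = card (gens_deg ?C i j))"
      unfolding betti_splitting_def betti_eq[OF chosen_I C] betti_min[OF chosen_J G] betti_min[OF chosen_K H]
        betti_min[OF chosen_JK F]
        card_gens_deg_cone[OF graded_resolution_finite[OF minimal_resolution_graded[OF F]]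
          graded_resolution_finite[OF minimal_resolution_graded[OF G]]
          graded_resolution_finite[OF minimal_resolution_graded[OF H]]] ..
    also have "\<dots> \<longleftrightarrow> minimal_resolution deg I ?C"
      using minimal_if_tensor_dim[OF C] minimal_tensor_dim by blast
    finally show ?thesis .
  qed

  have lift_exists: "\<exists>\<Phi>. phi_lift deg F (dsum_complex G H) \<Phi>"
    if F: "graded_resolution deg (J \<inter> K) F" and G: "graded_resolution deg J G" and H: "graded_resolution deg K H"
    for F G H :: "(nat, 'd, ('n, 'k) mpoly, ('n, 'k) mpoly) aug_complex"
  proof -
    obtain \<alpha> where \<alpha>: "chain_lift deg F G 1 \<alpha>"
      using chain_lift_exists[OF F G, of 1] by auto
    have "keys (- 1 :: ('n, 'k) mpoly) \<subseteq> {0}"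
      by (auto simp: in_keys_iff lookup_one when_def split: if_splits)
    then obtain \<beta> where \<beta>: "chain_lift deg F H (- 1) \<beta>"
      using chain_lift_exists[OF F H, of "- 1"] ring_module.subspace_neg[OF subspace_monomial_ideal[OF K]] by auto
    show ?thesis
      using \<alpha> \<beta> by (intro exI[of _ "\<lambda>i. case_sum (\<alpha> i) (\<beta> i)"])
        (simp add: phi_lift_dsum_iff graded_resolution_finite[OF F] graded_resolution_finite[OF G]
          graded_resolution_finite[OF H])
  qed

  obtain \<Phi>0 where \<Phi>0: "phi_lift deg F0 (dsum_complex G0 H0) \<Phi>0"
    using lift_exists[OF F0[THEN minimal_resolution_graded] G0[THEN minimal_resolution_graded]
        H0[THEN minimal_resolution_graded]] by blast
  \<comment> \<open>The data \<open>F0\<close>, \<open>G0\<close>, \<open>H0\<close> and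
    \<open>\<Phi>0\<close> keep the universal quantification in (c) from being vacuous.\<close>
  have c: "betti_splitting deg I J K \<longleftrightarrow> cone_gives_minimal_resolution deg I J K"
    unfolding cone_gives_minimal_resolution_def using a_iff F0 G0 H0 \<Phi>0 by metis

  let ?F = "chosen_resolution deg (J \<inter> K)" and ?G = "chosen_resolution deg J" and ?H = "chosen_resolution deg K"
  let ?\<Phi> = "chosen_lift deg J K"
  have \<Phi>: "phi_lift deg ?F (dsum_complex ?G ?H) ?\<Phi>"
    unfolding chosen_lift_def by (rule someI_ex[OF lift_exists[OF chosen_JK chosen_J chosen_K]])
  have lifts: "chain_lift deg ?F ?G 1 (\<lambda>i p. ?\<Phi> i (Inl p))" "chain_lift deg ?F ?H (- 1) (\<lambda>i p. ?\<Phi> i (Inr p))"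
    using \<Phi> by (simp_all add: phi_lift_dsum_iff graded_resolution_finite[OF chosen_JK]
        graded_resolution_finite[OF chosen_J] graded_resolution_finite[OF chosen_K])
  have lifts0: "chain_lift deg F0 G0 1 (\<lambda>i p. \<Phi>0 i (Inl p))" "chain_lift deg F0 H0 (- 1) (\<lambda>i p. \<Phi>0 i (Inr p))"
    using \<Phi>0 by (simp_all add: phi_lift_dsum_iff F0[THEN minimal_resolution_graded, THEN graded_resolution_finite]
        G0[THEN minimal_resolution_graded, THEN graded_resolution_finite]
        H0[THEN minimal_resolution_graded, THEN graded_resolution_finite])
  have lift_comp: "tensor_lift deg J K i v \<circ> Inl = tensor_map ?F (\<lambda>i p. ?\<Phi> i (Inl p)) i v"
    "tensor_lift deg J K i v \<circ> Inr = tensor_map ?F (\<lambda>i p. ?\<Phi> i (Inr p)) i v" for i v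
    unfolding tensor_lift_def mat_app_Inl mat_app_Inr by (simp_all add: const_mat_def)
  have "Tor_phi deg J K i j (fcoset (tensor_boundaries ?F i j) v) = (Tor_zero deg i J j, Tor_zero deg i K j)
    \<longleftrightarrow> tensor_map ?F (\<lambda>i p. ?\<Phi> i (Inl p)) i v \<in> tensor_boundaries ?G i j
      \<and> tensor_map ?F (\<lambda>i p. ?\<Phi> i (Inr p)) i v \<in> tensor_boundaries ?H i j" for i j v
    unfolding Tor_phi_def Tor_zero_def lift_comp prod.inject Tor_phi_component[OF deg lifts(1)]
      Tor_phi_component[OF deg lifts(2)] ..
  then have "(\<forall>i j. \<forall>c \<in> Tor deg i (J \<inter> K) j. Tor_phi deg J K i j c = (Tor_zero deg i J j, Tor_zero deg i K j))
    \<longleftrightarrow> tor_zero_map ?F ?G (\<lambda>i p. ?\<Phi> i (Inl p)) \<and> tor_zero_map ?F ?H (\<lambda>i p. ?\<Phi> i (Inr p))"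
    unfolding Tor_def quotient_space_def tor_zero_map_def by auto
  \<comment> \<open>The resolutions behind Tor need not be minimal; vanishing is moved to minimal
    ones, where it can be read off from matrix entries.\<close>
  also have "\<dots> \<longleftrightarrow> tor_zero_map F0 G0 (\<lambda>i p. \<Phi>0 i (Inl p)) \<and> tor_zero_map F0 H0 (\<lambda>i p. \<Phi>0 i (Inr p))"
    using tor_zero_map_transfer[OF chosen_JK minimal_resolution_graded[OF F0] chosen_J
        minimal_resolution_graded[OF G0] lifts(1) lifts0(1)]
      tor_zero_map_transfer[OF minimal_resolution_graded[OF F0] chosen_JK
        minimal_resolution_graded[OF G0] chosen_J lifts0(1) lifts(1)]
      tor_zero_map_transfer[OF chosen_JK minimal_resolution_graded[OF F0] chosen_K
        minimal_resolution_graded[OF H0] lifts(2) lifts0(2)]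
      tor_zero_map_transfer[OF minimal_resolution_graded[OF F0] chosen_JK
        minimal_resolution_graded[OF H0] chosen_K lifts0(2) lifts(2)]
    by blast
  also have "\<dots> \<longleftrightarrow> minimal_resolution deg I (mapping_cone F0 (dsum_complex G0 H0) \<Phi>0)"
    unfolding tor_zero_map_minimal[OF F0 G0 lifts0(1)] tor_zero_map_minimal[OF F0 H0 lifts0(2)] sum
      cone_minimal_iff[OF F0 G0 H0 \<Phi>0] ..
  also have "\<dots> \<longleftrightarrow> betti_splitting deg I J K"
    using a_iff[OF F0 G0 H0 \<Phi>0] by simp
  finally show ?thesis
    using c by blast
qed

lemma grading_standard_deg: "grading (standard_deg :: ('n::finite \<Rightarrow>\<^sub>0 nat) \<Rightarrow> nat)"
  by standard (simp add: standard_deg_def lookup_add sum.distrib)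

theorem proposition2p1:
  fixes I J K :: "('n::finite, 'k::field) mpoly set"
  assumes "monomial_ideal I" and "monomial_ideal J" and "monomial_ideal K"
    and "I = J + K"
    and "min_gens I = min_gens J \<union> min_gens K"
    and "min_gens J \<inter> min_gens K = {}"
  shows "((betti_splitting standard_deg I J K \<longleftrightarrow>
             (\<forall>i j. \<forall>c \<in> Tor standard_deg i (J \<inter> K) j.
                Tor_phi standard_deg J K i j c = (Tor_zero standard_deg i J j, Tor_zero standard_deg i K j)))
          \<and> (betti_splitting standard_deg I J K \<longleftrightarrow> cone_gives_minimal_resolution standard_deg I J K))
       \<and> ((betti_splitting multi_deg I J K \<longleftrightarrow>
             (\<forall>i j. \<forall>c \<in> Tor multi_deg i (J \<inter> K) j.
                Tor_phi multi_deg J K i j c = (Tor_zero multi_deg i J j, Tor_zero multi_deg i K j)))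
          \<and> (betti_splitting multi_deg I J K \<longleftrightarrow> cone_gives_minimal_resolution multi_deg I J K))"
  by (intro conjI[OF betti_splitting_equivalences[OF grading_standard_deg assms(1-4)]
        betti_splitting_equivalences[OF multi.grading_axioms assms(1-4)]])

end
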